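(* As $\varepsilon\to+0$, the spectrum of $\mathcal{H}_\varepsilon$ converges to that of $\mathcal{H}_0$ in the following sense. If $\lambda$ is not in the spectrum of $\mathcal{H}_0$, then $\lambda$ is not in the spectrum of $\mathcal{H}_\varepsilon$ for all sufficiently small $\varepsilon$. If $\lambda$ is in the spectrum of $\mathcal{H}_0$, then for each $\varepsilon$ there exists $\lambda_\varepsilon$ in the spectrum of $\mathcal{H}_\varepsilon$ such that $\lambda_\varepsilon\to\lambda$ as $\varepsilon\to+0$.
   Context: Geometry. Let $x=(x_1,x_2)$ be Cartesian coordinates in $\mathbb{R}^2$ and let $\Pi\subset\mathbb{R}^2$ be an unbounded domain with $C^3$-boundary such that: (i) $\Pi\subseteq\{x: 0<x_1<d\}$ for some $d>0$; (ii) for some $x_2^\infty>0$ and constants $a_\pm$ with $0\leqslant a_\pm<a_\pm+1\leqslant d$ one has $\Pi\cap\{x:\pm x_2>x_2^\infty\}=\{x: a_\pm<x_1<a_\pm+1,\ \pm x_2>x_2^\infty\}$ (two straight outlets of width one); (iii) for some $x_2^0>0$, $\partial\Pi\cap\{x:|x_2|<x_2^0\}=\{x: x_1=0,|x_2|<x_2^0\}\cup\{x: x_1=d,|x_2|<x_2^0\}$. Put $\Omega:=\bigcup_{k\in\mathbb{Z}}\{x:(x_1-kd,x_2)\in\Pi\}$ and, for small $\varepsilon>0$, $\Omega_\varepsilon:=\Omega\cup\bigcup_{k\in\mathbb{Z}}\{x: x_1=kd,\ |x_2|<\varepsilon\}$. Potential. $V$ is a real-valued function, infinitely differentiable in $\overline{\Omega}$,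 $d$-periodic in $x_1$, with $V(x)=0$ for $|x_2|>x_2^\infty$. Operators. For a domain $Q$, $\mathring{W}_2^1(Q)$ is the subspace of the Sobolev space $W_2^1(Q)$ consisting of functions with zero trace on $\partial Q$. $\mathcal{H}_\varepsilon=-\Delta+V$ with the Dirichlet condition is the self-adjoint operator in $L_2(\Omega_\varepsilon)$ associated with the closed lower-semibounded symmetric form $(\nabla u,\nabla v)_{L_2(\Omega_\varepsilon)}+(Vu,v)_{L_2(\Omega_\varepsilon)}$ on $\mathring{W}_2^1(\Omega_\varepsilon)$. $\mathcal{H}_0=-\Delta+V$ with the Dirichlet condition is the self-adjoint operator in $L_2(\Omega)$ associated with the form $(\nabla u,\nabla v)_{L_2(\Omega)}+(Vu,v)_{L_2(\Omega)}$ on $\mathring{W}_2^1(\Omega)$. *)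

theory Defs
  imports "HOL-Analysis.Analysis"
begin

section \<open>Functions of class \<open>C\<^sup>k\<close> and open sets with \<open>C\<^sup>k\<close> boundary\<close>

text \<open>The set \<open>S\<close> is open in all uses below, so that the Frechet derivative is determined on \<open>S\<close>.\<close>

primrec Ck_on :: "nat \<Rightarrow> ('a::euclidean_space \<Rightarrow> 'b::real_normed_vector) \<Rightarrow> 'a set \<Rightarrow> bool" where
  "Ck_on 0 f S \<longleftrightarrow> continuous_on S f"
| "Ck_on (Suc k) f S \<longleftrightarrow> f differentiable_on S \<and>
     (\<forall>b\<in>Basis. Ck_on k (\<lambda>x. frechet_derivative f (at x) b) S)"

definition smooth_on :: "('a::euclidean_space \<Rightarrow> 'b::real_normed_vector) \<Rightarrow> 'a set \<Rightarrow> bool" where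
  "smooth_on f S \<longleftrightarrow> (\<forall>k. Ck_on k f S)"

text \<open>All partial derivatives of order \<open>\<le> k\<close> exist in the open set \<open>S\<close> and extend continuously
  to \<open>closure S\<close>.\<close>

primrec Ck_up_to_boundary :: "nat \<Rightarrow> ('a::euclidean_space \<Rightarrow> 'b::real_normed_vector) \<Rightarrow> 'a set \<Rightarrow> bool" where
  "Ck_up_to_boundary 0 f S \<longleftrightarrow> (\<exists>F. continuous_on (closure S) F \<and> (\<forall>x\<in>S. F x = f x))"
| "Ck_up_to_boundary (Suc k) f S \<longleftrightarrow> (\<exists>F. continuous_on (closure S) F \<and> (\<forall>x\<in>S. F x = f x)) \<and>
     f differentiable_on S \<and>
     (\<forall>b\<in>Basis. Ck_up_to_boundary k (\<lambda>x. frechet_derivative f (at x) b) S)"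

text \<open>The class \<open>C\<^sup>\<infinity>\<close> of the closure of the open set \<open>S\<close>; the values of \<open>f\<close> on the boundary are
  those given by continuity.\<close>

definition smooth_on_closure :: "('a::euclidean_space \<Rightarrow> 'b::real_normed_vector) \<Rightarrow> 'a set \<Rightarrow> bool" where
  "smooth_on_closure f S \<longleftrightarrow> continuous_on (closure S) f \<and> (\<forall>k. Ck_up_to_boundary k f S)"

text \<open>Near each boundary point the set is, in suitable orthogonal coordinates \<open>T\<close>, the part of a
  ball lying strictly above the graph of a \<open>C\<^sup>k\<close> function (translations are absorbed in \<open>g\<close>).\<close>

definition has_Ck_boundary :: "nat \<Rightarrow> (real \<times> real) set \<Rightarrow> bool" where
  "has_Ck_boundary k S \<longleftrightarrow>
     (\<forall>p\<in>frontier S. \<exists>r>0. \<exists>T :: real \<times> real \<Rightarrow> real \<times> real. \<exists>g :: real \<Rightarrow> real.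
        orthogonal_transformation T \<and> Ck_on k g UNIV \<and>
        S \<inter> ball p r = {x \<in> ball p r. g (fst (T x)) < snd (T x)})"

section \<open>The spaces \<open>L\<^sub>2\<close>, \<open>W\<^sub>2\<^sup>1\<close> and its subspace of functions with zero trace\<close>

text \<open>Elements of \<open>L\<^sub>2(Q)\<close> are represented by functions on the whole space; only their values on \<open>Q\<close>,
  up to a null set, matter in what follows.\<close>

definition L2 :: "'a::euclidean_space set \<Rightarrow> ('a \<Rightarrow> complex) set" where
  "L2 Q = {u. u \<in> borel_measurable (lebesgue_on Q) \<and>
              integrable (lebesgue_on Q) (\<lambda>x. (cmod (u x))\<^sup>2)}"

definition l2_inner :: "'a::euclidean_space set \<Rightarrow> ('a \<Rightarrow> complex) \<Rightarrow> ('a \<Rightarrow> complex) \<Rightarrow> complex" where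
  "l2_inner Q u v = (LINT x|lebesgue_on Q. u x * cnj (v x))"

definition l2_norm :: "'a::euclidean_space set \<Rightarrow> ('a \<Rightarrow> complex) \<Rightarrow> real" where
  "l2_norm Q u = sqrt (LINT x|lebesgue_on Q. (cmod (u x))\<^sup>2)"

definition test_functions :: "'a::euclidean_space set \<Rightarrow> ('a \<Rightarrow> complex) set" where
  "test_functions Q = {\<phi>. smooth_on \<phi> UNIV \<and> compact (closure {x. \<phi> x \<noteq> 0}) \<and>
                          closure {x. \<phi> x \<noteq> 0} \<subseteq> Q}"

definition has_weak_partial ::
    "'a::euclidean_space set \<Rightarrow> 'a \<Rightarrow> ('a \<Rightarrow> complex) \<Rightarrow> ('a \<Rightarrow> complex) \<Rightarrow> bool" where
  "has_weak_partial Q b u g \<longleftrightarrow>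
     (\<forall>\<phi>\<in>test_functions Q.
        (LINT x|lebesgue_on Q. u x * frechet_derivative \<phi> (at x) b) =
        - (LINT x|lebesgue_on Q. g x * \<phi> x))"

definition W21 :: "'a::euclidean_space set \<Rightarrow> ('a \<Rightarrow> complex) set" where
  "W21 Q = {u \<in> L2 Q. \<forall>b\<in>Basis. \<exists>g\<in>L2 Q. has_weak_partial Q b u g}"

text \<open>Weak derivatives are unique only almost everywhere; a representative is chosen.\<close>

definition weak_partial :: "'a::euclidean_space set \<Rightarrow> 'a \<Rightarrow> ('a \<Rightarrow> complex) \<Rightarrow> 'a \<Rightarrow> complex" where
  "weak_partial Q b u = (SOME g. g \<in> L2 Q \<and> has_weak_partial Q b u g)"

definition W21_norm :: "'a::euclidean_space set \<Rightarrow> ('a \<Rightarrow> complex) \<Rightarrow> real" where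
  "W21_norm Q u = sqrt ((l2_norm Q u)\<^sup>2 + (\<Sum>b\<in>Basis. (l2_norm Q (weak_partial Q b u))\<^sup>2))"

text \<open>Functions with zero trace on the boundary, in the usual sense for arbitrary open sets: the
  closure of the test functions in \<open>W\<^sub>2\<^sup>1(Q)\<close>. This also makes sense where the domain lies on both
  sides of its boundary; there the one-sided traces all vanish.\<close>

definition W21_zero :: "'a::euclidean_space set \<Rightarrow> ('a \<Rightarrow> complex) set" where
  "W21_zero Q = {u \<in> W21 Q. \<exists>\<phi> :: nat \<Rightarrow> 'a \<Rightarrow> complex. (\<forall>n. \<phi> n \<in> test_functions Q) \<and>
                   (\<lambda>n. W21_norm Q (\<lambda>x. u x - \<phi> n x)) \<longlonglongrightarrow> 0}"

section \<open>The Dirichlet Schroedinger operator and its spectrum\<close>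

definition schroedinger_form ::
    "'a::euclidean_space set \<Rightarrow> ('a \<Rightarrow> real) \<Rightarrow> ('a \<Rightarrow> complex) \<Rightarrow> ('a \<Rightarrow> complex) \<Rightarrow> complex" where
  "schroedinger_form Q V u v =
     (\<Sum>b\<in>Basis. l2_inner Q (weak_partial Q b u) (weak_partial Q b v)) +
     l2_inner Q (\<lambda>x. complex_of_real (V x) * u x) v"

text \<open>The operator associated with the form (first representation theorem), given by its graph: \<open>u\<close>
  is in the domain and is mapped to \<open>f\<close> iff \<open>u\<close> is in the form domain and the form at \<open>(u, v)\<close>
  equals the inner product of \<open>f\<close> and \<open>v\<close> for all \<open>v\<close> in the form domain.\<close>

definition schroedinger_operator ::
    "'a::euclidean_space set \<Rightarrow> ('a \<Rightarrow> real) \<Rightarrow> (('a \<Rightarrow> complex) \<times> ('a \<Rightarrow> complex)) set" where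
  "schroedinger_operator Q V =
     {(u, f). u \<in> W21_zero Q \<and> f \<in> L2 Q \<and>
              (\<forall>v\<in>W21_zero Q. schroedinger_form Q V u v = l2_inner Q f v)}"

text \<open>For an operator in \<open>L\<^sub>2(Q)\<close> with graph \<open>H\<close>, the point \<open>z\<close> is in the resolvent set iff \<open>H - z\<close> is
  onto \<open>L\<^sub>2(Q)\<close> and bounded below, i.e. injective with bounded inverse.\<close>

definition resolvent_set ::
    "'a::euclidean_space set \<Rightarrow> (('a \<Rightarrow> complex) \<times> ('a \<Rightarrow> complex)) set \<Rightarrow> complex set" where
  "resolvent_set Q H =
     {z. (\<forall>f\<in>L2 Q. \<exists>(u, g)\<in>H. AE x in lebesgue_on Q. g x - z * u x = f x) \<and>
         (\<exists>C. \<forall>(u, g)\<in>H. l2_norm Q u \<le> C * l2_norm Q (\<lambda>x. g x - z * u x))}"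

definition spectrum ::
    "'a::euclidean_space set \<Rightarrow> (('a \<Rightarrow> complex) \<times> ('a \<Rightarrow> complex)) set \<Rightarrow> complex set" where
  "spectrum Q H = - resolvent_set Q H"

section \<open>The geometry\<close>

definition periodic_union :: "real \<Rightarrow> (real \<times> real) set \<Rightarrow> (real \<times> real) set" where
  "periodic_union d P = (\<Union>k::int. {x. (fst x - of_int k * d, snd x) \<in> P})"

definition perturbed_domain :: "real \<Rightarrow> (real \<times> real) set \<Rightarrow> real \<Rightarrow> (real \<times> real) set" where
  "perturbed_domain d P \<epsilon> =
     periodic_union d P \<union> (\<Union>k::int. {x. fst x = of_int k * d \<and> \<bar>snd x\<bar> < \<epsilon>})"

end

theory Submission
  imports Defs "HOL-Library.Function_Algebras"
begin

text \<open>
  Both directions follow from norm resolvent convergence. Let \<open>w\<close> be the difference of the two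
  resolvents applied to \<open>f\<close>. Its form inner product with every function in the form domain of the
  unperturbed operator vanishes, so \<open>\<parallel>w\<parallel>\<^sup>2\<close> equals the form evaluated at \<open>w\<close> and \<open>(1 - \<theta>) y\<close>, where \<open>y\<close> is
  the perturbed resolvent applied to \<open>w\<close> and \<open>\<theta>\<close> is a cut-off that vanishes near the gates. Moving
  \<open>1 - \<theta>\<close> to the other argument costs only terms with \<open>grad \<theta>\<close>, and no elliptic regularity is needed.
  With a logarithmic \<open>\<theta>\<close> one has \<open>\<bar>grad \<theta>\<bar> \<le> C \<kappa> / dist\<close> with \<open>\<kappa>\<close> arbitrarily small, while the functions
  in the form domain vanish on the walls outside the gates, so that a Hardy inequality along paths
  starting at the walls bounds \<open>u / dist\<close> by \<open>grad u\<close>. All bounds are uniform over the infinitely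
  many gates.

  Spectral points are characterised by approximate eigenvectors, which the closeness of the
  resolvents transfers between the two operators.
\<close>

section \<open>Semi-inner product spaces\<close>

text \<open>Elements of L2 are functions and not classes, and weak derivatives and resolvents are
  chosen representatives, so uniqueness and linearity hold only up to vectors of norm zero. The
  abstract theory is therefore written for semi-inner products, with the operator as a relation. The
  analytic obstacle: a cut-off that vanishes on the gates and is close to the identity in L2 has a
  gradient that blows up as \<epsilon> tends to 0, and infinitely many gates in an unbounded domain
  leave no compactness to exploit. What has to be small is the product of
  \<open>grad \<theta>\<close> with functions of the form domain. Hardy's inequality makes the
  product of \<open>grad \<theta>\<close> with the distance the relevant quantity, and a logarithmic
  profile makes it small by spreading the passage from 0 to 1 over many scales between \<epsilon>
  and a fixed length. The operators are shifted by a constant so that the form dominates the W21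
  norm. In place of a spectral theorem, \<open>apx_near\<close> produces a spectral point near an
  approximate eigenvalue by elementary means.\<close>

locale semi_inner = vector_space sc for sc :: "complex \<Rightarrow> 'v::ab_group_add \<Rightarrow> 'v" +
  fixes S :: "'v set" and ip :: "'v \<Rightarrow> 'v \<Rightarrow> complex"
  assumes sub: "subspace S"
    and ip_add_left: "\<lbrakk>x \<in> S; y \<in> S; z \<in> S\<rbrakk> \<Longrightarrow> ip (x + y) z = ip x z + ip y z"
    and ip_scale_left: "\<lbrakk>x \<in> S; y \<in> S\<rbrakk> \<Longrightarrow> ip (sc a x) y = a * ip x y"
    and ip_sym: "\<lbrakk>x \<in> S; y \<in> S\<rbrakk> \<Longrightarrow> ip y x = cnj (ip x y)"
    and ip_nonneg: "x \<in> S \<Longrightarrow> 0 \<le> Re (ip x x)"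
begin

definition nrm :: "'v \<Rightarrow> real" where "nrm x = sqrt (Re (ip x x))"


lemma mem [simp, intro]:
  "0 \<in> S" "x \<in> S \<Longrightarrow> y \<in> S \<Longrightarrow> x + y \<in> S" "x \<in> S \<Longrightarrow> y \<in> S \<Longrightarrow> x - y \<in> S" "x \<in> S \<Longrightarrow> sc a x \<in> S"
  using sub by (auto simp: subspace_0 subspace_add subspace_diff subspace_scale)

lemma ip_add_right: "\<lbrakk>x \<in> S; y \<in> S; z \<in> S\<rbrakk> \<Longrightarrow> ip z (x + y) = ip z x + ip z y"
  by (metis complex_cnj_add ip_add_left ip_sym mem(2))

lemma ip_scale_right: "\<lbrakk>x \<in> S; y \<in> S\<rbrakk> \<Longrightarrow> ip y (sc a x) = cnj a * ip y x"
  by (metis complex_cnj_mult ip_scale_left ip_sym mem(4))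

lemma ip_diff_left: "\<lbrakk>x \<in> S; y \<in> S; z \<in> S\<rbrakk> \<Longrightarrow> ip (x - y) z = ip x z - ip y z"
  by (metis add_diff_cancel_right' diff_add_cancel ip_add_left mem(3))

lemma ip_diff_right: "\<lbrakk>x \<in> S; y \<in> S; z \<in> S\<rbrakk> \<Longrightarrow> ip z (x - y) = ip z x - ip z y"
  by (metis add_diff_cancel_right' diff_add_cancel ip_add_right mem(3))

lemma ip_zero [simp]: "x \<in> S \<Longrightarrow> ip 0 x = 0" "x \<in> S \<Longrightarrow> ip x 0 = 0"
  using ip_diff_left[of x x x] ip_diff_right[of x x x] by auto

lemma nrm_zero [simp]: "nrm 0 = 0"
  by (simp add: nrm_def)

lemmas ip_simps = ip_add_left ip_add_right ip_diff_left ip_diff_right ip_scale_left ip_scale_right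

lemma nrm_nonneg [simp]: "0 \<le> nrm x" if "x \<in> S"
  using that by (simp add: nrm_def ip_nonneg)

lemma nrm_sq: "x \<in> S \<Longrightarrow> (nrm x)\<^sup>2 = Re (ip x x)"
  by (simp add: nrm_def ip_nonneg)

lemma ip_self: "x \<in> S \<Longrightarrow> ip x x = of_real ((nrm x)\<^sup>2)"
  using ip_sym[of x x] by (simp add: nrm_sq complex_eq_iff)

lemma nrm_scale: "x \<in> S \<Longrightarrow> nrm (sc a x) = cmod a * nrm x"
proof -
  assume x: "x \<in> S"
  have "(nrm (sc a x))\<^sup>2 = Re (a * cnj a * ip x x)"
    using x by (simp add: nrm_sq ip_simps mult_ac)
  also have "\<dots> = (cmod a * nrm x)\<^sup>2"
    by (simp only: complex_norm_square[symmetric] ip_self[OF x] of_real_mult[symmetric] Re_complex_of_real power_mult_distrib)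
  finally show ?thesis
    using x by (simp add: power2_eq_iff_nonneg)
qed

lemma nrm_add_sq: "\<lbrakk>x \<in> S; y \<in> S\<rbrakk> \<Longrightarrow> (nrm (x + y))\<^sup>2 = (nrm x)\<^sup>2 + 2 * Re (ip x y) + (nrm y)\<^sup>2"
  using ip_sym[of x y] by (simp add: nrm_sq ip_simps)

lemma nrm_diff_sq: "\<lbrakk>x \<in> S; y \<in> S\<rbrakk> \<Longrightarrow> (nrm (x - y))\<^sup>2 = (nrm x)\<^sup>2 - 2 * Re (ip x y) + (nrm y)\<^sup>2"
  using ip_sym[of x y] by (simp add: nrm_sq ip_simps)

text \<open>Comes from the nonnegativity of \<open>nrm (x - t a y)\<close>, squared, with
  \<open>a = ip x y\<close> and real \<open>t\<close>. The case \<open>nrm y = 0\<close> needs its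
  own argument, since such a \<open>y\<close> need not vanish.\<close>

lemma Cauchy_Schwarz: assumes x: "x \<in> S" and y: "y \<in> S" shows "cmod (ip x y) \<le> nrm x * nrm y"
proof -
  define a where "a = ip x y"
  have *: "0 \<le> (nrm x)\<^sup>2 - 2 * t * (cmod a)\<^sup>2 + t\<^sup>2 * (cmod a)\<^sup>2 * (nrm y)\<^sup>2" for t :: real
  proof -
    have "0 \<le> (nrm (x - sc (of_real t * a) y))\<^sup>2" by simp
    also have "\<dots> = (nrm x)\<^sup>2 - 2 * Re (cnj (of_real t * a) * a) + (cmod (of_real t * a) * nrm y)\<^sup>2"
      using x y by (simp add: nrm_diff_sq ip_scale_right nrm_scale a_def[symmetric])
    also have "cnj (of_real t * a) * a = of_real (t * (cmod a)\<^sup>2)"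
      by (metis complex_cnj_complex_of_real complex_cnj_mult complex_norm_square mult.assoc mult.commute of_real_mult)
    finally show ?thesis by (simp add: power_mult_distrib norm_mult algebra_simps)
  qed
  have "(cmod a)\<^sup>2 \<le> (nrm x)\<^sup>2 * (nrm y)\<^sup>2"
  proof (cases "nrm y = 0")
    case True
    have "a = 0"
    proof (rule ccontr)
      assume "a \<noteq> 0"
      \<comment> \<open>For \<open>nrm y = 0\<close> the quadratic in \<open>t\<close> is affine,
        and this \<open>t\<close> gives it the value -1.\<close>
      then show False using *[of "((nrm x)\<^sup>2 + 1) / (2 * (cmod a)\<^sup>2)"] True by (simp add: field_simps)
    qed
    then show ?thesis by simp
  next
    case False
    then have "0 < (nrm y)\<^sup>2" by simp
    moreover have "0 \<le> (nrm x)\<^sup>2 - (cmod a)\<^sup>2 / (nrm y)\<^sup>2"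
      using *[of "1 / (nrm y)\<^sup>2"] False by (simp add: field_simps power2_eq_square)
    ultimately show ?thesis by (simp add: field_simps)
  qed
  then have "(cmod a)\<^sup>2 \<le> (nrm x * nrm y)\<^sup>2" by (simp add: power_mult_distrib)
  then show ?thesis unfolding a_def using x y by (metis mult_nonneg_nonneg nrm_nonneg power2_le_imp_le)
qed

lemma Re_ip_le: "\<lbrakk>x \<in> S; y \<in> S\<rbrakk> \<Longrightarrow> \<bar>Re (ip x y)\<bar> \<le> nrm x * nrm y"
  using Cauchy_Schwarz abs_Re_le_cmod order_trans by blast

lemma nrm_triangle: "\<lbrakk>x \<in> S; y \<in> S\<rbrakk> \<Longrightarrow> nrm (x + y) \<le> nrm x + nrm y"
proof (rule power2_le_imp_le)
  assume "x \<in> S" "y \<in> S"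
  then show "(nrm (x + y))\<^sup>2 \<le> (nrm x + nrm y)\<^sup>2" "0 \<le> nrm x + nrm y"
    using Re_ip_le[of x y] by (auto simp: nrm_add_sq power2_sum)
qed

lemma nrm_minus_commute: "\<lbrakk>x \<in> S; y \<in> S\<rbrakk> \<Longrightarrow> nrm (x - y) = nrm (y - x)"
  using nrm_scale[of "x - y" "-1"] by simp

lemma nrm_triangle_diff: "\<lbrakk>x \<in> S; y \<in> S\<rbrakk> \<Longrightarrow> nrm (x - y) \<le> nrm x + nrm y"
  using nrm_triangle[of x "sc (-1) y"] nrm_scale[of y "-1"] mem(4)[of y "-1"] by simp

lemma nrm_triangle_sub: "\<lbrakk>x \<in> S; y \<in> S\<rbrakk> \<Longrightarrow> nrm x \<le> nrm y + nrm (x - y)"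
  using nrm_triangle[of y "x - y"] by simp

lemma nrm_triangle3: "\<lbrakk>x \<in> S; y \<in> S; z \<in> S\<rbrakk> \<Longrightarrow> nrm (x - z) \<le> nrm (x - y) + nrm (y - z)"
  using nrm_triangle[of "x - y" "y - z"] by simp

lemma ip_null: "\<lbrakk>x \<in> S; y \<in> S; nrm x = 0\<rbrakk> \<Longrightarrow> ip x y = 0" "\<lbrakk>x \<in> S; y \<in> S; nrm x = 0\<rbrakk> \<Longrightarrow> ip y x = 0"
  using Cauchy_Schwarz[of x y] Cauchy_Schwarz[of y x] by auto

lemma nrm_null_cong: "\<lbrakk>x \<in> S; y \<in> S; nrm (x - y) = 0\<rbrakk> \<Longrightarrow> nrm x = nrm y"
  using nrm_triangle_sub[of x y] nrm_triangle_sub[of y x] nrm_minus_commute[of x y] by simp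

text \<open>The substitute for equality of L2 classes: representatives at distance zero may be
  exchanged in inner products. Applied later to chosen weak derivatives and to resolvent
  images.\<close>

lemma ip_null_cong:
  assumes "x \<in> S" "y \<in> S" "z \<in> S" "nrm (x - y) = 0"
  shows "ip x z = ip y z" "ip z x = ip z y"
  using ip_null[of "x - y" z] assms by (auto simp: ip_simps)

text \<open>Stated by hand because \<open>nrm\<close> is only a seminorm, on a subset of a type that
  carries no metric.\<close>

definition cau :: "(nat \<Rightarrow> 'v) \<Rightarrow> bool" where
  "cau X \<longleftrightarrow> (\<forall>e>0. \<exists>N. \<forall>m\<ge>N. \<forall>n\<ge>N. nrm (X m - X n) < e)"

lemma LIMSEQ_ip_left:
  assumes "\<And>n. X n \<in> S" "x \<in> S" "y \<in> S" and lim: "(\<lambda>n. nrm (X n - x)) \<longlonglongrightarrow> 0"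
  shows "(\<lambda>n. ip (X n) y) \<longlonglongrightarrow> ip x y"
proof -
  have "(\<lambda>n. ip (X n) y - ip x y) \<longlonglongrightarrow> 0"
  proof (rule Lim_null_comparison)
    show "\<forall>\<^sub>F n in sequentially. norm (ip (X n) y - ip x y) \<le> nrm (X n - x) * nrm y"
      using Cauchy_Schwarz assms by (auto simp flip: ip_diff_left)
    show "(\<lambda>n. nrm (X n - x) * nrm y) \<longlonglongrightarrow> 0"
      using tendsto_mult_left_zero[OF lim] .
  qed
  then show ?thesis by (simp add: LIM_zero_iff)
qed

lemma LIMSEQ_nrm:
  assumes "\<And>n. X n \<in> S" "x \<in> S" and lim: "(\<lambda>n. nrm (X n - x)) \<longlonglongrightarrow> 0"
  shows "(\<lambda>n. nrm (X n)) \<longlonglongrightarrow> nrm x"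
proof -
  have "(\<lambda>n. nrm (X n) - nrm x) \<longlonglongrightarrow> 0"
  proof (rule Lim_null_comparison[OF _ lim], intro always_eventually allI)
    fix n
    show "norm (nrm (X n) - nrm x) \<le> nrm (X n - x)"
      using nrm_triangle_sub[of x "X n"] nrm_triangle_sub[of "X n" x] nrm_minus_commute[of x "X n"] assms by auto
  qed
  then show ?thesis by (simp add: LIM_zero_iff)
qed

end

locale semi_hilbert = semi_inner sc S ip
  for sc :: "complex \<Rightarrow> 'v::ab_group_add \<Rightarrow> 'v" and S ip +
  assumes complete: "\<lbrakk>\<And>n. X n \<in> S; cau X\<rbrakk> \<Longrightarrow> \<exists>x\<in>S. (\<lambda>n. nrm (X n - x)) \<longlonglongrightarrow> 0"
begin

text \<open>The representing vector minimises \<open>\<parallel>v\<parallel>\<^sup>2 - 2 Re (l v)\<close>; minimising sequences are Cauchy by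
  the parallelogram identity.\<close>

lemma Riesz:
  fixes l :: "'v \<Rightarrow> complex"
  assumes add: "\<And>x y. x \<in> S \<Longrightarrow> y \<in> S \<Longrightarrow> l (x + y) = l x + l y"
    and scale: "\<And>x a. x \<in> S \<Longrightarrow> l (sc a x) = cnj a * l x"
    and bdd: "\<And>x. x \<in> S \<Longrightarrow> cmod (l x) \<le> C * nrm x"
  shows "\<exists>u\<in>S. \<forall>v\<in>S. ip u v = l v"
proof -
  define J where "J v = (nrm v)\<^sup>2 - 2 * Re (l v)" for v
  have lb: "- C\<^sup>2 \<le> J v" if "v \<in> S" for v
  proof -
    have "Re (l v) \<le> C * nrm v" using bdd[OF that] complex_Re_le_cmod order_trans by blast
    moreover have "0 \<le> (nrm v - C)\<^sup>2" by simp
    ultimately show ?thesis unfolding J_def power2_diff by (simp add: algebra_simps)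
  qed
  define m where "m = Inf (J ` S)"
  have bb: "bdd_below (J ` S)" by (rule bdd_belowI2[of _ "- C\<^sup>2"]) (rule lb)
  have m_le: "m \<le> J v" if "v \<in> S" for v unfolding m_def by (rule cINF_lower[OF bb that])
  have "\<exists>v\<in>S. J v < m + 1 / Suc n" for n :: nat
  proof -
    have "\<exists>x\<in>J ` S. x < m + 1 / Suc n"
      unfolding m_def by (rule cInf_lessD) (use mem(1) in auto)
    then show ?thesis by auto
  qed
  then obtain X where X: "\<And>n. X n \<in> S" "\<And>n::nat. J (X n) < m + 1 / Suc n" by metis
  have par: "(nrm (v - w))\<^sup>2 = 2 * J v + 2 * J w - 4 * J (sc (1/2) (v + w))" if "v \<in> S" "w \<in> S" for v w
  proof -
    have "4 * (nrm (sc (1/2) (v + w)))\<^sup>2 = (nrm (v + w))\<^sup>2"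
    proof -
      have "nrm (v + w) = 2 * nrm (sc (1/2) (v + w))"
        using that nrm_scale[of "v + w" "1/2"] by (simp add: norm_divide)
      then show ?thesis by (simp add: power_mult_distrib)
    qed
    moreover have "l (sc (1/2) (v + w)) = (l v + l w) / 2"
      using that by (simp add: scale add)
    then have "Re (l (sc (1/2) (v + w))) = (Re (l v) + Re (l w)) / 2"
      by (simp only: Re_divide_numeral plus_complex.sel)
    moreover have "(nrm (v - w))\<^sup>2 = 2 * (nrm v)\<^sup>2 + 2 * (nrm w)\<^sup>2 - (nrm (v + w))\<^sup>2"
      using that by (simp add: nrm_add_sq nrm_diff_sq)
    ultimately show ?thesis
      unfolding J_def by argo
  qed
  have "cau X"
    unfolding cau_def
  proof (intro allI impI)
    fix e :: real assume "0 < e"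
    \<comment> \<open>By \<open>par\<close>, two vectors whose values are within 1/(N+1) of
      \<open>m\<close> are at squared distance below 4/(N+1).\<close>
    then obtain N :: nat where N: "4 / e\<^sup>2 < N" using reals_Archimedean2 by blast
    have "nrm (X i - X j) < e" if "N \<le> i" "N \<le> j" for i j
    proof -
      have "(nrm (X i - X j))\<^sup>2 \<le> 2 * J (X i) + 2 * J (X j) - 4 * m"
        using par[OF X(1) X(1), of i j] m_le[of "sc (1/2) (X i + X j)"] X(1) by simp
      also have "\<dots> < 2 * (1 / Suc i) + 2 * (1 / Suc j)" using X(2)[of i] X(2)[of j] by linarith
      also have "\<dots> \<le> 2 * (1 / Suc N) + 2 * (1 / Suc N)"
        using that by (intro add_mono mult_left_mono divide_left_mono) auto
      also have "\<dots> < e\<^sup>2"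
      proof -
        have "4 < e\<^sup>2 * Suc N" using N \<open>0 < e\<close> by (simp add: field_simps) (smt (verit) zero_less_power)
        then have "4 / Suc N < e\<^sup>2" by (subst divide_less_eq) simp
        then show ?thesis by simp
      qed
      finally show ?thesis using \<open>0 < e\<close> X(1) by (simp add: power2_less_imp_less)
    qed
    then show "\<exists>N. \<forall>m\<ge>N. \<forall>n\<ge>N. nrm (X m - X n) < e" by blast
  qed
  from complete[OF X(1) this] obtain u where u: "u \<in> S" "(\<lambda>n. nrm (X n - u)) \<longlonglongrightarrow> 0" by blast
  have l_diff: "l (x - y) = l x - l y" if "x \<in> S" "y \<in> S" for x y
    using add[of "x - y" y] that by simp
  have "(\<lambda>n. l (X n) - l u) \<longlonglongrightarrow> 0"
  proof (rule Lim_null_comparison[of _ "\<lambda>n. C * nrm (X n - u)"])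
    show "(\<lambda>n. C * nrm (X n - u)) \<longlonglongrightarrow> 0" using tendsto_mult_right_zero[OF u(2)] .
    show "\<forall>\<^sub>F n in sequentially. norm (l (X n) - l u) \<le> C * nrm (X n - u)"
      using bdd X(1) u(1) by (simp flip: l_diff)
  qed
  then have "(\<lambda>n. l (X n)) \<longlonglongrightarrow> l u" by (simp add: LIM_zero_iff)
  then have "(\<lambda>n. J (X n)) \<longlonglongrightarrow> J u"
    unfolding J_def by (intro tendsto_intros LIMSEQ_nrm X(1) u)
  moreover have "(\<lambda>n::nat. m + 1 / Suc n) \<longlonglongrightarrow> m + 0"
    using lim_inverse_n' LIMSEQ_Suc by (intro tendsto_add tendsto_const) blast
  ultimately have "J u \<le> m"
    using X(2) by (metis (no_types, lifting) LIMSEQ_le add.right_neutral less_eq_real_def)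
  then have min: "J u \<le> J v" if "v \<in> S" for v using m_le[OF that] by simp
  have Re0: "Re (ip u v - l v) = 0" if v: "v \<in> S" for v
  proof (rule ccontr)
    define r where "r = Re (ip u v - l v)"
    assume "\<not> ?thesis"
    then have r: "r \<noteq> 0" by (simp add: r_def)
    have "0 \<le> 2 * t * r + t\<^sup>2 * (nrm v)\<^sup>2" for t :: real
      using min[of "u + sc (of_real t) v"] u(1) v unfolding J_def r_def
      by (simp add: nrm_add_sq nrm_scale ip_simps add scale power_mult_distrib algebra_simps)
    note * = this
    \<comment> \<open>Nearly the minimiser of the quadratic \<open>2 t r + t^2 (nrm v)^2\<close>;
      the added 1 keeps the denominator positive when \<open>nrm v = 0\<close>.\<close>
    define t where "t = - r / ((nrm v)\<^sup>2 + 1)"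
    have pos: "0 < (nrm v)\<^sup>2 + 1" by (smt (verit) zero_le_power2)
    then have tr: "t * ((nrm v)\<^sup>2 + 1) = - r" by (simp add: t_def)
    have "0 \<le> 2 * t * r + t\<^sup>2 * (nrm v)\<^sup>2" by (rule *)
    also have "\<dots> = - (t\<^sup>2 * ((nrm v)\<^sup>2 + 2))"
      using tr by algebra
    finally have "t\<^sup>2 * ((nrm v)\<^sup>2 + 2) \<le> 0" by simp
    moreover have "0 < t\<^sup>2 * ((nrm v)\<^sup>2 + 2)"
      using r tr pos by (intro mult_pos_pos) (auto simp: zero_less_power2)
    ultimately show False by simp
  qed
  have "ip u v = l v" if v: "v \<in> S" for v
    \<comment> \<open>Both sides are conjugate-linear in \<open>v\<close>, so the real part at i
      times \<open>v\<close> gives the imaginary part at \<open>v\<close>.\<close>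
    using Re0[OF v] Re0[of "sc \<i> v"] v u(1) by (simp add: ip_simps scale complex_eq_iff)
  with u(1) show ?thesis by blast
qed

end

section \<open>Operators given by forms\<close>

text \<open>The operator of interest is that of \<open>b\<close> minus a constant; \<open>z\<close> below is the spectral parameter
  plus this constant, and \<open>gr u f\<close> says that \<open>u\<close> is the image of \<open>f\<close> under the inverse of the operator
  of \<open>b\<close>.\<close>

locale form_operator = L: semi_hilbert sc S ip + F: semi_hilbert sc D b
  for sc :: "complex \<Rightarrow> 'v::ab_group_add \<Rightarrow> 'v" and S ip D b +
  assumes dom_sub: "D \<subseteq> S" and dominates: "u \<in> D \<Longrightarrow> Re (ip u u) \<le> Re (b u u)"
begin

definition gr :: "'v \<Rightarrow> 'v \<Rightarrow> bool" where
  "gr u f \<longleftrightarrow> u \<in> D \<and> f \<in> S \<and> (\<forall>v\<in>D. b u v = ip f v)"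

text \<open>The approximate point spectrum. The strict inequality excludes vectors of norm zero, so
  \<open>u\<close> need not be normalised.\<close>

definition apx :: "complex \<Rightarrow> bool" where
  "apx z \<longleftrightarrow> (\<forall>\<eta>>0. \<exists>u f. gr u f \<and> L.nrm (f - sc z u) < \<eta> * L.nrm u)"

lemma in_S [simp, intro]: "u \<in> D \<Longrightarrow> u \<in> S" using dom_sub by blast

lemma gr_mem: assumes "gr u f" shows "u \<in> D" "f \<in> S" "u \<in> S"
  using assms by (auto simp: gr_def)

lemma gr_eq: "gr u f \<Longrightarrow> v \<in> D \<Longrightarrow> b u v = ip f v"
  by (simp add: gr_def)

lemma gr_add: "gr u f \<Longrightarrow> gr v g \<Longrightarrow> gr (u + v) (f + g)"
  unfolding gr_def by (auto simp: F.ip_simps L.ip_simps)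

lemma gr_diff: "gr u f \<Longrightarrow> gr v g \<Longrightarrow> gr (u - v) (f - g)"
  unfolding gr_def by (auto simp: F.ip_simps L.ip_simps)

lemma gr_scale: "gr u f \<Longrightarrow> gr (sc a u) (sc a f)"
  unfolding gr_def by (auto simp: F.ip_simps L.ip_simps)

lemma nrm_le: "u \<in> D \<Longrightarrow> L.nrm u \<le> F.nrm u"
  by (simp add: L.nrm_def F.nrm_def dominates)

text \<open>Test the defining identity with \<open>u\<close> itself and use that \<open>b\<close>
  dominates \<open>ip\<close>; the inverse is thus a contraction, even into the form norm.\<close>

lemma gr_nrm: assumes "gr u f" shows "F.nrm u \<le> L.nrm f" "L.nrm u \<le> L.nrm f"
proof -
  note m = gr_mem[OF assms]
  have "(F.nrm u)\<^sup>2 = Re (ip f u)" using m gr_eq[OF assms m(1)] by (simp add: F.nrm_sq)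
  also have "\<dots> \<le> L.nrm f * L.nrm u" using L.Re_ip_le[of f u] gr_mem[OF assms] by simp
  also have "\<dots> \<le> L.nrm f * F.nrm u"
    by (intro mult_left_mono nrm_le L.nrm_nonneg gr_mem[OF assms])
  finally have "F.nrm u * F.nrm u \<le> L.nrm f * F.nrm u" by (simp add: power2_eq_square)
  then show "F.nrm u \<le> L.nrm f"
    using F.nrm_nonneg[OF m(1)] L.nrm_nonneg[OF m(2)]
    by (cases "F.nrm u = 0") (auto simp: mult_le_cancel_right)
  then show "L.nrm u \<le> L.nrm f" using nrm_le[of u] gr_mem[OF assms] by linarith
qed

lemma gr_null: assumes "gr u f" "gr v g" "L.nrm (f - g) = 0" shows "L.nrm (u - v) = 0"
  using gr_nrm(2)[OF gr_diff[OF assms(1,2)]] assms(3)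
    L.nrm_nonneg[OF gr_mem(3)[OF gr_diff[OF assms(1,2)]]] by linarith

lemma gr_sym: assumes "gr u f" "gr v g" shows "ip u g = ip f v"
proof -
  note m = gr_mem[OF assms(1)] gr_mem[OF assms(2)]
  have "ip f v = b u v" using gr_eq[OF assms(1) m(4)] by simp
  also have "\<dots> = cnj (b v u)" using m by (intro F.ip_sym) auto
  also have "\<dots> = cnj (ip g u)" using gr_eq[OF assms(2) m(1)] by simp
  also have "\<dots> = ip u g" using m by (intro L.ip_sym[symmetric]) auto
  finally show ?thesis by simp
qed

lemma gr_ex: assumes f: "f \<in> S" shows "\<exists>u. gr u f"
proof -
  have "\<exists>u\<in>D. \<forall>v\<in>D. b u v = ip f v"
  proof (rule F.Riesz)
    show "cmod (ip f x) \<le> L.nrm f * F.nrm x" if "x \<in> D" for x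
      by (rule order_trans[OF L.Cauchy_Schwarz]) (use f that in \<open>auto intro!: mult_left_mono nrm_le\<close>)
  qed (use f in \<open>auto simp: L.ip_simps\<close>)
  then show ?thesis using f by (auto simp: gr_def)
qed

text \<open>A selection from the relation \<open>gr\<close>. By \<open>gr_null\<close> it is linear
  only up to vectors of norm zero, which is why linearity of \<open>T\<close> below is also stated
  in this sense.\<close>

definition R :: "'v \<Rightarrow> 'v" where "R f = (SOME u. gr u f)"

lemma gr_R: "f \<in> S \<Longrightarrow> gr (R f) f"
  unfolding R_def by (rule someI_ex) (rule gr_ex)

lemma R_mem [simp]: "f \<in> S \<Longrightarrow> R f \<in> D" "f \<in> S \<Longrightarrow> R f \<in> S"
  using gr_mem[OF gr_R] by auto

text \<open>\<open>1 - z R\<close> is normal. If it is bounded below, then \<open>((1 - z R) x, (1 - z R) y)\<close> is an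
  equivalent inner product, and Riesz' theorem for it inverts \<open>(1 - z R)\<^sup>*(1 - z R)\<close>.\<close>

lemma onto_if_bounded_below:
  assumes "0 < \<eta>" and below: "\<And>u f. gr u f \<Longrightarrow> \<eta> * L.nrm u \<le> L.nrm (f - sc z u)" and f: "f \<in> S"
  shows "\<exists>u g. gr u g \<and> L.nrm (g - sc z u - f) = 0"
proof -
  define T where "T x = x - sc z (R x)" for x
  define q where "q x y = ip (T x) (T y)" for x y
  have T [simp]: "T x \<in> S" if "x \<in> S" for x using that by (simp add: T_def)
  have null: "L.nrm (sc a x) = 0" if "x \<in> S" "L.nrm x = 0" for a x using that by (simp add: L.nrm_scale)
  have T_add: "L.nrm (T (x + y) - (T x + T y)) = 0" if "x \<in> S" "y \<in> S" for x y
  proof -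
    have "T (x + y) - (T x + T y) = sc z ((R x + R y) - R (x + y))"
      by (simp add: T_def L.scale_right_diff_distrib L.scale_right_distrib)
    moreover have "L.nrm ((R x + R y) - R (x + y)) = 0"
      using that by (intro gr_null[OF gr_add[OF gr_R gr_R] gr_R]) (auto simp: L.nrm_def L.ip_simps)
    ultimately show ?thesis using null that by simp
  qed
  have T_scale: "L.nrm (T (sc a x) - sc a (T x)) = 0" if "x \<in> S" for x a
  proof -
    have "T (sc a x) - sc a (T x) = sc z (sc a (R x) - R (sc a x))"
      by (simp add: T_def L.scale_right_diff_distrib L.scale_left_commute)
    moreover have "L.nrm (sc a (R x) - R (sc a x)) = 0"
      using that by (intro gr_null[OF gr_scale[OF gr_R] gr_R]) (auto simp: L.nrm_def L.ip_simps)
    ultimately show ?thesis using null that by simp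
  qed
  interpret Q: semi_inner sc S q
  proof
    show "L.subspace S" by (rule L.sub)
    show "q (x + y) w = q x w + q y w" if "x \<in> S" "y \<in> S" "w \<in> S" for x y w
      unfolding q_def using that L.ip_null_cong(1)[OF _ _ _ T_add, of x y "T w"] by (simp add: L.ip_simps)
    show "q (sc a x) y = a * q x y" if "x \<in> S" "y \<in> S" for a x y
      unfolding q_def using that L.ip_null_cong(1)[OF _ _ _ T_scale, of a x "T y"] by (simp add: L.ip_simps)
    show "q y x = cnj (q x y)" if "x \<in> S" "y \<in> S" for x y
      unfolding q_def using that by (intro L.ip_sym) auto
    show "0 \<le> Re (q x x)" if "x \<in> S" for x
      unfolding q_def using that by (intro L.ip_nonneg) auto
  qed
  have Q_nrm: "Q.nrm x = L.nrm (T x)" for x by (simp add: Q.nrm_def L.nrm_def q_def)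
  \<comment> \<open>From \<open>x = T x + z R x\<close> and
    \<open>\<eta> * nrm (R x) \<le> nrm (T x)\<close>. Together with \<open>upper\<close> this makes
    the norms of \<open>q\<close> and \<open>ip\<close> equivalent, so completeness carries
    over.\<close>
  define K where "K = 1 + cmod z / \<eta>"
  have K: "0 < K" using \<open>0 < \<eta>\<close> by (simp add: K_def add_pos_nonneg)
  have lower: "L.nrm x \<le> K * L.nrm (T x)" if x: "x \<in> S" for x
  proof -
    have "L.nrm (R x) \<le> L.nrm (T x) / \<eta>"
      using below[OF gr_R[OF x]] \<open>0 < \<eta>\<close> by (simp add: T_def field_simps)
    then have "cmod z * L.nrm (R x) \<le> cmod z * (L.nrm (T x) / \<eta>)" by (intro mult_left_mono) auto
    moreover have "L.nrm x \<le> L.nrm (T x) + cmod z * L.nrm (R x)"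
      using L.nrm_triangle[of "T x" "sc z (R x)"] x by (simp add: T_def L.nrm_scale)
    ultimately show ?thesis by (simp add: K_def algebra_simps)
  qed
  have upper: "L.nrm (T x) \<le> (1 + cmod z) * L.nrm x" if x: "x \<in> S" for x
  proof -
    have "L.nrm (T x) \<le> L.nrm x + cmod z * L.nrm (R x)"
      using L.nrm_triangle_diff[of x "sc z (R x)"] x by (simp add: T_def L.nrm_scale)
    also have "\<dots> \<le> L.nrm x + cmod z * L.nrm x"
      using gr_nrm(2)[OF gr_R[OF x]] by (simp add: mult_left_mono)
    finally show ?thesis by (simp add: algebra_simps)
  qed
  interpret Q: semi_hilbert sc S q
  proof
    fix X :: "nat \<Rightarrow> 'v" assume X: "\<And>n. X n \<in> S" and "Q.cau X"
    have "L.cau X"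
      unfolding L.cau_def
    proof (intro allI impI)
      fix e :: real assume "0 < e"
      then have "0 < e / K" using K by simp
      with \<open>Q.cau X\<close> obtain N where N: "\<And>m n. N \<le> m \<Longrightarrow> N \<le> n \<Longrightarrow> Q.nrm (X m - X n) < e / K"
        unfolding Q.cau_def by blast
      have "L.nrm (X m - X n) < e" if "N \<le> m" "N \<le> n" for m n
        using N[OF that] lower[of "X m - X n"] X K by (simp add: Q_nrm field_simps)
      then show "\<exists>N. \<forall>m\<ge>N. \<forall>n\<ge>N. L.nrm (X m - X n) < e" by blast
    qed
    from L.complete[OF X this] obtain x where x: "x \<in> S" "(\<lambda>n. L.nrm (X n - x)) \<longlonglongrightarrow> 0" by blast
    have "(\<lambda>n. Q.nrm (X n - x)) \<longlonglongrightarrow> 0"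
    proof (rule Lim_null_comparison[of _ "\<lambda>n. (1 + cmod z) * L.nrm (X n - x)"])
      show "(\<lambda>n. (1 + cmod z) * L.nrm (X n - x)) \<longlonglongrightarrow> 0" using tendsto_mult_right_zero[OF x(2)] .
    qed (use upper X x in \<open>auto simp: Q_nrm\<close>)
    with x show "\<exists>x\<in>S. (\<lambda>n. Q.nrm (X n - x)) \<longlonglongrightarrow> 0" by blast
  qed
  have "\<exists>x\<in>S. \<forall>y\<in>S. q x y = ip f y"
  proof (rule Q.Riesz)
    show "cmod (ip f x) \<le> (L.nrm f * K) * Q.nrm x" if "x \<in> S" for x
    proof -
      have "cmod (ip f x) \<le> L.nrm f * L.nrm x" using f that by (rule L.Cauchy_Schwarz)
      also have "\<dots> \<le> L.nrm f * (K * L.nrm (T x))" using f that by (intro mult_left_mono lower) auto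
      finally show ?thesis by (simp add: Q_nrm mult_ac)
    qed
  qed (use f in \<open>auto simp: L.ip_simps\<close>)
  then obtain x where x: "x \<in> S" and xq: "\<And>y. y \<in> S \<Longrightarrow> ip (T x) (T y) = ip f y"
    unfolding q_def by blast
  \<comment> \<open>The adjoint of \<open>T\<close>, applied to \<open>x\<close>. As
    \<open>T\<close> is normal, \<open>T x'\<close> is also the adjoint applied to
    \<open>T x\<close>, and by \<open>xq\<close> this is \<open>f\<close> up to norm zero.\<close>
  define x' where "x' = x - sc (cnj z) (R x)"
  have x': "x' \<in> S" using x by (simp add: x'_def)
  have sym: "ip (R u) v = ip u (R v)" if "u \<in> S" "v \<in> S" for u v
    using gr_sym[OF gr_R gr_R] that by simp
  have "ip (T x') y = ip f y" if y: "y \<in> S" for y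
  proof -
    have "ip (T x') y = ip x' y - z * ip x' (R y)"
      using x' y by (simp add: T_def L.ip_simps sym)
    also have "\<dots> = ip (T x) (T y)"
      using x y by (simp add: T_def x'_def L.ip_simps sym algebra_simps)
    finally show ?thesis using xq[OF y] by simp
  qed
  then have "ip (T x' - f) (T x' - f) = 0"
    using x' f by (simp add: L.ip_diff_left)
  then have "L.nrm (x' - sc z (R x') - f) = 0" by (simp add: L.nrm_def T_def)
  then show ?thesis using gr_R[OF x'] by blast
qed

lemma not_apx: assumes "\<not> apx z" obtains \<eta> where "0 < \<eta>" "\<And>u f. gr u f \<Longrightarrow> \<eta> * L.nrm u \<le> L.nrm (f - sc z u)"
  using assms unfolding apx_def by (meson not_less)

text \<open>By \<open>onto_if_bounded_below\<close> the surjectivity in the definition of the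
  resolvent set follows from the lower bound, so the spectrum consists of approximate eigenvalues
  only.\<close>

lemma resolvent_iff_not_apx:
  "\<not> apx z \<longleftrightarrow> (\<forall>f\<in>S. \<exists>u g. gr u g \<and> L.nrm (g - sc z u - f) = 0) \<and>
            (\<exists>C. \<forall>u f. gr u f \<longrightarrow> L.nrm u \<le> C * L.nrm (f - sc z u))"
proof (intro iffI conjI ballI)
  assume "\<not> apx z"
  then obtain \<eta> where \<eta>: "0 < \<eta>" "\<And>u f. gr u f \<Longrightarrow> \<eta> * L.nrm u \<le> L.nrm (f - sc z u)" by (rule not_apx) blast
  then show "\<exists>u g. gr u g \<and> L.nrm (g - sc z u - f) = 0" if "f \<in> S" for f
    using onto_if_bounded_below that by blast
  show "\<exists>C. \<forall>u f. gr u f \<longrightarrow> L.nrm u \<le> C * L.nrm (f - sc z u)"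
    using \<eta> by (intro exI[of _ "1 / \<eta>"]) (auto simp: field_simps)
next
  assume "(\<forall>f\<in>S. \<exists>u g. gr u g \<and> L.nrm (g - sc z u - f) = 0) \<and>
            (\<exists>C. \<forall>u f. gr u f \<longrightarrow> L.nrm u \<le> C * L.nrm (f - sc z u))"
  then obtain C where C: "\<And>u f. gr u f \<Longrightarrow> L.nrm u \<le> C * L.nrm (f - sc z u)" by blast
  show "\<not> apx z"
  proof
    assume "apx z"
    \<comment> \<open>\<open>C\<close> may be zero or negative, hence
      \<open>\<bar>C\<bar> + 1\<close>.\<close>
    moreover have "0 < 1 / (\<bar>C\<bar> + 1)" by (simp add: add_nonneg_pos)
    ultimately obtain u f where uf: "gr u f" "L.nrm (f - sc z u) < 1 / (\<bar>C\<bar> + 1) * L.nrm u"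
      unfolding apx_def by blast
    then have "(\<bar>C\<bar> + 1) * L.nrm (f - sc z u) < L.nrm u" by (simp add: field_simps)
    moreover have "0 \<le> L.nrm (f - sc z u)" using gr_mem[OF uf(1)] by (intro L.nrm_nonneg) auto
    then have "C * L.nrm (f - sc z u) \<le> (\<bar>C\<bar> + 1) * L.nrm (f - sc z u)" by (intro mult_right_mono) auto
    ultimately show False using C[OF uf(1)] by linarith
  qed
qed

text \<open>Since \<open>ip f u = b u u\<close> is real, pairing \<open>f - z u\<close> with
  \<open>u\<close> gives imaginary part \<open>- Im z * (nrm u)^2\<close>, so the residual is at
  least \<open>\<bar>Im z\<bar> * nrm u\<close>.\<close>

lemma apx_real: assumes "apx z" shows "Im z = 0"
proof (rule ccontr)
  assume "Im z \<noteq> 0"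
  then obtain u f where uf: "gr u f" "L.nrm (f - sc z u) < \<bar>Im z\<bar> * L.nrm u"
    using assms unfolding apx_def by (meson zero_less_abs_iff)
  have S: "u \<in> S" "f \<in> S" "f - sc z u \<in> S" using gr_mem[OF uf(1)] by auto
  have pos: "0 < L.nrm u"
    using uf(2) L.nrm_nonneg[OF S(3)] L.nrm_nonneg[OF S(1)] by (cases "L.nrm u = 0") auto
  have "ip f u = of_real ((F.nrm u)\<^sup>2)" using gr_eq[OF uf(1), of u] F.ip_self[of u] gr_mem[OF uf(1)] by auto
  then have "Im (ip (f - sc z u) u) = - Im z * (L.nrm u)\<^sup>2"
    using S by (simp add: L.ip_simps L.ip_self)
  then have "\<bar>Im z\<bar> * (L.nrm u)\<^sup>2 \<le> cmod (ip (f - sc z u) u)"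
    using abs_Im_le_cmod[of "ip (f - sc z u) u"] by (simp add: abs_mult)
  also have "\<dots> \<le> L.nrm (f - sc z u) * L.nrm u" using S by (intro L.Cauchy_Schwarz)
  also have "\<dots> < \<bar>Im z\<bar> * L.nrm u * L.nrm u" using uf(2) pos by simp
  finally show False by (simp add: power2_eq_square)
qed

text \<open>With \<open>K\<close> the operator minus \<open>a\<close> and \<open>\<beta>\<close> the infimum of \<open>\<parallel>K u\<parallel> / \<parallel>u\<parallel>\<close>, one of \<open>a \<plusminus> \<beta>\<close> is an
  approximate eigenvalue: if \<open>u\<close> nearly attains the infimum and \<open>K y = u\<close>, then
  \<open>(K - \<beta>) (K + \<beta>) y = K u - \<beta>\<^sup>2 y\<close> is small.\<close>

lemma apx_near:
  fixes a :: real
  assumes uF: "gr u f" "L.nrm (f - sc a u) \<le> \<eta> * L.nrm u" "0 < L.nrm u"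
  shows "\<exists>r::real. apx (complex_of_real r) \<and> \<bar>r - a\<bar> \<le> \<eta>"
proof (cases "apx (complex_of_real a)")
  case True
  have "0 \<le> \<eta> * L.nrm u"
    by (rule order_trans[OF L.nrm_nonneg uF(2)]) (use gr_mem[OF uF(1)] in auto)
  then have "\<bar>a - a\<bar> \<le> \<eta>" using uF(3) by (simp add: zero_le_mult_iff)
  with True show ?thesis by (intro exI[of _ a] conjI)
next
  case False
  then obtain \<eta>0 where \<eta>0: "0 < \<eta>0" "\<And>u f. gr u f \<Longrightarrow> \<eta>0 * L.nrm u \<le> L.nrm (f - sc a u)" by (rule not_apx) blast
  define B where "B = {L.nrm (f - sc a u) / L.nrm u | u f. gr u f \<and> 0 < L.nrm u}"
  define \<beta> where "\<beta> = Inf B"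
  have B: "x \<ge> \<eta>0" if "x \<in> B" for x
    using that \<eta>0 unfolding B_def by (auto simp: field_simps)
  have ne: "B \<noteq> {}" using uF unfolding B_def by blast
  have bdd: "bdd_below B" using B by (rule bdd_belowI)
  have "\<eta>0 \<le> \<beta>" unfolding \<beta>_def using ne B by (rule cInf_greatest)
  with \<eta>0(1) have \<beta>: "0 < \<beta>" by simp
  have "\<beta> \<le> L.nrm (f - sc a u) / L.nrm u"
    unfolding \<beta>_def by (rule cInf_lower[OF _ bdd]) (use uF in \<open>auto simp: B_def\<close>)
  also have "\<dots> \<le> \<eta>" using uF by (simp add: field_simps)
  finally have \<beta>\<eta>: "\<beta> \<le> \<eta>" .
  have below: "\<beta> * L.nrm u \<le> L.nrm (f - sc a u)" if "gr u f" for u f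
  proof (cases "L.nrm u = 0")
    case True
    then show ?thesis using gr_mem[OF that] by (auto intro!: L.nrm_nonneg)
  next
    case False
    then have "0 < L.nrm u" using L.nrm_nonneg[OF gr_mem(3)[OF that]] by linarith
    then have "\<beta> \<le> L.nrm (f - sc a u) / L.nrm u"
      unfolding \<beta>_def by (intro cInf_lower[OF _ bdd]) (use that in \<open>auto simp: B_def\<close>)
    then show ?thesis using \<open>0 < L.nrm u\<close> by (simp add: field_simps)
  qed
  \<comment> \<open>If both fail, K - \<beta> and K + \<beta> are bounded below by \<open>k1\<close>
    and \<open>k2\<close>, hence so is their product. But the product applied to \<open>y\<close>
    has norm \<open>Dl\<close>, which is small when \<open>u\<close> nearly attains the
    infimum.\<close>
  have "apx (complex_of_real (a + \<beta>)) \<or> apx (complex_of_real (a - \<beta>))"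
  proof (rule ccontr)
    assume "\<not> ?thesis"
    then obtain k1 k2 where k1: "0 < k1" "\<And>u f. gr u f \<Longrightarrow> k1 * L.nrm u \<le> L.nrm (f - sc (a + \<beta>) u)"
      and k2: "0 < k2" "\<And>u f. gr u f \<Longrightarrow> k2 * L.nrm u \<le> L.nrm (f - sc (a - \<beta>) u)"
      by (metis not_apx)
    define M where "M = 1 + \<beta>\<^sup>2 / (k1 * k2)"
    have M: "0 < M" using k1(1) k2(1) by (simp add: M_def add_pos_nonneg)
    \<comment> \<open>The slack is such that
      \<open>(nrm x)^2 < (1 + 1/M^2) \<beta>^2 (nrm u)^2\<close> forces
      \<open>M^2 Dl^2 < \<beta>^2 (nrm u)^2\<close>, against
      \<open>\<beta> nrm u \<le> nrm x \<le> M Dl\<close>.\<close>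
    have "\<beta> < \<beta> * sqrt (1 + 1 / M\<^sup>2)" using \<beta> M by simp
    then obtain w where "w \<in> B" "w < \<beta> * sqrt (1 + 1 / M\<^sup>2)"
      using cInf_lessD[OF ne] unfolding \<beta>_def by blast
    then obtain u f where uf: "gr u f" "0 < L.nrm u"
        "L.nrm (f - sc a u) / L.nrm u < \<beta> * sqrt (1 + 1 / M\<^sup>2)"
      unfolding B_def by blast
    define x where "x = f - sc a u"
    have x: "x \<in> S" using gr_mem[OF uf(1)] by (auto simp: x_def)
    obtain y h where y: "gr y h" "L.nrm (h - sc a y - u) = 0"
      using onto_if_bounded_below[OF \<eta>0, of u] gr_mem[OF uf(1)] by auto
    have S: "u \<in> S" "f \<in> S" "y \<in> S" "h \<in> S" using gr_mem[OF uf(1)] gr_mem[OF y(1)] by auto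
    \<comment> \<open>\<open>x\<close> is K u, and K y is \<open>u\<close> up to norm zero; the
      symmetry of K moves it from one argument to the other.\<close>
    have e1: "ip y x = ip u u"
    proof -
      have "ip y x = ip (h - sc a y) u"
        unfolding x_def using S gr_sym[OF y(1) uf(1)] by (simp add: L.ip_simps)
      also have "\<dots> = ip u u" by (rule L.ip_null_cong(1)[OF _ _ _ y(2)]) (use S in auto)
      finally show ?thesis .
    qed
    have nu: "L.nrm (h - sc a y) = L.nrm u" by (rule L.nrm_null_cong[OF _ _ y(2)]) (use S in auto)
    have by_le: "\<beta> * L.nrm y \<le> L.nrm u" using below[OF y(1)] nu by simp
    have bu: "\<beta> * L.nrm u \<le> L.nrm x" using below[OF uf(1)] by (simp add: x_def)
    define Dl where "Dl = L.nrm (x - sc (\<beta>\<^sup>2) y)"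
    have Dl0: "0 \<le> Dl" using x S by (simp add: Dl_def)
    have Dl: "Dl\<^sup>2 \<le> (L.nrm x)\<^sup>2 - \<beta>\<^sup>2 * (L.nrm u)\<^sup>2"
    proof -
      have "ip x y = ip u u" using e1 L.ip_sym[of y x] L.ip_sym[of u u] x S by simp
      then have "Dl\<^sup>2 = (L.nrm x)\<^sup>2 - 2 * \<beta>\<^sup>2 * (L.nrm u)\<^sup>2 + (\<beta>\<^sup>2 * L.nrm y)\<^sup>2"
        unfolding Dl_def using x S
        by (simp add: L.nrm_diff_sq L.ip_scale_right L.ip_self L.nrm_scale flip: of_real_power of_real_mult)
      moreover have "(\<beta>\<^sup>2 * L.nrm y)\<^sup>2 = \<beta>\<^sup>2 * (\<beta> * L.nrm y)\<^sup>2" by (simp add: power2_eq_square)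
      moreover have "\<beta>\<^sup>2 * (\<beta> * L.nrm y)\<^sup>2 \<le> \<beta>\<^sup>2 * (L.nrm u)\<^sup>2"
        using by_le \<beta> S by (intro mult_left_mono power_mono) auto
      ultimately show ?thesis by linarith
    qed
    \<comment> \<open>Up to norm zero this is (K + \<beta>) y, and (K - \<beta>) p is
      \<open>x - \<beta>^2 y\<close>.\<close>
    define p where "p = u + sc \<beta> y"
    have p: "p \<in> S" using S by (simp add: p_def)
    have "k1 * L.nrm p \<le> Dl"
    proof -
      have "gr p (f + sc \<beta> h)" unfolding p_def by (intro gr_add gr_scale uf(1) y(1))
      then have "k1 * L.nrm p \<le> L.nrm (f + sc \<beta> h - sc (a + \<beta>) p)" by (rule k1(2))
      also have "\<dots> = Dl" unfolding Dl_def
      proof (rule L.nrm_null_cong)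
        have "f + sc \<beta> h - sc (a + \<beta>) p - (x - sc (\<beta>\<^sup>2) y) = sc \<beta> (h - sc a y - u)"
          by (simp add: p_def x_def L.scale_left_distrib L.scale_right_distrib L.scale_right_diff_distrib
              power2_eq_square mult.commute algebra_simps)
        then show "L.nrm (f + sc \<beta> h - sc (a + \<beta>) p - (x - sc (\<beta>\<^sup>2) y)) = 0"
          using L.nrm_scale[of "h - sc a y - u" \<beta>] y(2) S by simp
      qed (use S p x in auto)
      finally show ?thesis .
    qed
    moreover have "k2 * L.nrm y \<le> L.nrm p"
    proof -
      have "k2 * L.nrm y \<le> L.nrm (h - sc (a - \<beta>) y)" by (rule k2(2)[OF y(1)])
      also have "\<dots> = L.nrm p"
      proof (rule L.nrm_null_cong)
        have "h - sc (a - \<beta>) y - p = h - sc a y - u"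
          by (simp add: p_def L.scale_left_diff_distrib algebra_simps)
        then show "L.nrm (h - sc (a - \<beta>) y - p) = 0" by (simp only: y(2))
      qed (use S p in auto)
      finally show ?thesis .
    qed
    ultimately have "k1 * (k2 * L.nrm y) \<le> Dl" using k1(1)
      by (meson mult_left_mono order_trans less_imp_le)
    then have "L.nrm y \<le> Dl / (k1 * k2)" using k1(1) k2(1) by (simp add: field_simps)
    then have "\<beta>\<^sup>2 * L.nrm y \<le> \<beta>\<^sup>2 * (Dl / (k1 * k2))" by (intro mult_left_mono) auto
    moreover have "L.nrm x \<le> Dl + \<beta>\<^sup>2 * L.nrm y"
      using L.nrm_triangle_sub[of x "sc (\<beta>\<^sup>2) y"] x S L.nrm_scale[of y "\<beta>\<^sup>2"] by (simp add: Dl_def norm_power)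
    ultimately have "L.nrm x \<le> M * Dl" by (simp add: M_def algebra_simps)
    then have "(L.nrm x)\<^sup>2 \<le> M\<^sup>2 * Dl\<^sup>2"
      using x by (metis L.nrm_nonneg power_mono power_mult_distrib)
    moreover have "L.nrm x < \<beta> * sqrt (1 + 1 / M\<^sup>2) * L.nrm u"
      using uf by (simp add: x_def field_simps)
    then have "(L.nrm x)\<^sup>2 < (\<beta> * sqrt (1 + 1 / M\<^sup>2) * L.nrm u)\<^sup>2"
      using x by (intro power_strict_mono) auto
    then have "(L.nrm x)\<^sup>2 < (1 + 1 / M\<^sup>2) * (\<beta>\<^sup>2 * (L.nrm u)\<^sup>2)"
      by (simp add: power_mult_distrib mult_ac add_nonneg_nonneg)
    then have "M\<^sup>2 * ((L.nrm x)\<^sup>2 - \<beta>\<^sup>2 * (L.nrm u)\<^sup>2) < \<beta>\<^sup>2 * (L.nrm u)\<^sup>2"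
      using M by (simp add: field_simps)
    moreover have "M\<^sup>2 * Dl\<^sup>2 \<le> M\<^sup>2 * ((L.nrm x)\<^sup>2 - \<beta>\<^sup>2 * (L.nrm u)\<^sup>2)" by (intro mult_left_mono Dl) auto
    moreover have "\<beta>\<^sup>2 * (L.nrm u)\<^sup>2 \<le> (L.nrm x)\<^sup>2"
      using power_mono[OF bu, of 2] \<beta> uf(2) by (simp add: power_mult_distrib)
    ultimately show False by linarith
  qed
  then show ?thesis
  proof
    assume "apx (complex_of_real (a + \<beta>))"
    then show ?thesis using \<beta> \<beta>\<eta> by (intro exI[of _ "a + \<beta>"]) simp
  next
    assume "apx (complex_of_real (a - \<beta>))"
    then show ?thesis using \<beta> \<beta>\<eta> by (intro exI[of _ "a - \<beta>"]) simp
  qed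
qed

text \<open>If the inverse sent \<open>v\<close> to a vector of norm zero, then
  \<open>ip v v = b (R v) v = 0\<close>. Otherwise \<open>apx_near\<close> applies at the point 0
  with whatever quotient results. This supplies spectral points also for those \<epsilon> that are
  not small.\<close>

lemma apx_ex: assumes v: "v \<in> D" "0 < L.nrm v" shows "\<exists>z. apx z"
proof -
  have u: "gr (R v) v" using v by (intro gr_R) auto
  have "0 < L.nrm (R v)"
  proof (rule ccontr)
    assume "\<not> ?thesis"
    then have n: "L.nrm (R v) = 0" using L.nrm_nonneg[OF gr_mem(3)[OF u]] by linarith
    have "(F.nrm (R v))\<^sup>2 = Re (ip v (R v))" using gr_eq[OF u] gr_mem[OF u] by (simp add: F.nrm_sq)
    also have "ip v (R v) = 0" using n v by (intro L.ip_null) auto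
    finally have "F.nrm (R v) = 0" by simp
    then have "b (R v) v = 0" using v by (intro F.ip_null) auto
    then have "ip v v = 0" using gr_eq[OF u v(1)] by simp
    then show False using v by (simp add: L.nrm_def)
  qed
  then show ?thesis
    using apx_near[OF u, of 0 "L.nrm (v - sc 0 (R v)) / L.nrm (R v)"] by auto
qed

end

section \<open>Pairs of operators with close resolvents\<close>

locale form_pair = A: form_operator sc S ip D1 b1 + B: form_operator sc S ip D2 b2
  for sc :: "complex \<Rightarrow> 'v::ab_group_add \<Rightarrow> 'v" and S ip D1 b1 D2 b2 +
  fixes \<delta> :: real
  assumes close: "A.gr u f \<Longrightarrow> B.gr v f \<Longrightarrow> A.L.nrm (u - v) \<le> \<delta> * A.L.nrm f"
begin

text \<open>The datum \<open>f\<close> is kept and \<open>u\<close> is replaced by the image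
  \<open>v\<close> of \<open>f\<close> under the other inverse, so the residual changes by
  \<open>z (u - v)\<close> only. The bound \<open>nrm f \<le> (1 + cmod z) * nrm u\<close> turns
  \<open>close\<close> into an estimate relative to \<open>nrm u\<close>.\<close>

lemma approximate_eigenvector_transfer:
  assumes "A.gr u f" "A.L.nrm (f - sc z u) \<le> \<eta> * A.L.nrm u" "0 < A.L.nrm u" "0 \<le> \<delta>" "0 < \<eta>" "\<eta> \<le> 1"
    and small: "4 * \<eta> \<le> e" "4 * ((1 + cmod z) * (cmod z + e)) * \<delta> \<le> e"
  shows "\<exists>v. B.gr v f \<and> 0 < A.L.nrm v \<and> A.L.nrm (f - sc z v) < e * A.L.nrm v"
proof -
  have f: "f \<in> S" "u \<in> S" using A.gr_mem[OF assms(1)] by auto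
  from B.gr_ex[OF f(1)] obtain v where v: "B.gr v f" by blast
  then have vS: "v \<in> S" by (rule B.gr_mem)
  define n where "n = A.L.nrm u"
  define \<theta> where "\<theta> = \<delta> * (1 + cmod z)"
  have "A.L.nrm f \<le> cmod z * n + A.L.nrm (f - sc z u)"
    using A.L.nrm_triangle_sub[of f "sc z u"] f by (simp add: A.L.nrm_scale n_def)
  also have "\<dots> \<le> (1 + cmod z) * n"
    using assms(2) mult_right_mono[OF assms(6) less_imp_le[OF assms(3)]]
    by (simp add: n_def algebra_simps)
  finally have "\<delta> * A.L.nrm f \<le> \<theta> * n" using assms(4) by (simp add: \<theta>_def mult_left_mono mult.assoc)
  with close[OF assms(1) v] have uv: "A.L.nrm (u - v) \<le> \<theta> * n" by linarith
  have e: "0 < e" using assms(5) small(1) by linarith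
  have "4 * (cmod z + e) * \<theta> \<le> e" using small(2) by (simp add: \<theta>_def mult_ac)
  \<comment> \<open>Gives both \<open>\<theta> \<le> 1/4\<close>, so that \<open>v\<close> does not
    degenerate, and room for the loss \<open>e \<theta>\<close> when \<open>nrm u\<close> is
    replaced by \<open>nrm v\<close>.\<close>
  then have \<theta>: "4 * (cmod z * \<theta>) + 4 * (e * \<theta>) \<le> e" by (simp add: algebra_simps)
  have z\<theta>: "0 \<le> cmod z * \<theta>" using assms(4) by (simp add: \<theta>_def)
  have "A.L.nrm u \<le> A.L.nrm v + A.L.nrm (u - v)" using f vS by (intro A.L.nrm_triangle_sub)
  then have nv: "(1 - \<theta>) * n \<le> A.L.nrm v" using uv by (simp add: n_def algebra_simps)
  have "4 * (e * \<theta>) \<le> e" using \<theta> z\<theta> by linarith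
  then have \<theta>1: "\<theta> \<le> 1/4" using e by simp
  have n: "0 < n" using assms(3) by (simp add: n_def)
  have "0 < (1 - \<theta>) * n" using \<theta>1 n by (intro mult_pos_pos) auto
  then have vpos: "0 < A.L.nrm v" using nv by linarith
  have 1: "A.L.nrm (f - sc z v) \<le> A.L.nrm (f - sc z u) + A.L.nrm (sc z u - sc z v)"
    by (rule A.L.nrm_triangle3) (use f vS in auto)
  have 2: "A.L.nrm (sc z u - sc z v) = cmod z * A.L.nrm (u - v)"
    using A.L.nrm_scale[of "u - v" z] f vS by (simp add: A.L.scale_right_diff_distrib)
  have 3: "cmod z * A.L.nrm (u - v) \<le> cmod z * (\<theta> * n)" by (intro mult_left_mono uv) auto
  have "A.L.nrm (f - sc z v) \<le> (\<eta> + cmod z * \<theta>) * n"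
    using assms(2) 1 2 3 by (simp add: n_def algebra_simps)
  also have "\<dots> < (e - e * \<theta>) * n"
  proof (intro mult_strict_right_mono n)
    show "\<eta> + cmod z * \<theta> < e - e * \<theta>" using \<theta> small(1) e by argo
  qed
  also have "\<dots> = e * ((1 - \<theta>) * n)" by (simp add: algebra_simps)
  also have "\<dots> \<le> e * A.L.nrm v" using nv e by simp
  finally show ?thesis using v vpos by (intro exI[of _ v] conjI)
qed

lemma apx_transfer:
  assumes "A.apx z" "0 \<le> \<delta>" "0 < e" "4 * ((1 + cmod z) * (cmod z + e)) * \<delta> \<le> e"
  shows "\<exists>v f. B.gr v f \<and> 0 < A.L.nrm v \<and> A.L.nrm (f - sc z v) < e * A.L.nrm v"
proof -
  define \<eta> where "\<eta> = min 1 (e / 4)"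
  have \<eta>: "0 < \<eta>" "\<eta> \<le> 1" "4 * \<eta> \<le> e" using assms(3) by (auto simp: \<eta>_def)
  obtain u f where uf: "A.gr u f" "A.L.nrm (f - sc z u) < \<eta> * A.L.nrm u"
    using assms(1) \<eta>(1) unfolding A.apx_def by blast
  have "0 < A.L.nrm u"
  proof (rule ccontr)
    assume "\<not> ?thesis"
    then have "A.L.nrm u = 0" using A.L.nrm_nonneg[OF A.gr_mem(3)[OF uf(1)]] by linarith
    moreover have "0 \<le> A.L.nrm (f - sc z u)" using A.gr_mem[OF uf(1)] by (intro A.L.nrm_nonneg) auto
    ultimately show False using uf by simp
  qed
  with approximate_eigenvector_transfer[OF uf(1) less_imp_le[OF uf(2)] _ assms(2) \<eta> assms(4)]
  show ?thesis by blast
qed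

end

text \<open>\<open>M\<close> is a cut-off that maps the larger form domain \<open>D1\<close> into the smaller one and nearly
  commutes with the form. With \<open>w = u - v\<close> and \<open>y\<close> the image of \<open>w\<close> under the first resolvent,
  \<open>\<parallel>w\<parallel>\<^sup>2 = b1 w y = b1 w (y - M y)\<close>, and moving the cut-off to the other argument makes this small.\<close>

lemma resolvents_close:
  assumes A: "form_operator sc S ip D1 b1" and B: "form_operator sc S ip D2 b2"
    and sub: "D2 \<subseteq> D1" and ext: "\<And>u v. u \<in> D2 \<Longrightarrow> v \<in> D2 \<Longrightarrow> b2 u v = b1 u v"
    and M: "\<And>v. v \<in> D1 \<Longrightarrow> M v \<in> D2"
    and small: "\<And>v. v \<in> D1 \<Longrightarrow> semi_inner.nrm ip (v - M v) \<le> \<eta> * semi_inner.nrm b1 v"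
    and comm: "\<And>u v. u \<in> D1 \<Longrightarrow> v \<in> D1 \<Longrightarrow>
      cmod (b1 u (M v) - b1 (M u) v) \<le> \<eta> * (semi_inner.nrm b1 u * semi_inner.nrm b1 v)"
    and "0 \<le> \<eta>"
    and u: "form_operator.gr S ip D1 b1 u f" and v: "form_operator.gr S ip D2 b2 v f"
  shows "semi_inner.nrm ip (u - v) \<le> 3 * \<eta> * semi_inner.nrm ip f"
proof -
  interpret A: form_operator sc S ip D1 b1 by (rule A)
  interpret B: form_operator sc S ip D2 b2 by (rule B)
  define w where "w = u - v"
  have mem: "u \<in> D1" "v \<in> D1" "v \<in> D2" "f \<in> S" "w \<in> D1" "w \<in> S"
    using A.gr_mem[OF u] B.gr_mem[OF v] sub by (auto simp: w_def)
  define y where "y = A.R w"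
  have y: "A.gr y w" unfolding y_def using mem by (intro A.gr_R)
  then have yD: "y \<in> D1" by (rule A.gr_mem)
  have MD: "M y \<in> D1" "M v \<in> D1" using M yD mem sub by auto
  \<comment> \<open>Galerkin orthogonality: \<open>M y\<close> lies in \<open>D2\<close>, where
    \<open>u\<close> and \<open>v\<close> satisfy the same variational equation.\<close>
  have "b1 w (M y) = 0"
  proof -
    have "b1 w (M y) = ip f (M y) - b1 v (M y)"
      unfolding w_def using mem MD A.gr_eq[OF u] by (simp add: A.F.ip_simps)
    moreover have "b1 v (M y) = ip f (M y)"
      using B.gr_eq[OF v M[OF yD]] ext[OF mem(3) M[OF yD]] by simp
    ultimately show ?thesis by simp
  qed
  moreover have "b1 w y = of_real ((A.L.nrm w)\<^sup>2)"
    using A.F.ip_sym[of y w] A.gr_eq[OF y, of w] A.L.ip_self[of w] mem yD by simp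
  ultimately have "of_real ((A.L.nrm w)\<^sup>2) = b1 w (y - M y)"
    using mem yD MD by (simp add: A.F.ip_simps)
  \<comment> \<open>\<open>b1 u\<close> is evaluated through \<open>f\<close>, and in
    \<open>b1 v (M y)\<close> the cut-off moves to \<open>v\<close> at the cost of the commutator in
    the last bracket. Every term now has a factor controlled by \<open>small\<close> or
    \<open>comm\<close>.\<close>
  also have "\<dots> = ip f (y - M y) - b1 (v - M v) y + (b1 v (M y) - b1 (M v) y)"
    unfolding w_def using mem yD MD A.gr_eq[OF u, of "y - M y"] by (simp add: A.F.ip_simps)
  also have "b1 (v - M v) y = ip (v - M v) w"
    using A.F.ip_sym[of y "v - M v"] A.gr_eq[OF y, of "v - M v"] A.L.ip_sym[of "v - M v" w] mem MD yD
    by simp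
  finally have "(A.L.nrm w)\<^sup>2 = cmod (ip f (y - M y) - ip (v - M v) w + (b1 v (M y) - b1 (M v) y))"
    by (metis abs_of_nonneg norm_of_real zero_le_power2)
  also have "\<dots> \<le> cmod (ip f (y - M y)) + cmod (ip (v - M v) w) + cmod (b1 v (M y) - b1 (M v) y)"
    by (meson add_mono norm_triangle_ineq norm_triangle_ineq4 order_refl order_trans)
  also have "\<dots> \<le> \<eta> * A.L.nrm f * A.L.nrm w + \<eta> * A.L.nrm f * A.L.nrm w + \<eta> * A.L.nrm f * A.L.nrm w"
  proof (intro add_mono)
    have yn: "A.F.nrm y \<le> A.L.nrm w" using A.gr_nrm(1)[OF y] .
    have vn: "A.F.nrm v \<le> A.L.nrm f"
    proof -
      have "A.F.nrm v = B.F.nrm v" unfolding A.F.nrm_def B.F.nrm_def using ext mem by simp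
      then show ?thesis using B.gr_nrm(1)[OF v] by simp
    qed
    have "cmod (ip f (y - M y)) \<le> A.L.nrm f * A.L.nrm (y - M y)"
      by (rule A.L.Cauchy_Schwarz) (use mem yD MD in auto)
    also have "\<dots> \<le> A.L.nrm f * (\<eta> * A.L.nrm w)"
      using small[OF yD] mult_left_mono[OF yn \<open>0 \<le> \<eta>\<close>] mem by (intro mult_left_mono) auto
    finally show "cmod (ip f (y - M y)) \<le> \<eta> * A.L.nrm f * A.L.nrm w" by (simp add: mult_ac)
    have "cmod (ip (v - M v) w) \<le> A.L.nrm (v - M v) * A.L.nrm w"
      by (rule A.L.Cauchy_Schwarz) (use mem MD in auto)
    also have "\<dots> \<le> (\<eta> * A.L.nrm f) * A.L.nrm w"
      using small[OF mem(2)] mult_left_mono[OF vn \<open>0 \<le> \<eta>\<close>] mem by (intro mult_right_mono) auto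
    finally show "cmod (ip (v - M v) w) \<le> \<eta> * A.L.nrm f * A.L.nrm w" .
    have "A.F.nrm v * A.F.nrm y \<le> A.L.nrm f * A.L.nrm w"
      using vn yn mem yD by (intro mult_mono) auto
    then show "cmod (b1 v (M y) - b1 (M v) y) \<le> \<eta> * A.L.nrm f * A.L.nrm w"
      using comm[OF mem(2) yD] mult_left_mono[of _ _ \<eta>] \<open>0 \<le> \<eta>\<close> by (fastforce simp: mult.assoc)
  qed
  finally have "A.L.nrm w * A.L.nrm w \<le> (3 * \<eta> * A.L.nrm f) * A.L.nrm w"
    by (simp add: power2_eq_square)
  then show ?thesis
    using A.L.nrm_nonneg[OF mem(6)] A.L.nrm_nonneg[OF mem(4)] \<open>0 \<le> \<eta>\<close>
    unfolding w_def[symmetric] by (cases "A.L.nrm w = 0") (auto simp: mult_le_cancel_right)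
qed

section \<open>Calculus of \<open>C\<^sup>k\<close> functions\<close>

lemma Ck_on_SucD:
  assumes "Ck_on (Suc k) f S" "open S" "x \<in> S"
  shows "(f has_derivative frechet_derivative f (at x)) (at x)"
  using assms by (simp add: differentiable_on_eq_differentiable_at frechet_derivative_works)

text \<open>As \<open>S\<close> is open, each of its points has a neighbourhood in which both
  functions agree, so their derivatives agree as well.\<close>

lemma Ck_on_cong:
  assumes "open S" "\<And>x. x \<in> S \<Longrightarrow> f x = g x" "Ck_on k f S"
  shows "Ck_on k g S"
  using assms(2,3)
proof (induction k arbitrary: f g)
  case 0
  then show ?case by (auto cong: continuous_on_cong)
next
  case (Suc k)
  have f: "(f has_derivative frechet_derivative f (at x)) (at x)" if "x \<in> S" for x
    using Ck_on_SucD[OF Suc.prems(2) assms(1) that] .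
  have g: "(g has_derivative frechet_derivative f (at x)) (at x)" if "x \<in> S" for x
    by (rule has_derivative_transform_within_open[OF f[OF that] assms(1) that Suc.prems(1)])
  have eq: "frechet_derivative f (at x) = frechet_derivative g (at x)" if "x \<in> S" for x
    using frechet_derivative_at[OF g[OF that]] .
  have "Ck_on k (\<lambda>x. frechet_derivative g (at x) b) S" if "b \<in> Basis" for b
  proof (rule Suc.IH[of "\<lambda>x. frechet_derivative f (at x) b"])
    show "Ck_on k (\<lambda>x. frechet_derivative f (at x) b) S" using Suc.prems(2) that by simp
  qed (simp add: eq)
  moreover have "g differentiable_on S"
    using g by (auto simp: differentiable_on_eq_differentiable_at[OF assms(1)] differentiable_def)
  ultimately show ?case by simp
qed

text \<open>Admits any explicit formula for the derivative in place of the choice made by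
  \<open>frechet_derivative\<close>.\<close>

lemma Ck_on_SucI:
  assumes "open S" and D: "\<And>x. x \<in> S \<Longrightarrow> (f has_derivative D x) (at x)"
    and C: "\<And>b. b \<in> Basis \<Longrightarrow> Ck_on k (\<lambda>x. D x b) S"
  shows "Ck_on (Suc k) f S"
proof -
  have "Ck_on k (\<lambda>x. frechet_derivative f (at x) b) S" if "b \<in> Basis" for b
    by (rule Ck_on_cong[OF assms(1) _ C[OF that]]) (simp add: frechet_derivative_at[OF D, symmetric])
  moreover have "f differentiable_on S"
    using D by (auto simp: differentiable_on_eq_differentiable_at[OF assms(1)] differentiable_def)
  ultimately show ?thesis by simp
qed

lemma Ck_on_real_SucI:
  fixes f :: "real \<Rightarrow> real"
  assumes "open S" "\<And>x. x \<in> S \<Longrightarrow> (f has_field_derivative D x) (at x)" "Ck_on k D S"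
  shows "Ck_on (Suc k) f S"
  by (rule Ck_on_SucI[where D="\<lambda>x y. D x * y"]) (use assms in \<open>auto simp: has_field_derivative_def\<close>)

lemma Ck_on_mono: "Ck_on (Suc k) f S \<Longrightarrow> Ck_on k f S"
proof (induction k arbitrary: f)
  case 0
  then show ?case by (simp add: differentiable_imp_continuous_on)
next
  case (Suc k)
  then show ?case by (metis Ck_on.simps(2))
qed

section \<open>Algebraic closure properties of class C^k and the chain rule\<close>

lemma Ck_on_const: "Ck_on k (\<lambda>_. c) S"
  by (induction k arbitrary: c) (auto simp: frechet_derivative_const)

lemma Ck_on_linear:
  fixes f :: "'a::euclidean_space \<Rightarrow> 'b::real_normed_vector"
  assumes "bounded_linear h" "open S"
  shows "Ck_on k f S \<Longrightarrow> Ck_on k (\<lambda>x. h (f x)) S"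
proof (induction k arbitrary: f)
  case 0
  then show ?case using bounded_linear.continuous_on[OF assms(1)] by simp
next
  case (Suc k)
  show ?case
  proof (rule Ck_on_SucI[OF assms(2), where D="\<lambda>x b. h (frechet_derivative f (at x) b)"])
    fix x assume "x \<in> S"
    then show "((\<lambda>x. h (f x)) has_derivative (\<lambda>b. h (frechet_derivative f (at x) b))) (at x)"
      using Ck_on_SucD[OF Suc.prems assms(2)] bounded_linear.has_derivative[OF assms(1)] by blast
  next
    fix b :: 'a assume "b \<in> Basis"
    then show "Ck_on k (\<lambda>x. h (frechet_derivative f (at x) b)) S"
      using Suc.prems by (intro Suc.IH) simp
  qed
qed

lemma Ck_on_add:
  fixes f :: "'a::euclidean_space \<Rightarrow> 'b::real_normed_vector"
  assumes "open S" "Ck_on k f S" "Ck_on k g S"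
  shows "Ck_on k (\<lambda>x. f x + g x) S"
  using assms(2,3)
proof (induction k arbitrary: f g)
  case 0
  then show ?case by (simp add: continuous_on_add)
next
  case (Suc k)
  show ?case
  proof (rule Ck_on_SucI[OF assms(1),
        where D="\<lambda>x b. frechet_derivative f (at x) b + frechet_derivative g (at x) b"])
    fix x assume "x \<in> S"
    then show "((\<lambda>x. f x + g x) has_derivative
        (\<lambda>b. frechet_derivative f (at x) b + frechet_derivative g (at x) b)) (at x)"
      using Suc.prems assms(1) by (intro has_derivative_add Ck_on_SucD)
  next
    fix b :: 'a assume "b \<in> Basis"
    then show "Ck_on k (\<lambda>x. frechet_derivative f (at x) b + frechet_derivative g (at x) b) S"
      using Suc.prems by (intro Suc.IH) auto
  qed
qed

lemma Ck_on_bilinear: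
  fixes f :: "'a::euclidean_space \<Rightarrow> 'b::real_normed_vector" and g :: "'a \<Rightarrow> 'c::real_normed_vector"
  assumes "bounded_bilinear h" "open S"
  shows "Ck_on k f S \<Longrightarrow> Ck_on k g S \<Longrightarrow> Ck_on k (\<lambda>x. h (f x) (g x)) S"
proof (induction k arbitrary: f g)
  case 0
  then show ?case using bounded_bilinear.continuous_on[OF assms(1)] by simp
next
  case (Suc k)
  show ?case
  proof (rule Ck_on_SucI[OF assms(2),
        where D="\<lambda>x b. h (f x) (frechet_derivative g (at x) b) + h (frechet_derivative f (at x) b) (g x)"])
    fix x assume "x \<in> S"
    then show "((\<lambda>x. h (f x) (g x)) has_derivative
        (\<lambda>b. h (f x) (frechet_derivative g (at x) b) + h (frechet_derivative f (at x) b) (g x))) (at x)"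
      using Suc.prems assms by (intro bounded_bilinear.FDERIV[OF assms(1)] Ck_on_SucD)
  next
    fix b :: 'a assume "b \<in> Basis"
    then show "Ck_on k (\<lambda>x. h (f x) (frechet_derivative g (at x) b) + h (frechet_derivative f (at x) b) (g x)) S"
      using Suc.prems by (intro Ck_on_add[OF assms(2)] Suc.IH Ck_on_mono[of k f] Ck_on_mono[of k g]) auto
  qed
qed

lemmas Ck_on_mult = Ck_on_bilinear[OF bounded_bilinear_mult]

lemma Ck_on_minus: "open S \<Longrightarrow> Ck_on k f S \<Longrightarrow> Ck_on k (\<lambda>x. - f x) S"
  by (rule Ck_on_linear[OF bounded_linear_minus[OF bounded_linear_ident]])

lemma Ck_on_diff: "open S \<Longrightarrow> Ck_on k f S \<Longrightarrow> Ck_on k g S \<Longrightarrow> Ck_on k (\<lambda>x. f x - g x) S"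
  using Ck_on_add[of S k f "\<lambda>x. - g x"] Ck_on_minus[of S k g] by simp

lemma Ck_on_prod:
  fixes f :: "'i \<Rightarrow> 'a::euclidean_space \<Rightarrow> real"
  assumes "open S" "\<And>i. i \<in> I \<Longrightarrow> Ck_on k (f i) S"
  shows "Ck_on k (\<lambda>x. \<Prod>i\<in>I. f i x) S"
  using assms(2)
proof (induction I rule: infinite_finite_induct)
  case (insert i I)
  then show ?case by (simp add: Ck_on_mult[OF assms(1)])
qed (auto simp: Ck_on_const)

text \<open>The outer function has one real variable, so its derivative is multiplication by its
  value at 1 and the chain rule yields a product. \<open>g\<close> is generalised because the
  induction moves on to its derivative.\<close>

lemma Ck_on_compose:
  fixes f :: "'a::euclidean_space \<Rightarrow> real" and g :: "real \<Rightarrow> real"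
  assumes "open S" "open T" "\<And>x. x \<in> S \<Longrightarrow> f x \<in> T" "Ck_on k g T" "Ck_on k f S"
  shows "Ck_on k (\<lambda>x. g (f x)) S"
  using assms(4,5)
proof (induction k arbitrary: g)
  case 0
  then show ?case using continuous_on_compose2[of T g S f] assms(3) by auto
next
  case (Suc k)
  show ?case
  proof (rule Ck_on_SucI[OF assms(1),
        where D="\<lambda>x b. frechet_derivative g (at (f x)) 1 * frechet_derivative f (at x) b"])
    fix x assume x: "x \<in> S"
    have g: "(g has_derivative frechet_derivative g (at (f x))) (at (f x))"
      by (rule Ck_on_SucD[OF Suc.prems(1) assms(2)]) (use assms(3) x in auto)
    have lin: "frechet_derivative g (at (f x)) y = frechet_derivative g (at (f x)) 1 * y" for y
      using linear_scale[OF has_derivative_linear[OF g], of y 1] by (simp add: mult.commute)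
    have "((\<lambda>x. g (f x)) has_derivative
        (\<lambda>b. frechet_derivative g (at (f x)) (frechet_derivative f (at x) b))) (at x)"
      by (rule has_derivative_compose[OF Ck_on_SucD[OF Suc.prems(2) assms(1) x] g])
    then show "((\<lambda>x. g (f x)) has_derivative
        (\<lambda>b. frechet_derivative g (at (f x)) 1 * frechet_derivative f (at x) b)) (at x)"
      by (subst (asm) lin)
  next
    fix b :: 'a assume "b \<in> Basis"
    then show "Ck_on k (\<lambda>x. frechet_derivative g (at (f x)) 1 * frechet_derivative f (at x) b) S"
      using Suc.prems by (intro Ck_on_mult[OF assms(1)] Suc.IH[of "\<lambda>y. frechet_derivative g (at y) 1"] Ck_on_mono[of k f]) auto
  qed
qed

section \<open>Elementary functions of class C^k\<close>

lemma Ck_on_inner: "open S \<Longrightarrow> Ck_on k (\<lambda>x. x \<bullet> c) S"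
proof (cases k)
  case (Suc j)
  assume "open S"
  then show ?thesis unfolding Suc
    by (intro Ck_on_SucI[where D="\<lambda>x b. b \<bullet> c"] Ck_on_const) (auto intro!: derivative_eq_intros)
qed (auto intro!: continuous_intros)

lemma Ck_on_sin_cos: "Ck_on k (sin :: real \<Rightarrow> real) UNIV \<and> Ck_on k (cos :: real \<Rightarrow> real) UNIV"
proof (induction k)
  case (Suc k)
  show ?case
  proof
    show "Ck_on (Suc k) (sin :: real \<Rightarrow> real) UNIV"
      using Suc by (intro Ck_on_real_SucI[where D=cos]) (auto intro: DERIV_sin)
    show "Ck_on (Suc k) (cos :: real \<Rightarrow> real) UNIV"
      using Suc by (intro Ck_on_real_SucI[where D="\<lambda>x. - sin x"] Ck_on_minus) (auto intro: DERIV_cos)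
  qed
qed (auto intro!: continuous_intros)

lemma Ck_on_inverse: "Ck_on k (inverse :: real \<Rightarrow> real) {0<..}"
proof (induction k)
  case (Suc k)
  then show ?case
    by (intro Ck_on_real_SucI[where D="\<lambda>x. - (inverse x * inverse x)"] Ck_on_minus Ck_on_mult)
       (auto intro!: derivative_eq_intros simp: power2_eq_square)
qed (auto intro!: continuous_intros)

lemma Ck_on_ln: "Ck_on k (ln :: real \<Rightarrow> real) {0<..}"
proof (cases k)
  case (Suc j)
  show ?thesis unfolding Suc
    by (rule Ck_on_real_SucI[where D=inverse])
       (auto intro: Ck_on_inverse intro!: derivative_eq_intros simp: field_simps)
qed (auto intro!: continuous_intros)

lemma smooth_onI: "(\<And>k. Ck_on k f S) \<Longrightarrow> smooth_on f S"
  by (simp add: smooth_on_def)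

lemma smooth_onD: "smooth_on f S \<Longrightarrow> Ck_on k f S"
  by (simp add: smooth_on_def)

lemma smooth_has_derivative: "smooth_on f UNIV \<Longrightarrow> (f has_derivative frechet_derivative f (at x)) (at x)"
  using Ck_on_SucD[of 0 f UNIV x] smooth_onD[of f UNIV "Suc 0"] by simp

lemma smooth_continuous: "smooth_on f UNIV \<Longrightarrow> continuous_on UNIV f"
  using smooth_onD[of f UNIV 0] by simp

lemma smooth_frechet: "smooth_on f UNIV \<Longrightarrow> b \<in> Basis \<Longrightarrow> smooth_on (\<lambda>x. frechet_derivative f (at x) b) UNIV"
  using smooth_onD[of f UNIV "Suc _"] by (auto intro!: smooth_onI)

subsection \<open>A smooth step\<close>

text \<open>\<open>step_aux 0\<close> is \<open>exp (-1/t)\<close>; the others are what its derivatives are combined from.\<close>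

definition step_aux :: "nat \<Rightarrow> real \<Rightarrow> real" where
  "step_aux m t = (if 0 < t then (1 / t) ^ m * exp (- (1 / t)) else 0)"

abbreviation "step \<equiv> step_aux 0"

text \<open>With s = 1/t this is s^m / e^s for s tending to infinity. It yields the derivative at 0,
  where the right difference quotient of \<open>step_aux m\<close> is
  \<open>step_aux (Suc m)\<close>.\<close>

lemma step_aux_at_right: "(step_aux m \<longlongrightarrow> 0) (at_right 0)"
proof -
  have "((\<lambda>t::real. inverse t ^ m / exp (inverse t)) \<longlongrightarrow> 0) (at_right 0)"
    by (rule filterlim_compose[OF tendsto_power_div_exp_0 filterlim_inverse_at_top_right])
  then show ?thesis
    by (rule Lim_transform_eventually)
       (auto simp: step_aux_def exp_minus field_simps eventually_at_right_field intro!: exI[of _ 1])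
qed

lemma DERIV_step_aux:
  "(step_aux m has_field_derivative step_aux (Suc (Suc m)) t - of_nat m * step_aux (Suc m) t) (at t)"
proof -
  consider "0 < t" | "t < 0" | "t = 0" by linarith
  then show ?thesis
  proof cases
    case 1
    have "((\<lambda>t. (1 / t) ^ m * exp (- (1 / t))) has_field_derivative
        (1 / t) ^ Suc (Suc m) * exp (- (1 / t)) - of_nat m * ((1 / t) ^ Suc m * exp (- (1 / t)))) (at t)"
    proof -
      have a: "((\<lambda>t. 1 / t) has_field_derivative - ((1 / t)\<^sup>2)) (at t)"
        using 1 by (auto intro!: derivative_eq_intros simp: power2_eq_square)
      have c: "((\<lambda>t. exp (- (1 / t))) has_field_derivative exp (- (1 / t)) * (1 / t)\<^sup>2) (at t)"
        using DERIV_fun_exp[OF DERIV_minus[OF a]] by simp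
      have eq: "of_nat m * (- s\<^sup>2 * s ^ (m - Suc 0)) * e + e * s\<^sup>2 * s ^ m
          = s ^ Suc (Suc m) * e - of_nat m * (s ^ Suc m * e)" for s e :: real
        by (cases m) (simp_all add: algebra_simps power2_eq_square)
      show ?thesis
        using DERIV_mult[OF DERIV_power[OF a] c, of m] unfolding eq .
    qed
    then have "(step_aux m has_field_derivative
        (1 / t) ^ Suc (Suc m) * exp (- (1 / t)) - of_nat m * ((1 / t) ^ Suc m * exp (- (1 / t)))) (at t)"
      by (rule has_field_derivative_transform_within_open[where S="{0<..}"]) (use 1 in \<open>auto simp: step_aux_def\<close>)
    then show ?thesis using 1 by (simp add: step_aux_def)
  next
    case 2
    have "((\<lambda>t. 0) has_field_derivative 0) (at t)" by simp
    then have "(step_aux m has_field_derivative 0) (at t)"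
      by (rule has_field_derivative_transform_within_open[where S="{..<0}"]) (use 2 in \<open>auto simp: step_aux_def\<close>)
    then show ?thesis using 2 by (simp add: step_aux_def)
  next
    case 3
    have "((\<lambda>y. (step_aux m y - step_aux m 0) / (y - 0)) \<longlongrightarrow> 0) (at 0)"
    proof (subst filterlim_at_split, intro conjI)
      show "((\<lambda>y. (step_aux m y - step_aux m 0) / (y - 0)) \<longlongrightarrow> 0) (at_left 0)"
        by (rule Lim_transform_eventually[OF tendsto_const])
           (auto simp: step_aux_def eventually_at_left_field intro!: exI[of _ "-1"])
      show "((\<lambda>y. (step_aux m y - step_aux m 0) / (y - 0)) \<longlongrightarrow> 0) (at_right 0)"
        by (rule Lim_transform_eventually[OF step_aux_at_right[of "Suc m"]])
           (auto simp: step_aux_def eventually_at_right_field intro!: exI[of _ 1])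
    qed
    then show ?thesis using 3 by (simp add: has_field_derivative_iff step_aux_def)
  qed
qed

lemma Ck_on_step_aux: "Ck_on k (step_aux m) UNIV"
proof (induction k arbitrary: m)
  case 0
  then show ?case by (simp add: continuous_at_imp_continuous_on DERIV_isCont[OF DERIV_step_aux])
next
  case (Suc k)
  show ?case
    by (rule Ck_on_real_SucI[OF _ DERIV_step_aux]) (auto intro!: Ck_on_diff Ck_on_mult Ck_on_const Suc)
qed

lemma DERIV_step: "(step has_field_derivative step_aux 2 t) (at t)"
  using DERIV_step_aux[of 0 t] by (simp add: numeral_2_eq_2)

text \<open>The bound 4 comes from squaring \<open>s \<le> exp s\<close> at s = 1/(2t).\<close>

lemma step_bounds: "0 \<le> step t" "step t \<le> 1" "0 \<le> step_aux 2 t" "step_aux 2 t \<le> 4"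
proof -
  show "step_aux 2 t \<le> 4"
  proof (cases "0 < t")
    case True
    define s where "s = 1 / (2 * t)"
    have s: "0 < s" "1 / t = 2 * s" using True by (auto simp: s_def)
    have "s \<le> exp s" using exp_ge_add_one_self[of s] by linarith
    then have "s\<^sup>2 \<le> (exp s)\<^sup>2" using s by (intro power_mono) auto
    moreover have "(1 / t)\<^sup>2 = 4 * s\<^sup>2" by (simp add: s(2) power_mult_distrib)
    moreover have "(exp s)\<^sup>2 = exp (1 / t)" by (simp add: s(2) exp_double)
    ultimately have "(1 / t)\<^sup>2 \<le> 4 * exp (1 / t)" by simp
    then have "(1 / t)\<^sup>2 * exp (- (1 / t)) \<le> 4 * exp (1 / t) * exp (- (1 / t))"
      by (intro mult_right_mono) auto
    also have "\<dots> = 4" by (simp add: exp_minus)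
    finally show ?thesis using True by (simp add: step_aux_def)
  qed (simp add: step_aux_def)
qed (auto simp: step_aux_def)

text \<open>\<open>step\<close> stays below 1, so a cut-off built from it never equals 1; this rate
  decides how close to 1 it gets.\<close>

lemma one_minus_step: "0 < t \<Longrightarrow> 1 - step t \<le> 1 / t"
  using exp_ge_add_one_self[of "- (1 / t)"] by (simp add: step_aux_def)

section \<open>The space \<open>L\<^sub>2\<close>\<close>

abbreviation (input) cscale :: "complex \<Rightarrow> ('a \<Rightarrow> complex) \<Rightarrow> 'a \<Rightarrow> complex" where
  "cscale c u \<equiv> (\<lambda>x. c * u x)"

lemma L2_D: assumes "u \<in> L2 Q"
  shows "u \<in> borel_measurable (lebesgue_on Q)" "integrable (lebesgue_on Q) (\<lambda>x. (cmod (u x))\<^sup>2)"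
  using assms by (auto simp: L2_def)

lemma L2_I: "u \<in> borel_measurable (lebesgue_on Q) \<Longrightarrow>
    integrable (lebesgue_on Q) (\<lambda>x. (cmod (u x))\<^sup>2) \<Longrightarrow> u \<in> L2 Q"
  by (simp add: L2_def)

lemma L2_dominated:
  assumes "v \<in> borel_measurable (lebesgue_on Q)" "u \<in> L2 Q"
    "AE x in lebesgue_on Q. cmod (v x) \<le> C * cmod (u x)"
  shows "v \<in> L2 Q"
proof (rule L2_I[OF assms(1)])
  show "integrable (lebesgue_on Q) (\<lambda>x. (cmod (v x))\<^sup>2)"
  proof (rule Bochner_Integration.integrable_bound)
    show "integrable (lebesgue_on Q) (\<lambda>x. C\<^sup>2 * (cmod (u x))\<^sup>2)"
      using L2_D[OF assms(2)] by (intro integrable_mult_right)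
    show "(\<lambda>x. (cmod (v x))\<^sup>2) \<in> borel_measurable (lebesgue_on Q)"
      using assms(1) by measurable
    show "AE x in lebesgue_on Q. norm ((cmod (v x))\<^sup>2) \<le> norm (C\<^sup>2 * (cmod (u x))\<^sup>2)"
      using assms(3)
    proof eventually_elim
      case (elim x)
      then show ?case using power_mono[OF elim, of 2] by (simp add: power_mult_distrib norm_mult)
    qed
  qed
qed

lemma L2_zero: "(\<lambda>x. 0) \<in> L2 Q"
  by (rule L2_I) auto

lemma L2_add: assumes "u \<in> L2 Q" "v \<in> L2 Q" shows "(\<lambda>x. u x + v x) \<in> L2 Q"
proof (rule L2_I)
  note [measurable] = L2_D(1)[OF assms(1)] L2_D(1)[OF assms(2)]
  show "(\<lambda>x. u x + v x) \<in> borel_measurable (lebesgue_on Q)" by measurable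
  show "integrable (lebesgue_on Q) (\<lambda>x. (cmod (u x + v x))\<^sup>2)"
  proof (rule Bochner_Integration.integrable_bound)
    show "integrable (lebesgue_on Q) (\<lambda>x. 2 * (cmod (u x))\<^sup>2 + 2 * (cmod (v x))\<^sup>2)"
      using assms by (intro Bochner_Integration.integrable_add integrable_mult_right L2_D)
    show "(\<lambda>x. (cmod (u x + v x))\<^sup>2) \<in> borel_measurable (lebesgue_on Q)" by measurable
    have "(cmod (a + b))\<^sup>2 \<le> 2 * (cmod a)\<^sup>2 + 2 * (cmod b)\<^sup>2" for a b
    proof -
      have "(cmod (a + b))\<^sup>2 \<le> (cmod a + cmod b)\<^sup>2" by (intro power_mono norm_triangle_ineq) auto
      moreover have "0 \<le> (cmod a - cmod b)\<^sup>2" by simp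
      ultimately show ?thesis by (simp add: power2_sum power2_diff)
    qed
    then show "AE x in lebesgue_on Q. norm ((cmod (u x + v x))\<^sup>2) \<le> norm (2 * (cmod (u x))\<^sup>2 + 2 * (cmod (v x))\<^sup>2)"
      by simp
  qed
qed

lemma L2_scale: assumes "u \<in> L2 Q" shows "cscale c u \<in> L2 Q"
  by (rule L2_dominated[OF _ assms, of _ "cmod c"]) (use L2_D(1)[OF assms] in \<open>auto simp: norm_mult\<close>)

lemma L2_mult:
  assumes "u \<in> L2 Q" "m \<in> borel_measurable (lebesgue_on Q)" "\<And>x. x \<in> Q \<Longrightarrow> cmod (m x) \<le> C" "Q \<in> sets lebesgue"
  shows "(\<lambda>x. m x * u x) \<in> L2 Q"
proof (rule L2_dominated[OF _ assms(1), of _ C])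
  show "(\<lambda>x. m x * u x) \<in> borel_measurable (lebesgue_on Q)"
    using assms(2) L2_D(1)[OF assms(1)] by measurable
  show "AE x in lebesgue_on Q. cmod (m x * u x) \<le> C * cmod (u x)"
    using assms(3,4) by (intro AE_I2) (auto simp: norm_mult space_restrict_space intro!: mult_right_mono)
qed

lemma L2_prod_integrable: assumes "u \<in> L2 Q" "v \<in> L2 Q"
  shows "integrable (lebesgue_on Q) (\<lambda>x. u x * v x)" "integrable (lebesgue_on Q) (\<lambda>x. u x * cnj (v x))"
proof -
  note [measurable] = L2_D(1)[OF assms(1)] L2_D(1)[OF assms(2)]
  have i: "integrable (lebesgue_on Q) (\<lambda>x. (cmod (u x))\<^sup>2 + (cmod (v x))\<^sup>2)"
    using assms by (intro Bochner_Integration.integrable_add L2_D)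
  have le: "cmod a * cmod b \<le> (cmod a)\<^sup>2 + (cmod b)\<^sup>2" for a b
  proof -
    have "2 * (cmod a * cmod b) \<le> (cmod a)\<^sup>2 + (cmod b)\<^sup>2"
      using sum_squares_bound[of "cmod a" "cmod b"] by (simp add: mult.assoc)
    moreover have "0 \<le> cmod a * cmod b" by simp
    ultimately show ?thesis by linarith
  qed
  show "integrable (lebesgue_on Q) (\<lambda>x. u x * v x)"
    by (rule Bochner_Integration.integrable_bound[OF i]) (auto simp: norm_mult le)
  have "(\<lambda>x. cnj (v x)) \<in> borel_measurable (lebesgue_on Q)"
    by (rule measurable_compose[OF L2_D(1)[OF assms(2)] borel_measurable_continuous_onI[OF continuous_on_cnj[OF continuous_on_id]]])
  then have "(\<lambda>x. u x * cnj (v x)) \<in> borel_measurable (lebesgue_on Q)" by measurable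
  then show "integrable (lebesgue_on Q) (\<lambda>x. u x * cnj (v x))"
    by (intro Bochner_Integration.integrable_bound[OF i]) (auto simp: norm_mult le)
qed

interpretation csp: vector_space cscale
  by standard (auto simp: fun_eq_iff algebra_simps)

lemma l2_inner_self: "l2_inner Q x x = complex_of_real (LINT t|lebesgue_on Q. (cmod (x t))\<^sup>2)"
  unfolding l2_inner_def by (simp only: complex_norm_square[symmetric] integral_complex_of_real)

lemma L2_semi_inner: "semi_inner cscale (L2 Q) (l2_inner Q)"
proof
  show "csp.subspace (L2 Q)"
    unfolding csp.subspace_def
    by (auto simp: plus_fun_def zero_fun_def L2_zero L2_add L2_scale)
  show "l2_inner Q (x + y) z = l2_inner Q x z + l2_inner Q y z" if "x \<in> L2 Q" "y \<in> L2 Q" "z \<in> L2 Q" for x y z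
    using that by (simp add: l2_inner_def distrib_right L2_prod_integrable)
  show "l2_inner Q (cscale c x) y = c * l2_inner Q x y" if "x \<in> L2 Q" "y \<in> L2 Q" for c x y
    by (simp add: l2_inner_def mult.assoc)
  show "l2_inner Q y x = cnj (l2_inner Q x y)" for x y
    using Bochner_Integration.integral_cnj[of "lebesgue_on Q" "\<lambda>t. x t * cnj (y t)"]
    by (simp add: l2_inner_def mult.commute)
  show "0 \<le> Re (l2_inner Q x x)" for x
  proof -
    have "l2_inner Q x x = complex_of_real (LINT t|lebesgue_on Q. (cmod (x t))\<^sup>2)"
      by (rule l2_inner_self)
    then show ?thesis by simp
  qed
qed

lemma nrm_l2_inner: "semi_inner.nrm (l2_inner Q) = l2_norm Q"
  by (simp add: fun_eq_iff semi_inner.nrm_def[OF L2_semi_inner] l2_norm_def l2_inner_self)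

interpretation Lsp: semi_inner cscale "L2 Q" "l2_inner Q"
  rewrites "semi_inner.nrm (l2_inner Q) = l2_norm Q" for Q :: "'a::euclidean_space set"
proof -
  show "semi_inner cscale (L2 Q) (l2_inner Q)" by (rule L2_semi_inner)
  show "semi_inner.nrm (l2_inner Q) = l2_norm Q" by (rule nrm_l2_inner)
qed

lemma l2_norm_sq: "(l2_norm Q u)\<^sup>2 = (LINT x|lebesgue_on Q. (cmod (u x))\<^sup>2)"
  by (simp add: l2_norm_def)

lemma nn_integral_L2: "u \<in> L2 Q \<Longrightarrow> (\<integral>\<^sup>+x. ennreal ((cmod (u x))\<^sup>2) \<partial>lebesgue_on Q) = ennreal ((l2_norm Q u)\<^sup>2)"
  by (simp add: l2_norm_sq nn_integral_eq_integral L2_D)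

lemma l2_norm_le_iff: "0 \<le> C \<Longrightarrow> u \<in> L2 Q \<Longrightarrow>
    l2_norm Q u \<le> C \<longleftrightarrow> (\<integral>\<^sup>+x. ennreal ((cmod (u x))\<^sup>2) \<partial>lebesgue_on Q) \<le> ennreal (C\<^sup>2)"
  using Lsp.nrm_nonneg[of u Q] by (simp add: nn_integral_L2 abs_le_square_iff[symmetric])

lemma l2_norm_mono_AE:
  assumes "u \<in> L2 Q" "v \<in> L2 Q" "AE x in lebesgue_on Q. cmod (v x) \<le> C * cmod (u x)" "0 \<le> C"
  shows "l2_norm Q v \<le> C * l2_norm Q u"
proof -
  have "(l2_norm Q v)\<^sup>2 \<le> (LINT x|lebesgue_on Q. C\<^sup>2 * (cmod (u x))\<^sup>2)"
    unfolding l2_norm_sq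
  proof (rule integral_mono_AE)
    show "AE x in lebesgue_on Q. (cmod (v x))\<^sup>2 \<le> C\<^sup>2 * (cmod (u x))\<^sup>2"
      using assms(3)
    proof eventually_elim
      case (elim x)
      then show ?case using power_mono[OF elim, of 2] by (simp add: power_mult_distrib)
    qed
  qed (use assms L2_D in auto)
  also have "\<dots> = (C * l2_norm Q u)\<^sup>2" by (simp add: l2_norm_sq power_mult_distrib)
  finally show ?thesis
    using assms Lsp.nrm_nonneg[OF assms(1)] by (simp add: power2_le_iff_abs_le)
qed

lemma l2_norm_eq_0_iff: assumes "u \<in> L2 Q"
  shows "l2_norm Q u = 0 \<longleftrightarrow> (AE x in lebesgue_on Q. u x = 0)"
  using integral_nonneg_eq_0_iff_AE[OF L2_D(2)[OF assms]] by (simp add: l2_norm_def)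

lemma l2_norm_diff_eq_0_iff: assumes "u \<in> L2 Q" "v \<in> L2 Q"
  shows "l2_norm Q (u - v) = 0 \<longleftrightarrow> (AE x in lebesgue_on Q. u x = v x)"
  by (subst l2_norm_eq_0_iff) (use assms in auto)

text \<open>The core of the Riesz-Fischer theorem: the sums \<open>g n\<close> of absolute
  increments have norm at most 2, so by monotone convergence their supremum is finite almost
  everywhere, and there the increments are absolutely summable.\<close>

lemma L2_Cauchy_AE_limit:
  fixes X :: "nat \<Rightarrow> 'a::euclidean_space \<Rightarrow> complex"
  assumes X: "\<And>n. X n \<in> L2 Q" and fast: "\<And>n. l2_norm Q (X (Suc n) - X n) \<le> (1/2) ^ n"
  shows "\<exists>x\<in>L2 Q. AE t in lebesgue_on Q. (\<lambda>n. X n t) \<longlonglongrightarrow> x t"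
proof -
  let ?M = "lebesgue_on Q"
  note [measurable] = L2_D(1)[OF X]
  define g where "g n t = (\<Sum>i<n. cmod (X (Suc i) t - X i t))" for n t
  have g_L2: "(\<lambda>t. complex_of_real (g n t)) \<in> L2 Q \<and> l2_norm Q (\<lambda>t. complex_of_real (g n t)) \<le> 2" for n
  proof -
    have "(\<lambda>t. complex_of_real (g n t)) \<in> L2 Q \<and> l2_norm Q (\<lambda>t. complex_of_real (g n t)) \<le> (\<Sum>i<n. (1/2) ^ i)"
    proof (induction n)
      case 0
      then show ?case by (simp add: g_def L2_zero l2_norm_def)
    next
      case (Suc n)
      define h where "h t = complex_of_real (cmod (X (Suc n) t - X n t))" for t
      have d: "X (Suc n) - X n \<in> L2 Q" using X by simp
      have hm: "h \<in> borel_measurable ?M" unfolding h_def by measurable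
      have h: "h \<in> L2 Q"
        by (rule L2_dominated[OF hm d, of 1]) (simp add: h_def)
      have hn: "l2_norm Q h \<le> (1/2) ^ n"
        using l2_norm_mono_AE[OF d h, of 1] fast[of n] by (auto simp: h_def)
      have eq: "(\<lambda>t. complex_of_real (g (Suc n) t)) = (\<lambda>t. complex_of_real (g n t)) + h"
        by (simp add: fun_eq_iff g_def h_def)
      show ?case
        unfolding eq using Suc h hn Lsp.nrm_triangle[of "\<lambda>t. complex_of_real (g n t)" Q h] by auto
    qed
    moreover have "(\<Sum>i<n. (1/2) ^ i) \<le> (2::real)"
      using sum_gp_strict[of "1/2::real" n] by simp
    ultimately show ?thesis by linarith
  qed
  have incg: "incseq (\<lambda>n. ennreal ((g n t)\<^sup>2))" for t
    by (intro incseq_SucI ennreal_leI power_mono) (auto simp: g_def intro!: sum_nonneg)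
  have gm [measurable]: "g n \<in> borel_measurable ?M" for n unfolding g_def by measurable
  have "(\<integral>\<^sup>+t. (SUP n. ennreal ((g n t)\<^sup>2)) \<partial>?M) = (SUP n. \<integral>\<^sup>+t. ennreal ((g n t)\<^sup>2) \<partial>?M)"
    by (rule nn_integral_monotone_convergence_SUP) (use incg in \<open>auto simp: incseq_def le_fun_def\<close>)
  also have "\<dots> \<le> ennreal 4"
  proof (rule SUP_least)
    fix n
    have "(\<integral>\<^sup>+t. ennreal ((g n t)\<^sup>2) \<partial>?M) = ennreal ((l2_norm Q (\<lambda>t. complex_of_real (g n t)))\<^sup>2)"
      using nn_integral_L2[of "\<lambda>t. complex_of_real (g n t)" Q] g_L2 by simp
    also have "\<dots> \<le> ennreal (2\<^sup>2)"
      using g_L2[of n] by (intro ennreal_leI power_mono Lsp.nrm_nonneg) auto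
    finally show "(\<integral>\<^sup>+t. ennreal ((g n t)\<^sup>2) \<partial>?M) \<le> ennreal 4" by simp
  qed
  finally have fin: "(\<integral>\<^sup>+t. (SUP n. ennreal ((g n t)\<^sup>2)) \<partial>?M) < \<infinity>"
    by (simp add: order_le_less_trans)
  have "AE t in ?M. (SUP n. ennreal ((g n t)\<^sup>2)) \<noteq> \<infinity>"
    by (rule nn_integral_PInf_AE) (use fin in auto)
  then have conv: "AE t in ?M. convergent (\<lambda>n. X n t)"
  proof eventually_elim
    case (elim t)
    then obtain K where K: "0 \<le> K" "(SUP n. ennreal ((g n t)\<^sup>2)) = ennreal K"
      by (metis ennreal_cases infinity_ennreal_def)
    have "(g n t)\<^sup>2 \<le> K" for n
      using SUP_upper[of n UNIV "\<lambda>n. ennreal ((g n t)\<^sup>2)"] K by simp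
    then have "g n t \<le> sqrt K" for n using real_le_rsqrt by blast
    then have "summable (\<lambda>i. cmod (X (Suc i) t - X i t))"
      unfolding g_def by (intro summableI_nonneg_bounded) auto
    then have "summable (\<lambda>i. X (Suc i) t - X i t)" by (rule summable_norm_cancel)
    then have "convergent (\<lambda>n. \<Sum>i<n. X (Suc i) t - X i t)" by (simp add: summable_iff_convergent)
    moreover have "(\<lambda>n. \<Sum>i<n. X (Suc i) t - X i t) = (\<lambda>n. X n t - X 0 t)"
      by (intro ext sum_lessThan_telescope)
    ultimately have "convergent (\<lambda>n. X n t - X 0 t)" by (simp only:)
    then have "convergent (\<lambda>n. (X n t - X 0 t) + X 0 t)" by (rule convergent_add) (rule convergent_const)
    then show ?case by simp
  qed
  define x where "x t = lim (\<lambda>n. X n t)" for t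
  have lim: "AE t in ?M. (\<lambda>n. X n t) \<longlonglongrightarrow> x t"
    using conv by eventually_elim (simp add: x_def convergent_LIMSEQ_iff)
  have x_meas [measurable]: "x \<in> borel_measurable ?M" unfolding x_def by measurable
  have bd: "AE t in ?M. ennreal ((cmod (x t))\<^sup>2) \<le> 2 * ennreal ((cmod (X 0 t))\<^sup>2) + 2 * (SUP n. ennreal ((g n t)\<^sup>2))"
    using lim
  proof eventually_elim
    case (elim t)
    show ?case
    proof (rule LIMSEQ_le_const2)
      show "(\<lambda>n. ennreal ((cmod (X n t))\<^sup>2)) \<longlonglongrightarrow> ennreal ((cmod (x t))\<^sup>2)"
        by (intro tendsto_intros elim) 
      have "ennreal ((cmod (X n t))\<^sup>2) \<le> 2 * ennreal ((cmod (X 0 t))\<^sup>2) + 2 * (SUP n. ennreal ((g n t)\<^sup>2))" for n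
      proof -
        have "cmod (X n t - X 0 t) \<le> g n t"
          unfolding g_def sum_lessThan_telescope[of "\<lambda>i. X i t" n, symmetric] by (rule norm_sum)
        then have "cmod (X n t) \<le> cmod (X 0 t) + g n t"
          using norm_triangle_sub[of "X n t" "X 0 t"] by linarith
        then have "(cmod (X n t))\<^sup>2 \<le> (cmod (X 0 t) + g n t)\<^sup>2" by (intro power_mono) auto
        also have "\<dots> \<le> 2 * (cmod (X 0 t))\<^sup>2 + 2 * (g n t)\<^sup>2"
          using sum_squares_bound[of "cmod (X 0 t)" "g n t"] by (simp add: power2_sum)
        finally have "ennreal ((cmod (X n t))\<^sup>2) \<le> ennreal (2 * (cmod (X 0 t))\<^sup>2 + 2 * (g n t)\<^sup>2)"
          by (rule ennreal_leI)
        also have "\<dots> = 2 * ennreal ((cmod (X 0 t))\<^sup>2) + 2 * ennreal ((g n t)\<^sup>2)"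
          by (simp add: ennreal_mult)
        also have "\<dots> \<le> 2 * ennreal ((cmod (X 0 t))\<^sup>2) + 2 * (SUP n. ennreal ((g n t)\<^sup>2))"
          by (intro add_left_mono mult_left_mono SUP_upper) auto
        finally show ?thesis .
      qed
      then show "\<exists>N. \<forall>n\<ge>N. ennreal ((cmod (X n t))\<^sup>2) \<le> 2 * ennreal ((cmod (X 0 t))\<^sup>2) + 2 * (SUP n. ennreal ((g n t)\<^sup>2))"
        by blast
    qed
  qed
  have "(\<integral>\<^sup>+t. ennreal ((cmod (x t))\<^sup>2) \<partial>?M)
      \<le> (\<integral>\<^sup>+t. 2 * ennreal ((cmod (X 0 t))\<^sup>2) + 2 * (SUP n. ennreal ((g n t)\<^sup>2)) \<partial>?M)"
    by (rule nn_integral_mono_AE[OF bd])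
  also have "\<dots> = 2 * (\<integral>\<^sup>+t. ennreal ((cmod (X 0 t))\<^sup>2) \<partial>?M) + 2 * (\<integral>\<^sup>+t. (SUP n. ennreal ((g n t)\<^sup>2)) \<partial>?M)"
    by (simp add: nn_integral_add nn_integral_cmult)
  also have "\<dots> < \<infinity>"
    using fin by (simp add: nn_integral_L2[OF X] ennreal_mult_less_top less_top)
  finally have "integrable ?M (\<lambda>t. (cmod (x t))\<^sup>2)"
    by (intro integrableI_nonneg) auto
  then have "x \<in> L2 Q" by (intro L2_I) auto
  with lim show ?thesis by blast
qed

lemma L2_complete:
  fixes X :: "nat \<Rightarrow> 'a::euclidean_space \<Rightarrow> complex"
  assumes X: "\<And>n. X n \<in> L2 Q" and cau: "Lsp.cau Q X"
  shows "\<exists>x\<in>L2 Q. (\<lambda>n. l2_norm Q (X n - x)) \<longlonglongrightarrow> 0"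
proof -
  let ?M = "lebesgue_on Q"
  note cau' = cau[unfolded Lsp.cau_def, rule_format]
  have "\<exists>N. \<forall>m\<ge>N. \<forall>n\<ge>N. l2_norm Q (X m - X n) < (1/2) ^ k" for k :: nat
    using cau'[of "(1/2) ^ k"] by simp
  then obtain N where N: "\<And>k m n. N k \<le> m \<Longrightarrow> N k \<le> n \<Longrightarrow> l2_norm Q (X m - X n) < (1/2) ^ k" by metis
  \<comment> \<open>Strictly increasing indices beyond \<open>N k\<close>, so that consecutive terms
    of the subsequence are within \<open>(1/2)^k\<close>.\<close>
  define r where "r = rec_nat (N 0) (\<lambda>k rk. max (Suc rk) (N (Suc k)))"
  have r: "r (Suc k) = max (Suc (r k)) (N (Suc k))" "r 0 = N 0" for k by (simp_all add: r_def)
  have rN: "N k \<le> r k" for k by (cases k) (simp_all add: r)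
  have "r k < r (Suc k)" for k by (simp add: r less_max_iff_disj)
  then have mono: "strict_mono r" by (simp add: strict_mono_Suc_iff)
  have "l2_norm Q (X (r (Suc n)) - X (r n)) \<le> (1/2) ^ n" for n
    using N[of n "r (Suc n)" "r n"] rN[of n] strict_monoD[OF mono, of n "Suc n"] by simp
  then obtain x where x: "x \<in> L2 Q" "AE t in ?M. (\<lambda>n. X (r n) t) \<longlonglongrightarrow> x t"
    using L2_Cauchy_AE_limit[of "\<lambda>n. X (r n)" Q] X by auto
  note [measurable] = L2_D(1)[OF X] L2_D(1)[OF x(1)]
  \<comment> \<open>Fatou's lemma along the subsequence carries the Cauchy estimate over to the
    limit, for every large \<open>m\<close> and not only for indices of the subsequence.\<close>
  have bnd: "l2_norm Q (X m - x) \<le> e" if e: "0 < e" and m: "\<And>i j. n0 \<le> i \<Longrightarrow> n0 \<le> j \<Longrightarrow> l2_norm Q (X i - X j) < e" "n0 \<le> m" for e n0 m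
  proof -
    have "(\<integral>\<^sup>+t. ennreal ((cmod ((X m - x) t))\<^sup>2) \<partial>?M)
        = (\<integral>\<^sup>+t. liminf (\<lambda>n. ennreal ((cmod (X m t - X (r n) t))\<^sup>2)) \<partial>?M)"
    proof (rule nn_integral_cong_AE)
      show "AE t in ?M. ennreal ((cmod ((X m - x) t))\<^sup>2) = liminf (\<lambda>n. ennreal ((cmod (X m t - X (r n) t))\<^sup>2))"
        using x(2)
      proof eventually_elim
        case (elim t)
        have "(\<lambda>n. ennreal ((cmod (X m t - X (r n) t))\<^sup>2)) \<longlonglongrightarrow> ennreal ((cmod ((X m - x) t))\<^sup>2)"
          by (simp, intro tendsto_intros elim)
        from lim_imp_Liminf[OF _ this] show ?case by simp
      qed
    qed
    also have "\<dots> \<le> liminf (\<lambda>n. \<integral>\<^sup>+t. ennreal ((cmod (X m t - X (r n) t))\<^sup>2) \<partial>?M)"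
      by (rule nn_integral_liminf) auto
    also have "\<dots> \<le> ennreal (e\<^sup>2)"
    proof (rule Liminf_le)
      show "\<forall>\<^sub>F n in sequentially. (\<integral>\<^sup>+t. ennreal ((cmod (X m t - X (r n) t))\<^sup>2) \<partial>?M) \<le> ennreal (e\<^sup>2)"
        unfolding eventually_sequentially
      proof (intro exI[of _ n0] allI impI)
        fix n assume "n0 \<le> n"
        then have "n0 \<le> r n" using seq_suble[OF mono, of n] by linarith
        then have "l2_norm Q (X m - X (r n)) \<le> e" using m by (simp add: less_imp_le)
        then show "(\<integral>\<^sup>+t. ennreal ((cmod (X m t - X (r n) t))\<^sup>2) \<partial>?M) \<le> ennreal (e\<^sup>2)"
          using l2_norm_le_iff[of e "X m - X (r n)" Q] e X by simp
      qed
    qed simp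
    finally show ?thesis
      using l2_norm_le_iff[of e "X m - x" Q] e X x(1) by simp
  qed
  have "(\<lambda>n. l2_norm Q (X n - x)) \<longlonglongrightarrow> 0"
  proof (rule LIMSEQ_I)
    fix e :: real assume "0 < e"
    then obtain n0 where "\<And>i j. n0 \<le> i \<Longrightarrow> n0 \<le> j \<Longrightarrow> l2_norm Q (X i - X j) < e / 2"
      using cau'[of "e / 2"] by auto
    then have "l2_norm Q (X n - x) \<le> e / 2" if "n0 \<le> n" for n
      using bnd[of "e / 2" n0 n] that \<open>0 < e\<close> by simp
    moreover have "0 \<le> l2_norm Q (X n - x)" for n using X x(1) by (intro Lsp.nrm_nonneg) auto
    ultimately have "norm (l2_norm Q (X n - x) - 0) < e" if "n0 \<le> n" for n
      using that \<open>0 < e\<close> by fastforce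
    then show "\<exists>no. \<forall>n\<ge>no. norm (l2_norm Q (X n - x) - 0) < e" by blast
  qed
  with x(1) show ?thesis by blast
qed

interpretation Lh: semi_hilbert cscale "L2 Q" "l2_inner Q"
  rewrites "semi_inner.nrm (l2_inner Q) = l2_norm Q" for Q :: "'a::euclidean_space set"
proof -
  show "semi_hilbert cscale (L2 Q) (l2_inner Q)"
  proof unfold_locales
    fix X :: "nat \<Rightarrow> 'a \<Rightarrow> complex"
    assume "\<And>n. X n \<in> L2 Q" "semi_inner.cau (l2_inner Q) X"
    then show "\<exists>x\<in>L2 Q. (\<lambda>n. semi_inner.nrm (l2_inner Q) (X n - x)) \<longlonglongrightarrow> 0"
      unfolding nrm_l2_inner by (intro L2_complete) (auto simp: Lsp.cau_def semi_inner.cau_def[OF L2_semi_inner] nrm_l2_inner)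
  qed
  show "semi_inner.nrm (l2_inner Q) = l2_norm Q" by (rule nrm_l2_inner)
qed

section \<open>Test functions\<close>

lemma smooth_on_mult:
  fixes f g :: "'a::euclidean_space \<Rightarrow> 'b::real_normed_algebra"
  shows "open S \<Longrightarrow> smooth_on f S \<Longrightarrow> smooth_on g S \<Longrightarrow> smooth_on (\<lambda>x. f x * g x) S"
  by (simp add: smooth_on_def Ck_on_mult)

lemma smooth_on_add: "open S \<Longrightarrow> smooth_on f S \<Longrightarrow> smooth_on g S \<Longrightarrow> smooth_on (\<lambda>x. f x + g x) S"
  by (simp add: smooth_on_def Ck_on_add)

lemma test_functionsD:
  assumes "\<phi> \<in> test_functions Q"
  shows "smooth_on \<phi> UNIV" "compact (closure {x. \<phi> x \<noteq> 0})" "closure {x. \<phi> x \<noteq> 0} \<subseteq> Q"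
  using assms by (auto simp: test_functions_def)

lemma test_functionsI:
  assumes "smooth_on \<phi> UNIV" "compact K" "K \<subseteq> Q" "\<And>x. x \<notin> K \<Longrightarrow> \<phi> x = 0"
  shows "\<phi> \<in> test_functions Q"
proof -
  have "closure {x. \<phi> x \<noteq> 0} \<subseteq> K"
    using assms(4) by (intro closure_minimal compact_imp_closed[OF assms(2)]) auto
  then show ?thesis
    using assms compact_Int_closed[OF assms(2) closed_closure, of "{x. \<phi> x \<noteq> 0}"]
    by (auto simp: test_functions_def inf.absorb2)
qed

lemma test_function_outside: "\<phi> \<in> test_functions Q \<Longrightarrow> x \<notin> Q \<Longrightarrow> \<phi> x = 0"
  using test_functionsD(3)[of \<phi> Q] closure_subset[of "{x. \<phi> x \<noteq> 0}"] by auto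

lemma test_functions_mono: "Q \<subseteq> Q' \<Longrightarrow> test_functions Q \<subseteq> test_functions Q'"
  by (auto simp: test_functions_def)

lemma test_function_continuous: "\<phi> \<in> test_functions Q \<Longrightarrow> continuous_on UNIV \<phi>"
  by (intro smooth_continuous test_functionsD)

lemma test_function_zero: "(\<lambda>x. 0) \<in> test_functions Q"
  by (rule test_functionsI[of _ "{}"]) (auto intro!: smooth_onI Ck_on_const)

lemma test_function_smooth_mult:
  assumes "smooth_on f UNIV" "\<phi> \<in> test_functions Q"
  shows "(\<lambda>x. f x * \<phi> x) \<in> test_functions Q"
proof (rule test_functionsI)
  show "smooth_on (\<lambda>x. f x * \<phi> x) UNIV"
    by (rule smooth_on_mult[OF open_UNIV assms(1) test_functionsD(1)[OF assms(2)]])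
  show "f x * \<phi> x = 0" if "x \<notin> closure {x. \<phi> x \<noteq> 0}" for x
    using that closure_subset[of "{x. \<phi> x \<noteq> 0}"] by auto
qed (use test_functionsD[OF assms(2)] in auto)

lemma test_function_add:
  assumes "\<phi> \<in> test_functions Q" "\<psi> \<in> test_functions Q"
  shows "(\<lambda>x. \<phi> x + \<psi> x) \<in> test_functions Q"
proof (rule test_functionsI)
  let ?K = "closure {x. \<phi> x \<noteq> 0} \<union> closure {x. \<psi> x \<noteq> 0}"
  show "smooth_on (\<lambda>x. \<phi> x + \<psi> x) UNIV"
    by (rule smooth_on_add[OF open_UNIV test_functionsD(1)[OF assms(1)] test_functionsD(1)[OF assms(2)]])
  show "compact ?K"
    using test_functionsD(2)[OF assms(1)] test_functionsD(2)[OF assms(2)] by (rule compact_Un)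
  show "?K \<subseteq> Q" using test_functionsD(3)[OF assms(1)] test_functionsD(3)[OF assms(2)] by simp
  show "\<phi> x + \<psi> x = 0" if "x \<notin> ?K" for x
  proof -
    have "\<phi> x = 0" using that closure_subset[of "{x. \<phi> x \<noteq> 0}"] by auto
    moreover have "\<psi> x = 0" using that closure_subset[of "{x. \<psi> x \<noteq> 0}"] by auto
    ultimately show ?thesis by simp
  qed
qed

lemma test_function_scale: "\<phi> \<in> test_functions Q \<Longrightarrow> (\<lambda>x. c * \<phi> x) \<in> test_functions Q"
  by (rule test_function_smooth_mult) (auto intro: smooth_onI Ck_on_const)

lemma test_function_has_derivative:
  "\<phi> \<in> test_functions Q \<Longrightarrow> (\<phi> has_derivative frechet_derivative \<phi> (at x)) (at x)"
  by (intro smooth_has_derivative test_functionsD)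

lemma test_function_derivative_outside:
  assumes "x \<notin> closure {x. \<phi> x \<noteq> 0}"
  shows "frechet_derivative \<phi> (at x) = (\<lambda>_. 0)"
proof -
  have "(\<phi> has_derivative (\<lambda>_. 0)) (at x)"
  proof (rule has_derivative_transform_within_open[of "\<lambda>_. 0"])
    show "open (- closure {x. \<phi> x \<noteq> 0})" by (rule open_Compl) (rule closed_closure)
    show "0 = \<phi> y" if "y \<in> - closure {x. \<phi> x \<noteq> 0}" for y
      using that closure_subset[of "{x. \<phi> x \<noteq> 0}"] by auto
  qed (use assms in auto)
  then show ?thesis by (rule frechet_derivative_at[symmetric])
qed

lemma test_function_derivative:
  assumes "\<phi> \<in> test_functions Q" "b \<in> Basis"
  shows "(\<lambda>x. frechet_derivative \<phi> (at x) b) \<in> test_functions Q"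
  by (rule test_functionsI[OF smooth_frechet[OF test_functionsD(1)[OF assms(1)] assms(2)]
        test_functionsD(2,3)[OF assms(1)]])
     (simp add: test_function_derivative_outside)

lemma frechet_derivative_mult_apply:
  fixes f g :: "'a::euclidean_space \<Rightarrow> complex"
  assumes "smooth_on f UNIV" "smooth_on g UNIV"
  shows "frechet_derivative (\<lambda>x. f x * g x) (at x) b
       = f x * frechet_derivative g (at x) b + frechet_derivative f (at x) b * g x"
  using frechet_derivative_at[OF has_derivative_mult[OF smooth_has_derivative[OF assms(1)]
        smooth_has_derivative[OF assms(2)]], of x, symmetric] by simp

lemma compact_support_integrable:
  fixes f :: "'a::euclidean_space \<Rightarrow> 'b::{banach, second_countable_topology}"
  assumes "continuous_on UNIV f" "compact K" "\<And>x. x \<notin> K \<Longrightarrow> f x = 0"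
  shows "integrable lborel f"
proof -
  have "integrable lborel (\<lambda>x. indicator K x *\<^sub>R f x)"
    using assms by (intro borel_integrable_compact continuous_on_subset[OF assms(1)]) auto
  moreover have "(\<lambda>x. indicator K x *\<^sub>R f x) = f"
    using assms(3) by (auto simp: fun_eq_iff indicator_def)
  ultimately show ?thesis by simp
qed

lemma continuous_borel_measurable_lebesgue_on:
  fixes f :: "'a::euclidean_space \<Rightarrow> 'b::euclidean_space"
  assumes "continuous_on UNIV f" shows "f \<in> borel_measurable (lebesgue_on Q)"
  using borel_measurable_continuous_onI[OF assms] by (intro measurable_restrict_space1 measurable_completion) simp

lemma test_function_L2:
  assumes "\<phi> \<in> test_functions Q'" "Q \<in> sets lebesgue" shows "\<phi> \<in> L2 Q"
proof (rule L2_I)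
  note c = test_function_continuous[OF assms(1)]
  show "\<phi> \<in> borel_measurable (lebesgue_on Q)"
    by (rule continuous_borel_measurable_lebesgue_on[OF c])
  have c2: "continuous_on UNIV (\<lambda>x. (cmod (\<phi> x))\<^sup>2)" using c by (intro continuous_intros)
  have "integrable lborel (\<lambda>x. (cmod (\<phi> x))\<^sup>2)"
    by (rule compact_support_integrable[OF c2 test_functionsD(2)[OF assms(1)]])
       (use closure_subset[of "{x. \<phi> x \<noteq> 0}"] in auto)
  then have "integrable lebesgue (\<lambda>x. (cmod (\<phi> x))\<^sup>2)"
    by (subst integrable_completion) (use borel_measurable_continuous_onI[OF c2] in simp_all)
  then show "integrable (lebesgue_on Q) (\<lambda>x. (cmod (\<phi> x))\<^sup>2)"
    using integrable_mult_indicator[OF assms(2), of "\<lambda>x. (cmod (\<phi> x))\<^sup>2"] assms(2)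
    by (simp add: integrable_restrict_space)
qed

lemma lebesgue_on_integral_eq_lborel:
  fixes f :: "'a::euclidean_space \<Rightarrow> 'b::euclidean_space"
  assumes "continuous_on UNIV f" "Q \<in> sets lebesgue" "\<And>x. x \<notin> Q \<Longrightarrow> f x = 0"
  shows "integral\<^sup>L (lebesgue_on Q) f = integral\<^sup>L lborel f"
proof -
  have "integral\<^sup>L (lebesgue_on Q) f = integral\<^sup>L lebesgue (\<lambda>x. indicator Q x *\<^sub>R f x)"
    using assms(2) by (subst integral_restrict_space) auto
  also have "(\<lambda>x. indicator Q x *\<^sub>R f x) = f" using assms(3) by (auto simp: fun_eq_iff indicator_def)
  also have "integral\<^sup>L lebesgue f = integral\<^sup>L lborel f"
    using borel_measurable_continuous_onI[OF assms(1)] by (intro integral_completion) simp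
  finally show ?thesis .
qed

subsection \<open>Integration by parts\<close>

text \<open>By translation invariance the integrals of all difference quotients of \<open>f\<close> vanish.\<close>

lemma integral_test_derivative:
  fixes f :: "'a::euclidean_space \<Rightarrow> complex"
  assumes f: "f \<in> test_functions Q" and b: "b \<in> Basis"
  shows "integral\<^sup>L lborel (\<lambda>x. frechet_derivative f (at x) b) = 0"
proof -
  define K where "K = closure {x. f x \<noteq> 0}"
  define f' where "f' x = frechet_derivative f (at x) b" for x
  have f'T: "f' \<in> test_functions Q" unfolding f'_def by (rule test_function_derivative[OF f b])
  have cf: "continuous_on UNIV f" and cf': "continuous_on UNIV f'"
    using f f'T by (auto intro: test_function_continuous)
  have K: "compact K" using test_functionsD(2)[OF f] by (simp add: K_def)
  have out: "f x = 0" if "x \<notin> K" for x using that closure_subset[of "{x. f x \<noteq> 0}"] by (auto simp: K_def)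
  have out': "f' x = 0" if "x \<notin> K" for x
    using that test_function_derivative_outside[of x f] by (simp add: K_def f'_def)
  have "bounded (f' ` K)"
    by (intro compact_imp_bounded compact_continuous_image continuous_on_subset[OF cf'] K) simp
  then obtain B where B: "0 < B" "\<And>x. x \<in> K \<Longrightarrow> cmod (f' x) \<le> B" unfolding bounded_pos by auto
  then have B': "cmod (f' x) \<le> B" for x by (cases "x \<in> K") (auto simp: out')
  obtain r where r: "\<And>x. x \<in> K \<Longrightarrow> norm x \<le> r" using compact_imp_bounded[OF K] unfolding bounded_iff by auto
  have line: "((\<lambda>t. f (x + t *\<^sub>R b)) has_derivative (\<lambda>s. s *\<^sub>R f' (x + t *\<^sub>R b))) (at t)" for x t
  proof -
    note D = test_function_has_derivative[OF f, of "x + t *\<^sub>R b"]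
    have "((\<lambda>t. f (x + t *\<^sub>R b)) has_derivative
        (\<lambda>s. frechet_derivative f (at (x + t *\<^sub>R b)) (s *\<^sub>R b))) (at t)"
      by (rule has_derivative_compose[of "\<lambda>t. x + t *\<^sub>R b" "\<lambda>s. s *\<^sub>R b", OF _ D])
         (auto intro!: derivative_eq_intros)
    then show ?thesis
      using linear_scale[OF has_derivative_linear[OF D]] by (simp add: f'_def)
  qed
  define g where "g n x = (f (x + (1 / Suc n) *\<^sub>R b) - f x) * of_nat (Suc n)" for n :: nat and x
  have shift_cont: "continuous_on UNIV (\<lambda>x. f (x + c))" for c
    by (intro continuous_on_compose2[OF cf] continuous_intros) auto
  have int_f: "integrable lborel f" by (rule compact_support_integrable[OF cf K out])
  have int_shift: "integrable lborel (\<lambda>x. f (x + c))" and eq_shift: "integral\<^sup>L lborel (\<lambda>x. f (x + c)) = integral\<^sup>L lborel f" for c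
  proof -
    have m: "f \<in> borel_measurable borel" using cf by (rule borel_measurable_continuous_onI)
    have d: "distr lborel borel ((+) c) = lborel" by (rule lborel_distr_plus)
    have "integral\<^sup>L (distr lborel borel ((+) c)) f = integral\<^sup>L lborel (\<lambda>x. f (c + x))"
      by (rule integral_distr) (use m in auto)
    then show "integral\<^sup>L lborel (\<lambda>x. f (x + c)) = integral\<^sup>L lborel f"
      unfolding d by (simp add: add.commute)
    have "integrable (distr lborel borel ((+) c)) f \<longleftrightarrow> integrable lborel (\<lambda>x. f (c + x))"
      by (rule integrable_distr_eq) (use m in auto)
    then show "integrable lborel (\<lambda>x. f (x + c))"
      unfolding d using int_f by (simp add: add.commute)
  qed
  have "integral\<^sup>L lborel (g n) = 0" for n
    unfolding g_def by (simp add: int_shift int_f eq_shift)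
  moreover have "(\<lambda>n. integral\<^sup>L lborel (g n)) \<longlonglongrightarrow> integral\<^sup>L lborel f'"
  \<comment> \<open>The shifts have length at most 1, so all difference quotients vanish outside the
    ball of radius \<open>r + 1\<close>; inside it the mean value inequality bounds them by
    \<open>B\<close>.\<close>
  proof (rule integral_dominated_convergence[where w="\<lambda>x. B * indicator (cball 0 (r + 1)) x"])
    show "f' \<in> borel_measurable lborel" using borel_measurable_continuous_onI[OF cf'] by simp
    show "g n \<in> borel_measurable lborel" for n
    proof -
      have "continuous_on UNIV (g n)" unfolding g_def by (intro continuous_intros shift_cont cf)
      then show ?thesis using borel_measurable_continuous_onI by simp
    qed
    show "integrable lborel (\<lambda>x. B * indicat_real (cball (0::'a) (r + 1)) x)"
      using emeasure_lborel_cball_finite[of "0::'a" "r + 1"] by (intro integrable_mult_right integrable_real_indicator) auto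
    show "AE x in lborel. (\<lambda>n. g n x) \<longlonglongrightarrow> f' x"
    proof (rule AE_I2)
      fix x
      have "((\<lambda>t. norm (f (x + t *\<^sub>R b) - f (x + 0 *\<^sub>R b) - (t - 0) *\<^sub>R f' (x + 0 *\<^sub>R b)) / norm (t - 0)) \<longlongrightarrow> 0) (at 0)"
        using line[of x 0] unfolding has_derivative_iff_norm by blast
      moreover have "filterlim (\<lambda>n. 1 / real (Suc n)) (at 0) sequentially"
        unfolding filterlim_at using LIMSEQ_Suc[OF lim_inverse_n'] by auto
      ultimately have "(\<lambda>n. norm (f (x + (1 / Suc n) *\<^sub>R b) - f x - (1 / Suc n) *\<^sub>R f' x) / (1 / Suc n)) \<longlonglongrightarrow> 0"
        using filterlim_compose by fastforce
      moreover have "norm (f (x + (1 / Suc n) *\<^sub>R b) - f x - (1 / Suc n) *\<^sub>R f' x) / (1 / Suc n) = norm (g n x - f' x)" for n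
      proof -
        have "g n x - f' x = (f (x + (1 / Suc n) *\<^sub>R b) - f x - (1 / Suc n) *\<^sub>R f' x) * of_nat (Suc n)"
          by (simp add: g_def algebra_simps scaleR_conv_of_real del: of_nat_Suc)
        then show ?thesis by (simp only: norm_mult norm_of_nat) simp
      qed
      ultimately have "(\<lambda>n. norm (g n x - f' x)) \<longlonglongrightarrow> 0" by (simp only:)
      then show "(\<lambda>n. g n x) \<longlonglongrightarrow> f' x" by (simp add: tendsto_norm_zero_iff LIM_zero_iff)
    qed
    show "AE x in lborel. norm (g n x) \<le> B * indicat_real (cball 0 (r + 1)) x" for n
    proof (rule AE_I2)
      fix x
      show "norm (g n x) \<le> B * indicat_real (cball 0 (r + 1)) x"
      proof (cases "x \<in> cball 0 (r + 1)")
        case True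
        have "norm (f (x + (1 / Suc n) *\<^sub>R b) - f (x + 0 *\<^sub>R b)) \<le> B * norm (1 / Suc n - 0 :: real)"
        proof (rule differentiable_bound[OF convex_UNIV])
          show "((\<lambda>t. f (x + t *\<^sub>R b)) has_derivative (\<lambda>s. s *\<^sub>R f' (x + t *\<^sub>R b))) (at t)" for t
            by (rule line)
          show "onorm (\<lambda>s. s *\<^sub>R f' (x + t *\<^sub>R b)) \<le> B" for t
            by (rule onorm_le) (use mult_left_mono[OF B'[of "x + t *\<^sub>R b"] abs_ge_zero] in \<open>simp add: mult.commute\<close>)
        qed auto
        then have "cmod (f (x + (1 / Suc n) *\<^sub>R b) - f x) * Suc n \<le> B"
          by (simp add: field_simps del: of_nat_Suc)
        moreover have "norm (g n x) = cmod (f (x + (1 / Suc n) *\<^sub>R b) - f x) * Suc n"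
          by (simp only: g_def norm_mult norm_of_nat)
        ultimately show ?thesis using True by simp
      next
        case False
        then have nx: "r + 1 < norm x" by simp
        have "norm x \<le> norm (x + (1 / Suc n) *\<^sub>R b) + norm ((1 / Suc n) *\<^sub>R b)"
          by (metis add_diff_cancel_right' norm_triangle_ineq4)
        moreover have "norm ((1 / Suc n) *\<^sub>R b) \<le> 1" using b by simp
        ultimately have "r < norm (x + (1 / Suc n) *\<^sub>R b)" using nx by linarith
        then have "x + (1 / Suc n) *\<^sub>R b \<notin> K" using r by (meson not_less)
        moreover have "x \<notin> K"
        proof
          assume "x \<in> K"
          then show False using r[of x] nx by simp
        qed
        ultimately show ?thesis using False by (simp add: g_def out)
      qed
    qed
  qed
  ultimately have "(\<lambda>n. 0) \<longlonglongrightarrow> integral\<^sup>L lborel f'" by simp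
  then have "integral\<^sup>L lborel f' = 0" by (simp add: LIMSEQ_const_iff)
  then show ?thesis unfolding f'_def .
qed

text \<open>The product of \<open>f\<close> with a test function is again a test function, and the
  integral of its derivative vanishes.\<close>

lemma smooth_has_weak_partial:
  fixes f :: "'a::euclidean_space \<Rightarrow> complex"
  assumes f: "smooth_on f UNIV" and Q: "Q \<in> sets lebesgue" and b: "b \<in> Basis"
  shows "has_weak_partial Q b f (\<lambda>x. frechet_derivative f (at x) b)"
  unfolding has_weak_partial_def
proof
  fix \<phi> assume \<phi>: "\<phi> \<in> test_functions Q"
  have f': "smooth_on (\<lambda>x. frechet_derivative f (at x) b) UNIV" by (rule smooth_frechet[OF f b])
  have T1: "(\<lambda>x. f x * frechet_derivative \<phi> (at x) b) \<in> test_functions Q"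
    by (rule test_function_smooth_mult[OF f test_function_derivative[OF \<phi> b]])
  have T2: "(\<lambda>x. frechet_derivative f (at x) b * \<phi> x) \<in> test_functions Q"
    by (rule test_function_smooth_mult[OF f' \<phi>])
  have int: "integrable lborel h" if "h \<in> test_functions Q" for h :: "'a \<Rightarrow> complex"
    by (rule compact_support_integrable[OF test_function_continuous[OF that] test_functionsD(2)[OF that]])
       (use closure_subset[of "{x. h x \<noteq> 0}"] in auto)
  have to_lborel: "integral\<^sup>L (lebesgue_on Q) h = integral\<^sup>L lborel h" if "h \<in> test_functions Q" for h :: "'a \<Rightarrow> complex"
    by (rule lebesgue_on_integral_eq_lborel[OF test_function_continuous[OF that] Q test_function_outside[OF that]])
  have "0 = integral\<^sup>L lborel (\<lambda>x. frechet_derivative (\<lambda>x. f x * \<phi> x) (at x) b)"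
    by (rule integral_test_derivative[OF test_function_smooth_mult[OF f \<phi>] b, symmetric])
  also have "\<dots> = integral\<^sup>L lborel (\<lambda>x. f x * frechet_derivative \<phi> (at x) b)
      + integral\<^sup>L lborel (\<lambda>x. frechet_derivative f (at x) b * \<phi> x)"
    unfolding frechet_derivative_mult_apply[OF f test_functionsD(1)[OF \<phi>]]
    by (rule Bochner_Integration.integral_add[OF int[OF T1] int[OF T2]])
  finally show "(LINT x|lebesgue_on Q. f x * frechet_derivative \<phi> (at x) b) =
      - (LINT x|lebesgue_on Q. frechet_derivative f (at x) b * \<phi> x)"
    using to_lborel[OF T1] to_lborel[OF T2] by (simp add: eq_neg_iff_add_eq_0)
qed

subsection \<open>The fundamental lemma of the calculus of variations\<close>

text \<open>These test functions steepen with \<open>n\<close> and converge boundedly to the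
  indicator of the open box, so that testing against them computes integrals over boxes.\<close>

definition box_bump :: "'a::euclidean_space \<Rightarrow> 'a \<Rightarrow> nat \<Rightarrow> 'a \<Rightarrow> complex" where
  "box_bump a b n x = of_real (\<Prod>i\<in>Basis. step (Suc n * (x \<bullet> i - a \<bullet> i)) * step (Suc n * (b \<bullet> i - x \<bullet> i)))"

lemma box_bump_eq_0: "x \<notin> box a b \<Longrightarrow> box_bump a b n x = 0"
proof -
  assume "x \<notin> box a b"
  then obtain i where i: "i \<in> Basis" "x \<bullet> i \<le> a \<bullet> i \<or> b \<bullet> i \<le> x \<bullet> i"
    by (auto simp: mem_box not_less)
  then have "step (Suc n * (x \<bullet> i - a \<bullet> i)) = 0 \<or> step (Suc n * (b \<bullet> i - x \<bullet> i)) = 0"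
    by (auto simp: step_aux_def zero_less_mult_iff simp del: of_nat_Suc)
  then have "(\<Prod>i\<in>Basis. step (Suc n * (x \<bullet> i - a \<bullet> i)) * step (Suc n * (b \<bullet> i - x \<bullet> i))) = 0"
    using i(1) by (intro prod_zero) auto
  then show ?thesis unfolding box_bump_def by simp
qed

lemma box_bump_test_function:
  assumes "cbox a b \<subseteq> Q" shows "box_bump a b n \<in> test_functions Q"
proof (rule test_functionsI[OF _ compact_cbox assms])
  have "Ck_on k (\<lambda>x. step (Suc n * (x \<bullet> i - a \<bullet> i))) UNIV" for k i
    by (rule Ck_on_compose[of UNIV UNIV _ k step])
       (auto intro!: Ck_on_step_aux Ck_on_mult Ck_on_diff Ck_on_const Ck_on_inner)
  moreover have "Ck_on k (\<lambda>x. step (Suc n * (b \<bullet> i - x \<bullet> i))) UNIV" for k i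
    by (rule Ck_on_compose[of UNIV UNIV _ k step])
       (auto intro!: Ck_on_step_aux Ck_on_mult Ck_on_diff Ck_on_const Ck_on_inner)
  ultimately have "Ck_on k (\<lambda>x. \<Prod>i\<in>Basis. step (Suc n * (x \<bullet> i - a \<bullet> i)) * step (Suc n * (b \<bullet> i - x \<bullet> i))) UNIV" for k
    by (intro Ck_on_prod Ck_on_mult) auto
  then show "smooth_on (box_bump a b n) UNIV"
    unfolding box_bump_def by (intro smooth_onI Ck_on_linear[OF bounded_linear_of_real]) auto
  show "box_bump a b n x = 0" if "x \<notin> cbox a b" for x
    using that box_subset_cbox by (intro box_bump_eq_0) blast
qed

lemma step_LIMSEQ: "0 < t \<Longrightarrow> (\<lambda>n. step (Suc n * t)) \<longlonglongrightarrow> 1" for t :: real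
proof -
  assume t: "0 < t"
  have "(\<lambda>n. exp (- ((1 / t) * (1 / real (Suc n))))) \<longlonglongrightarrow> exp (- ((1 / t) * 0))"
    using LIMSEQ_Suc[OF lim_inverse_n'] by (intro tendsto_intros)
  then show ?thesis using t by (simp add: step_aux_def zero_less_mult_iff mult.commute del: of_nat_Suc)
qed

lemma box_bump_LIMSEQ: "(\<lambda>n. box_bump a b n x) \<longlonglongrightarrow> indicator (box a b) x"
proof (cases "x \<in> box a b")
  case True
  have "(\<lambda>n. \<Prod>i\<in>Basis. step (Suc n * (x \<bullet> i - a \<bullet> i)) * step (Suc n * (b \<bullet> i - x \<bullet> i)))
      \<longlonglongrightarrow> (\<Prod>i\<in>(Basis::'a set). 1 * 1)"
    using True by (intro tendsto_prod tendsto_mult step_LIMSEQ) (auto simp: mem_box)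
  then have "(\<lambda>n. box_bump a b n x) \<longlonglongrightarrow> of_real (\<Prod>i\<in>(Basis::'a set). 1 * 1)"
    unfolding box_bump_def by (rule tendsto_of_real)
  then show ?thesis using True by simp
next
  case False
  then show ?thesis by (simp add: box_bump_eq_0)
qed

lemma box_bump_bound: "cmod (box_bump a b n x) \<le> indicator (box a b) x"
proof (cases "x \<in> box a b")
  case True
  have "(\<Prod>i\<in>Basis. step (Suc n * (x \<bullet> i - a \<bullet> i)) * step (Suc n * (b \<bullet> i - x \<bullet> i))) \<le> 1"
    by (intro prod_le_1 conjI mult_nonneg_nonneg mult_le_one step_bounds)
  moreover have "0 \<le> (\<Prod>i\<in>Basis. step (Suc n * (x \<bullet> i - a \<bullet> i)) * step (Suc n * (b \<bullet> i - x \<bullet> i)))"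
    by (intro prod_nonneg mult_nonneg_nonneg step_bounds)
  ultimately show ?thesis using True unfolding box_bump_def norm_of_real by simp
next
  case False
  then show ?thesis by (simp add: box_bump_eq_0)
qed

text \<open>Openness up to a null set suffices for the uniqueness of weak derivatives. The perturbed
  domain has it because it adds only a null set to the open \<open>periodic_union\<close>.\<close>

locale ae_open =
  fixes Q :: "'a::euclidean_space set"
  assumes negligible_boundary: "negligible (Q - interior Q)"
begin

lemma measurable_Q [measurable]: "Q \<in> sets lebesgue"
proof -
  have "Q = interior Q \<union> (Q - interior Q)" using interior_subset by blast
  then show ?thesis
    using negligible_imp_sets[OF negligible_boundary] borel_open[OF open_interior, of Q]
    by (metis sets.Un sets_completionI_sets sets_lborel)
qed

lemma AE_lebesgue_on_iff: "(AE x in lebesgue_on Q. R x) \<longleftrightarrow> (AE x in lebesgue. x \<in> Q \<longrightarrow> R x)"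
  by (rule AE_restrict_space_iff) simp

lemma integral_over_boxes_eq_0:
  assumes g: "g \<in> L2 Q" and zero: "\<And>\<phi>. \<phi> \<in> test_functions Q \<Longrightarrow> (LINT x|lebesgue_on Q. g x * \<phi> x) = 0"
    and ab: "cbox a b \<subseteq> Q"
  shows "integrable lebesgue (\<lambda>x. indicator (box a b) x *\<^sub>R g x)"
    "integral\<^sup>L lebesgue (\<lambda>x. indicator (box a b) x *\<^sub>R g x) = 0"
proof -
  have bQ: "box a b \<subseteq> Q" using ab box_subset_cbox by blast
  have bm: "box a b \<in> sets lebesgue" by (simp add: sets_completionI_sets)
  have ind: "(\<lambda>x. indicator (box a b) x :: complex) \<in> L2 Q"
  proof (rule L2_I)
    show "(\<lambda>x. indicator (box a b) x :: complex) \<in> borel_measurable (lebesgue_on Q)"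
      by (intro measurable_restrict_space1 borel_measurable_indicator bm)
    have "integrable lebesgue (indicat_real (box a b))"
      using emeasure_lborel_box_finite[of a b] bm by (intro integrable_real_indicator) auto
    then have "integrable (lebesgue_on Q) (indicat_real (box a b))"
      using integrable_mult_indicator[OF measurable_Q, of "indicat_real (box a b)"]
      by (simp add: integrable_restrict_space)
    moreover have "(\<lambda>x. (cmod (indicator (box a b) x))\<^sup>2) = indicat_real (box a b)"
      by (auto simp: fun_eq_iff indicator_def)
    ultimately show "integrable (lebesgue_on Q) (\<lambda>x. (cmod (indicator (box a b) x))\<^sup>2)" by simp
  qed
  note int = L2_prod_integrable(1)[OF g ind]
  have eq: "(\<lambda>x. indicator Q x *\<^sub>R (g x * indicator (box a b) x)) = (\<lambda>x. indicator (box a b) x *\<^sub>R g x)"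
    using bQ by (auto simp: fun_eq_iff indicator_def)
  show "integrable lebesgue (\<lambda>x. indicator (box a b) x *\<^sub>R g x)"
    using int by (subst (asm) integrable_restrict_space) (simp_all add: eq)
  have "(\<lambda>n. LINT x|lebesgue_on Q. g x * box_bump a b n x) \<longlonglongrightarrow> (LINT x|lebesgue_on Q. g x * indicator (box a b) x)"
  proof (rule integral_dominated_convergence)
    show "integrable (lebesgue_on Q) (\<lambda>x. cmod (g x * indicator (box a b) x))"
      using int by (rule integrable_norm)
    show "(\<lambda>x. g x * indicator (box a b) x) \<in> borel_measurable (lebesgue_on Q)"
      using int by (rule borel_measurable_integrable)
    show "(\<lambda>x. g x * box_bump a b n x) \<in> borel_measurable (lebesgue_on Q)" for n
      using L2_D(1)[OF g] L2_D(1)[OF test_function_L2[OF box_bump_test_function[OF ab] measurable_Q], of n] by measurable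
    show "AE x in lebesgue_on Q. (\<lambda>n. g x * box_bump a b n x) \<longlonglongrightarrow> g x * indicator (box a b) x"
      by (intro AE_I2 tendsto_mult tendsto_const box_bump_LIMSEQ)
    show "AE x in lebesgue_on Q. norm (g x * box_bump a b n x) \<le> cmod (g x * indicator (box a b) x)" for n
    proof (rule AE_I2)
      fix x
      have "cmod (box_bump a b n x) \<le> cmod (indicator (box a b) x)"
        using box_bump_bound[of a b n x] by (cases "x \<in> box a b") simp_all
      then show "norm (g x * box_bump a b n x) \<le> cmod (g x * indicator (box a b) x)"
        unfolding norm_mult by (rule mult_left_mono) simp
    qed
  qed
  moreover have "(LINT x|lebesgue_on Q. g x * box_bump a b n x) = 0" for n
    by (rule zero[OF box_bump_test_function[OF ab]])
  ultimately have "(LINT x|lebesgue_on Q. g x * indicator (box a b) x) = 0" by (simp add: LIMSEQ_const_iff)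
  then show "integral\<^sup>L lebesgue (\<lambda>x. indicator (box a b) x *\<^sub>R g x) = 0"
    by (subst (asm) integral_restrict_space) (simp_all add: eq)
qed

end

text \<open>Boxes form an intersection-stable generator of the Borel sets, so the integral vanishes
  over every Borel set; the hypothesis on the whole space serves the complements. A Lebesgue set
  differs from a Borel set by a null set.\<close>

lemma AE_eq_0_if_box_integrals_0:
  fixes f :: "'a::euclidean_space \<Rightarrow> complex"
  assumes int: "integrable lebesgue f" and UN: "integral\<^sup>L lebesgue f = 0"
    and box: "\<And>a b. integral\<^sup>L lebesgue (\<lambda>x. indicator (box a b) x *\<^sub>R f x) = 0"
  shows "AE x in lebesgue. f x = 0"
proof -
  have si: "set_integrable lebesgue A f" if "A \<in> sets lebesgue" for A
    unfolding set_integrable_def using that int by (rule integrable_mult_indicator)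
  have borel0: "set_lebesgue_integral lebesgue A f = 0" if "A \<in> sets borel" for A
  proof -
    let ?G = "range (\<lambda>(a, b). box a b :: 'a set)"
    have s: "sets borel = sigma_sets UNIV ?G" by (subst borel_eq_box) (simp add: sets_measure_of)
    have "Int_stable ?G" by (auto simp: Int_stable_def box_Int_box)
    moreover have "?G \<subseteq> Pow UNIV" by simp
    moreover have "A \<in> sigma_sets UNIV ?G" using that s by simp
    ultimately show ?thesis
    proof (induction rule: sigma_sets_induct_disjoint)
      case (basic A)
      then show ?case using box by (auto simp: set_lebesgue_integral_def)
    next
      case empty
      then show ?case by (simp add: set_lebesgue_integral_def)
    next
      case (compl A)
      have A: "A \<in> sets lebesgue" using compl(1) unfolding s[symmetric] by (simp add: sets_completionI_sets)
      have "(\<lambda>x. indicator (UNIV - A) x *\<^sub>R f x) = (\<lambda>x. f x - indicator A x *\<^sub>R f x)"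
        by (auto simp: fun_eq_iff indicator_def)
      then show ?case
        using compl(2) UN int integrable_mult_indicator[OF A int] by (simp add: set_lebesgue_integral_def)
    next
      case (union A)
      have A: "A i \<in> sets lebesgue" for i
        using union(2) unfolding s[symmetric] by (auto intro: sets_completionI_sets)
      have "set_lebesgue_integral lebesgue (\<Union>i. A i) f = (\<Sum>i. set_lebesgue_integral lebesgue (A i) f)"
        using A union(1) by (intro lebesgue_integral_countable_add si sets.countable_UN) (auto simp: disjoint_family_on_def)
      then show ?case using union(3) by simp
    qed
  qed
  interpret sigma_finite_measure "lebesgue :: 'a measure"
  proof
    have e1: "emeasure lebesgue (cball (0::'a) r) \<noteq> \<infinity>" for r
      using emeasure_lborel_cball_finite[of "0::'a" r] by auto
    have e2: "(\<Union>n. cball (0::'a) (real n)) = UNIV"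
      using real_arch_simple by auto
    show "\<exists>A :: 'a set set. countable A \<and> A \<subseteq> sets lebesgue \<and> \<Union> A = space lebesgue \<and>
        (\<forall>a\<in>A. emeasure lebesgue a \<noteq> \<infinity>)"
      by (rule exI[of _ "range (\<lambda>n::nat. cball (0::'a) (real n))"])
         (use e1 e2 in \<open>auto intro: sets_completionI_sets\<close>)
  qed
  show ?thesis
  proof (rule density_zero[OF int])
    fix A :: "'a set" assume "A \<in> sets lebesgue"
    then obtain S N N' where SN: "A = S \<union> N" "N \<subseteq> N'" "N' \<in> null_sets lborel" "S \<in> sets lborel"
      by (rule sets_completionE)
    have "set_lebesgue_integral lebesgue A f = set_lebesgue_integral lebesgue S f"
      unfolding set_lebesgue_integral_def
    proof (rule integral_cong_AE)
      have "AE x in lebesgue. x \<notin> N'"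
        by (rule AE_not_in) (use SN(3) in \<open>auto intro: null_sets_completionI\<close>)
      then show "AE x in lebesgue. indicat_real A x *\<^sub>R f x = indicat_real S x *\<^sub>R f x"
        by eventually_elim (use SN in \<open>auto simp: indicator_def\<close>)
      show "(\<lambda>x. indicat_real A x *\<^sub>R f x) \<in> borel_measurable lebesgue"
        using \<open>A \<in> sets lebesgue\<close> int by (intro borel_measurable_integrable integrable_mult_indicator)
      show "(\<lambda>x. indicat_real S x *\<^sub>R f x) \<in> borel_measurable lebesgue"
        using SN(4) int by (intro borel_measurable_integrable integrable_mult_indicator) (auto intro: sets_completionI_sets)
    qed
    also have "\<dots> = 0" using borel0 SN(4) by simp
    finally show "set_lebesgue_integral lebesgue A f = 0" .
  qed
qed

context ae_open
begin

lemma fundamental_lemma: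
  assumes g: "g \<in> L2 Q" and zero: "\<And>\<phi>. \<phi> \<in> test_functions Q \<Longrightarrow> (LINT x|lebesgue_on Q. g x * \<phi> x) = 0"
  shows "AE x in lebesgue_on Q. g x = 0"
proof -
  have in_box: "AE x in lebesgue. x \<in> cbox c e \<longrightarrow> g x = 0" if ce: "cbox c e \<subseteq> Q" for c e
  proof -
    let ?f = "\<lambda>x. indicator (box c e) x *\<^sub>R g x"
    have "AE x in lebesgue. ?f x = 0"
    proof (rule AE_eq_0_if_box_integrals_0)
      show "integrable lebesgue ?f" "integral\<^sup>L lebesgue ?f = 0"
        using integral_over_boxes_eq_0[OF g zero ce] by auto
      show "integral\<^sup>L lebesgue (\<lambda>x. indicator (box a b) x *\<^sub>R ?f x) = 0" for a b
      proof -
        obtain a' b' where ab': "box a b \<inter> box c e = box a' b'" "cbox a b \<inter> cbox c e = cbox a' b'"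
          by (rule that[OF box_Int_box Int_interval])
        have "(\<lambda>x. indicator (box a b) x *\<^sub>R ?f x) = (\<lambda>x. indicator (box a' b') x *\<^sub>R g x)"
          unfolding ab'(1)[symmetric] by (auto simp: fun_eq_iff indicator_def)
        moreover have "cbox a' b' \<subseteq> Q" using ab'(2) ce by blast
        ultimately show ?thesis using integral_over_boxes_eq_0(2)[OF g zero] by simp
      qed
    qed
    moreover have "AE x in lebesgue. x \<notin> cbox c e - box c e"
      by (rule AE_not_in) (use negligible_frontier_interval negligible_iff_null_sets in blast)
    ultimately show ?thesis by eventually_elim (auto simp: indicator_def split: if_splits)
  qed
  \<comment> \<open>Countably many boxes exhaust the interior, so the exceptional null sets add up
    to a null set; the rest of \<open>Q\<close> is null by assumption.\<close>
  obtain \<D> where D: "countable \<D>" "\<D> \<subseteq> Pow (interior Q)" "\<And>X. X \<in> \<D> \<Longrightarrow> \<exists>a b. X = cbox a b" "\<Union>\<D> = interior Q"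
    using open_countable_Union_open_cbox[OF open_interior[of Q]] by metis
  have "AE x in lebesgue. \<forall>X\<in>\<D>. x \<in> X \<longrightarrow> g x = 0"
    unfolding AE_ball_countable[OF D(1)]
  proof
    fix X assume X: "X \<in> \<D>"
    then obtain a b where ab: "X = cbox a b" using D(3) by blast
    moreover have "X \<subseteq> Q" using X D(2) interior_subset[of Q] by blast
    ultimately show "AE x in lebesgue. x \<in> X \<longrightarrow> g x = 0" using in_box by simp
  qed
  moreover have "AE x in lebesgue. x \<notin> Q - interior Q"
    by (rule AE_not_in) (use negligible_boundary negligible_iff_null_sets in blast)
  ultimately have "AE x in lebesgue. x \<in> Q \<longrightarrow> g x = 0"
    by eventually_elim (use D(4) in blast)
  then show ?thesis by (simp add: AE_lebesgue_on_iff)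
qed

end

section \<open>Sobolev spaces\<close>

definition w_inner :: "'a::euclidean_space set \<Rightarrow> ('a \<Rightarrow> complex) \<Rightarrow> ('a \<Rightarrow> complex) \<Rightarrow> complex" where
  "w_inner Q u v = l2_inner Q u v + (\<Sum>b\<in>Basis. l2_inner Q (weak_partial Q b u) (weak_partial Q b v))"

lemma L2_cnj: assumes "u \<in> L2 Q" shows "(\<lambda>x. cnj (u x)) \<in> L2 Q"
proof (rule L2_dominated[OF _ assms, of _ 1])
  show "(\<lambda>x. cnj (u x)) \<in> borel_measurable (lebesgue_on Q)"
    by (rule measurable_compose[OF L2_D(1)[OF assms] borel_measurable_continuous_onI[OF continuous_on_cnj[OF continuous_on_id]]])
qed simp

lemma integral_eq_l2_inner: "(LINT x|lebesgue_on Q. u x * v x) = l2_inner Q u (\<lambda>x. cnj (v x))"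
  by (simp add: l2_inner_def)

section \<open>Rules for weak derivatives\<close>

lemma has_weak_partial_add:
  assumes "Q \<in> sets lebesgue" "b \<in> Basis" "has_weak_partial Q b u g" "has_weak_partial Q b v h"
    "u \<in> L2 Q" "g \<in> L2 Q" "v \<in> L2 Q" "h \<in> L2 Q"
  shows "has_weak_partial Q b (u + v) (g + h)"
  unfolding has_weak_partial_def
proof
  fix \<phi> assume \<phi>: "\<phi> \<in> test_functions Q"
  note t = test_function_L2[OF \<phi> assms(1)] test_function_L2[OF test_function_derivative[OF \<phi> assms(2)] assms(1)]
  have "(LINT x|lebesgue_on Q. u x * frechet_derivative \<phi> (at x) b) = - (LINT x|lebesgue_on Q. g x * \<phi> x)"
    "(LINT x|lebesgue_on Q. v x * frechet_derivative \<phi> (at x) b) = - (LINT x|lebesgue_on Q. h x * \<phi> x)"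
    using assms(3,4) \<phi> by (auto simp: has_weak_partial_def)
  then show "(LINT x|lebesgue_on Q. (u + v) x * frechet_derivative \<phi> (at x) b) = - (LINT x|lebesgue_on Q. (g + h) x * \<phi> x)"
    by (simp add: distrib_right L2_prod_integrable(1)[OF _ t(1)] L2_prod_integrable(1)[OF _ t(2)] assms(5-8))
qed

lemma has_weak_partial_scale:
  assumes "has_weak_partial Q b u g"
  shows "has_weak_partial Q b (cscale c u) (cscale c g)"
  using assms by (simp add: has_weak_partial_def mult.assoc)

text \<open>Test \<open>u\<close> with \<open>f * \<phi>\<close> and expand the derivative of this
  product.\<close>

lemma has_weak_partial_mult:
  fixes f :: "'a::euclidean_space \<Rightarrow> complex"
  assumes Q: "Q \<in> sets lebesgue" and b: "b \<in> Basis" and f: "smooth_on f UNIV"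
    and w: "has_weak_partial Q b u g" and L: "u \<in> L2 Q" "g \<in> L2 Q"
  shows "has_weak_partial Q b (\<lambda>x. f x * u x) (\<lambda>x. f x * g x + frechet_derivative f (at x) b * u x)"
  unfolding has_weak_partial_def
proof
  fix \<phi> assume \<phi>: "\<phi> \<in> test_functions Q"
  have f': "smooth_on (\<lambda>x. frechet_derivative f (at x) b) UNIV" by (rule smooth_frechet[OF f b])
  have T: "(\<lambda>x. f x * \<phi> x) \<in> test_functions Q" by (rule test_function_smooth_mult[OF f \<phi>])
  have T1: "(\<lambda>x. f x * frechet_derivative \<phi> (at x) b) \<in> test_functions Q"
    by (rule test_function_smooth_mult[OF f test_function_derivative[OF \<phi> b]])
  have T2: "(\<lambda>x. frechet_derivative f (at x) b * \<phi> x) \<in> test_functions Q"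
    by (rule test_function_smooth_mult[OF f' \<phi>])
  note t = L2_prod_integrable(1)[OF L(2) test_function_L2[OF T Q]]
    L2_prod_integrable(1)[OF L(1) test_function_L2[OF T1 Q]] L2_prod_integrable(1)[OF L(1) test_function_L2[OF T2 Q]]
  have "(LINT x|lebesgue_on Q. u x * frechet_derivative (\<lambda>x. f x * \<phi> x) (at x) b) = - (LINT x|lebesgue_on Q. g x * (f x * \<phi> x))"
    using w T by (simp add: has_weak_partial_def)
  then have "(LINT x|lebesgue_on Q. u x * (f x * frechet_derivative \<phi> (at x) b))
      + (LINT x|lebesgue_on Q. u x * (frechet_derivative f (at x) b * \<phi> x)) = - (LINT x|lebesgue_on Q. g x * (f x * \<phi> x))"
    unfolding frechet_derivative_mult_apply[OF f test_functionsD(1)[OF \<phi>]] using t by (simp add: distrib_left)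
  then have "(LINT x|lebesgue_on Q. u x * (f x * frechet_derivative \<phi> (at x) b))
      = - ((LINT x|lebesgue_on Q. g x * (f x * \<phi> x)) + (LINT x|lebesgue_on Q. u x * (frechet_derivative f (at x) b * \<phi> x)))"
    by (simp add: algebra_simps eq_neg_iff_add_eq_0)
  also have "(LINT x|lebesgue_on Q. g x * (f x * \<phi> x)) + (LINT x|lebesgue_on Q. u x * (frechet_derivative f (at x) b * \<phi> x))
      = (LINT x|lebesgue_on Q. g x * (f x * \<phi> x) + u x * (frechet_derivative f (at x) b * \<phi> x))"
    using t by simp
  finally show "(LINT x|lebesgue_on Q. f x * u x * frechet_derivative \<phi> (at x) b) =
      - (LINT x|lebesgue_on Q. (f x * g x + frechet_derivative f (at x) b * u x) * \<phi> x)"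
    by (simp add: algebra_simps)
qed

text \<open>For a fixed test function both sides are L2 inner products with a fixed element, hence
  continuous.\<close>

lemma has_weak_partial_limit:
  assumes Q: "Q \<in> sets lebesgue" and b: "b \<in> Basis"
    and w: "\<And>n. has_weak_partial Q b (X n) (G n)" and L: "\<And>n. X n \<in> L2 Q" "\<And>n. G n \<in> L2 Q" "u \<in> L2 Q" "g \<in> L2 Q"
    and lim: "(\<lambda>n. l2_norm Q (X n - u)) \<longlonglongrightarrow> 0" "(\<lambda>n. l2_norm Q (G n - g)) \<longlonglongrightarrow> 0"
  shows "has_weak_partial Q b u g"
  unfolding has_weak_partial_def
proof
  fix \<phi> assume \<phi>: "\<phi> \<in> test_functions Q"
  let ?d = "\<lambda>x. cnj (frechet_derivative \<phi> (at x) b)" and ?c = "\<lambda>x. cnj (\<phi> x)"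
  have t: "?c \<in> L2 Q" "?d \<in> L2 Q"
    using test_function_L2[OF \<phi> Q] test_function_L2[OF test_function_derivative[OF \<phi> b] Q] by (auto intro: L2_cnj)
  have "(\<lambda>n. l2_inner Q (X n) ?d) \<longlonglongrightarrow> l2_inner Q u ?d"
    by (rule Lsp.LIMSEQ_ip_left) (use L lim t in auto)
  moreover have "(\<lambda>n. - l2_inner Q (G n) ?c) \<longlonglongrightarrow> - l2_inner Q g ?c"
    by (intro tendsto_minus Lsp.LIMSEQ_ip_left) (use L lim t in auto)
  moreover have "l2_inner Q (X n) ?d = - l2_inner Q (G n) ?c" for n
    using w[of n] \<phi> by (simp add: has_weak_partial_def integral_eq_l2_inner)
  ultimately show "(LINT x|lebesgue_on Q. u x * frechet_derivative \<phi> (at x) b) = - (LINT x|lebesgue_on Q. g x * \<phi> x)"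
    using LIMSEQ_unique by (simp add: integral_eq_l2_inner)
qed

context ae_open
begin

lemma weak_partial_unique:
  assumes "b \<in> Basis" "has_weak_partial Q b u g" "has_weak_partial Q b u h" "g \<in> L2 Q" "h \<in> L2 Q"
  shows "AE x in lebesgue_on Q. g x = h x"
proof -
  have "AE x in lebesgue_on Q. (g - h) x = 0"
  proof (rule fundamental_lemma)
    show "g - h \<in> L2 Q" using assms by simp
    fix \<phi> assume \<phi>: "\<phi> \<in> test_functions Q"
    have "(LINT x|lebesgue_on Q. g x * \<phi> x) = (LINT x|lebesgue_on Q. h x * \<phi> x)"
      using assms(2,3) \<phi> by (simp add: has_weak_partial_def)
    then show "(LINT x|lebesgue_on Q. (g - h) x * \<phi> x) = 0"
      by (simp add: left_diff_distrib L2_prod_integrable(1)[OF _ test_function_L2[OF \<phi> measurable_Q]] assms(4,5))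
  qed
  then show ?thesis by simp
qed

lemma weak_partial:
  assumes "g \<in> L2 Q" "has_weak_partial Q b u g"
  shows "weak_partial Q b u \<in> L2 Q" "has_weak_partial Q b u (weak_partial Q b u)"
  using someI[of "\<lambda>g. g \<in> L2 Q \<and> has_weak_partial Q b u g" g] assms by (auto simp: weak_partial_def)

lemma weak_partial_AE:
  assumes "b \<in> Basis" "g \<in> L2 Q" "has_weak_partial Q b u g"
  shows "AE x in lebesgue_on Q. weak_partial Q b u x = g x"
  using weak_partial_unique[OF assms(1) weak_partial(2)[OF assms(2,3)] assms(3) weak_partial(1)[OF assms(2,3)] assms(2)] .

text \<open>Ties the chosen derivative to any explicit one, in the form that
  \<open>ip_null_cong\<close> and \<open>nrm_null_cong\<close> consume.\<close>

lemma weak_partial_null: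
  assumes "b \<in> Basis" "g \<in> L2 Q" "has_weak_partial Q b u g"
  shows "l2_norm Q (weak_partial Q b u - g) = 0"
  using l2_norm_diff_eq_0_iff[OF weak_partial(1)[OF assms(2,3)] assms(2)] weak_partial_AE[OF assms] by simp

section \<open>W21 as a complete semi-inner product space\<close>

lemma W21_weak_partial:
  assumes "u \<in> W21 Q" "b \<in> Basis"
  shows "weak_partial Q b u \<in> L2 Q" "has_weak_partial Q b u (weak_partial Q b u)"
proof -
  obtain g where "g \<in> L2 Q" "has_weak_partial Q b u g" using assms by (auto simp: W21_def)
  then show "weak_partial Q b u \<in> L2 Q" "has_weak_partial Q b u (weak_partial Q b u)"
    by (rule weak_partial)+
qed

lemma W21_L2: "u \<in> W21 Q \<Longrightarrow> u \<in> L2 Q"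
  by (simp add: W21_def)

lemma W21_I: "u \<in> L2 Q \<Longrightarrow> (\<And>b. b \<in> Basis \<Longrightarrow> g b \<in> L2 Q \<and> has_weak_partial Q b u (g b)) \<Longrightarrow> u \<in> W21 Q"
  by (auto simp: W21_def)

lemma W21_add_weak_partial:
  assumes "u \<in> W21 Q" "v \<in> W21 Q" "b \<in> Basis"
  shows "weak_partial Q b u + weak_partial Q b v \<in> L2 Q"
    "has_weak_partial Q b (u + v) (weak_partial Q b u + weak_partial Q b v)"
  using assms W21_weak_partial W21_L2 by (auto intro!: has_weak_partial_add[OF measurable_Q])

lemma W21_scale_weak_partial:
  assumes "u \<in> W21 Q" "b \<in> Basis"
  shows "cscale c (weak_partial Q b u) \<in> L2 Q" "has_weak_partial Q b (cscale c u) (cscale c (weak_partial Q b u))"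
  using W21_weak_partial[OF assms] by (auto intro!: has_weak_partial_scale L2_scale)

lemma W21_add: assumes "u \<in> W21 Q" "v \<in> W21 Q" shows "u + v \<in> W21 Q"
  by (rule W21_I[where g="\<lambda>b. weak_partial Q b u + weak_partial Q b v"])
     (use W21_add_weak_partial[OF assms] W21_L2[OF assms(1)] W21_L2[OF assms(2)] in auto)

lemma W21_scale: assumes "u \<in> W21 Q" shows "cscale c u \<in> W21 Q"
  by (rule W21_I[where g="\<lambda>b. cscale c (weak_partial Q b u)"])
     (use W21_scale_weak_partial[OF assms] L2_scale[OF W21_L2[OF assms]] in auto)

lemma test_function_W21: assumes "\<phi> \<in> test_functions Q'" shows "\<phi> \<in> W21 Q"
proof (rule W21_I[where g="\<lambda>b x. frechet_derivative \<phi> (at x) b"])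
  show "\<phi> \<in> L2 Q" by (rule test_function_L2[OF assms measurable_Q])
  show "(\<lambda>x. frechet_derivative \<phi> (at x) b) \<in> L2 Q \<and> has_weak_partial Q b \<phi> (\<lambda>x. frechet_derivative \<phi> (at x) b)"
    if "b \<in> Basis" for b
    using that assms by (auto intro!: test_function_L2[OF test_function_derivative] smooth_has_weak_partial test_functionsD)
qed

text \<open>As a choice, \<open>weak_partial\<close> need not be additive in \<open>u\<close>; the
  inner products are additive nevertheless, because they do not see vectors of norm zero.\<close>

lemma W21_semi_inner: "semi_inner cscale (W21 Q) (w_inner Q)"
proof
  show "csp.subspace (W21 Q)"
    unfolding csp.subspace_def
    using W21_add W21_scale test_function_W21[OF test_function_zero] by (auto simp: zero_fun_def)
  show "w_inner Q (x + y) z = w_inner Q x z + w_inner Q y z" if W: "x \<in> W21 Q" "y \<in> W21 Q" "z \<in> W21 Q" for x y z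
  proof -
    have "l2_inner Q (weak_partial Q b (x + y)) (weak_partial Q b z)
        = l2_inner Q (weak_partial Q b x) (weak_partial Q b z) + l2_inner Q (weak_partial Q b y) (weak_partial Q b z)"
      if b: "b \<in> Basis" for b
    proof -
      note A = W21_add_weak_partial[OF W(1,2) b]
      have "l2_inner Q (weak_partial Q b (x + y)) (weak_partial Q b z)
          = l2_inner Q (weak_partial Q b x + weak_partial Q b y) (weak_partial Q b z)"
        by (rule Lsp.ip_null_cong(1)[OF weak_partial(1)[OF A] A(1) W21_weak_partial(1)[OF W(3) b] weak_partial_null[OF b A]])
      then show ?thesis using W W21_weak_partial(1)[OF _ b] by (simp add: Lsp.ip_add_left)
    qed
    then show ?thesis using W W21_L2 by (simp add: w_inner_def Lsp.ip_add_left sum.distrib)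
  qed
  show "w_inner Q (cscale c x) y = c * w_inner Q x y" if W: "x \<in> W21 Q" "y \<in> W21 Q" for c x y
  proof -
    have "l2_inner Q (weak_partial Q b (cscale c x)) (weak_partial Q b y)
        = c * l2_inner Q (weak_partial Q b x) (weak_partial Q b y)" if b: "b \<in> Basis" for b
    proof -
      note A = W21_scale_weak_partial[OF W(1) b, of c]
      have "l2_inner Q (weak_partial Q b (cscale c x)) (weak_partial Q b y)
          = l2_inner Q (cscale c (weak_partial Q b x)) (weak_partial Q b y)"
        by (rule Lsp.ip_null_cong(1)[OF weak_partial(1)[OF A] A(1) W21_weak_partial(1)[OF W(2) b] weak_partial_null[OF b A]])
      then show ?thesis using W W21_weak_partial(1)[OF _ b] by (simp add: Lsp.ip_scale_left)
    qed
    then show ?thesis using W W21_L2 by (simp add: w_inner_def Lsp.ip_scale_left sum_distrib_left distrib_left)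
  qed
  show "w_inner Q y x = cnj (w_inner Q x y)" if W: "x \<in> W21 Q" "y \<in> W21 Q" for x y
  proof -
    have "l2_inner Q y x = cnj (l2_inner Q x y)" using W W21_L2 by (intro Lsp.ip_sym)
    moreover have "(\<Sum>b\<in>Basis. l2_inner Q (weak_partial Q b y) (weak_partial Q b x))
        = (\<Sum>b\<in>Basis. cnj (l2_inner Q (weak_partial Q b x) (weak_partial Q b y)))"
      using W by (intro sum.cong refl Lsp.ip_sym W21_weak_partial(1))
    ultimately show ?thesis by (simp add: w_inner_def)
  qed
  show "0 \<le> Re (w_inner Q x x)" if W: "x \<in> W21 Q" for x
    using W W21_L2 W21_weak_partial(1)[OF W] by (auto simp: w_inner_def intro!: add_nonneg_nonneg sum_nonneg Lsp.ip_nonneg)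
qed

lemma nrm_w_inner: "semi_inner.nrm (w_inner Q) = W21_norm Q"
  by (simp add: fun_eq_iff semi_inner.nrm_def[OF W21_semi_inner] W21_norm_def w_inner_def l2_inner_self l2_norm_sq)

sublocale W: semi_inner cscale "W21 Q" "w_inner Q"
  rewrites "semi_inner.nrm (w_inner Q) = W21_norm Q"
  by (rule W21_semi_inner) (rule nrm_w_inner)

lemma W21_norm_sq: "(W21_norm Q u)\<^sup>2 = (l2_norm Q u)\<^sup>2 + (\<Sum>b\<in>Basis. (l2_norm Q (weak_partial Q b u))\<^sup>2)"
  by (simp add: W21_norm_def sum_nonneg add_nonneg_nonneg)

lemma l2_norm_le_W21_norm:
  shows "u \<in> W21 Q \<Longrightarrow> l2_norm Q u \<le> W21_norm Q u"
    and "u \<in> W21 Q \<Longrightarrow> b \<in> Basis \<Longrightarrow> l2_norm Q (weak_partial Q b u) \<le> W21_norm Q u"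
proof -
  assume u: "u \<in> W21 Q"
  show "l2_norm Q u \<le> W21_norm Q u"
    by (rule power2_le_imp_le[OF _ W.nrm_nonneg[OF u]]) (simp add: W21_norm_sq sum_nonneg)
  assume b: "b \<in> Basis"
  have "(l2_norm Q (weak_partial Q b u))\<^sup>2 \<le> (\<Sum>b\<in>Basis. (l2_norm Q (weak_partial Q b u))\<^sup>2)"
    by (rule member_le_sum[OF b]) auto
  then have "(l2_norm Q (weak_partial Q b u))\<^sup>2 \<le> (W21_norm Q u)\<^sup>2"
    unfolding W21_norm_sq by (metis add_increasing zero_le_power2)
  then show "l2_norm Q (weak_partial Q b u) \<le> W21_norm Q u"
    by (rule power2_le_imp_le[OF _ W.nrm_nonneg[OF u]])
qed

lemma W21_norm_le:
  assumes "u \<in> L2 Q" "\<And>b. b \<in> Basis \<Longrightarrow> g b \<in> L2 Q \<and> has_weak_partial Q b u (g b)"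
  shows "W21_norm Q u \<le> l2_norm Q u + (\<Sum>b\<in>Basis. l2_norm Q (g b))"
proof -
  have eq: "l2_norm Q (weak_partial Q b u) = l2_norm Q (g b)" if "b \<in> Basis" for b
    using assms(2)[OF that] weak_partial(1) weak_partial_null[OF that] by (intro Lsp.nrm_null_cong) auto
  have nn: "0 \<le> l2_norm Q u" "\<And>b. b \<in> Basis \<Longrightarrow> 0 \<le> l2_norm Q (g b)" using assms by auto
  have "(W21_norm Q u)\<^sup>2 = (l2_norm Q u)\<^sup>2 + (\<Sum>b\<in>Basis. (l2_norm Q (g b))\<^sup>2)"
    by (simp add: W21_norm_sq eq)
  also have "(\<Sum>b\<in>Basis. (l2_norm Q (g b))\<^sup>2) \<le> (\<Sum>b\<in>Basis. l2_norm Q (g b))\<^sup>2"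
  proof -
    have "(\<Sum>b\<in>Basis. (l2_norm Q (g b))\<^sup>2) \<le> (\<Sum>b\<in>Basis. l2_norm Q (g b) * (\<Sum>b\<in>Basis. l2_norm Q (g b)))"
      unfolding power2_eq_square using nn by (intro sum_mono mult_left_mono member_le_sum) auto
    then show ?thesis by (simp add: power2_eq_square sum_distrib_right)
  qed
  also have "(l2_norm Q u)\<^sup>2 + (\<Sum>b\<in>Basis. l2_norm Q (g b))\<^sup>2 \<le> (l2_norm Q u + (\<Sum>b\<in>Basis. l2_norm Q (g b)))\<^sup>2"
    using nn by (simp add: power2_sum sum_nonneg)
  finally have sq: "(W21_norm Q u)\<^sup>2 \<le> (l2_norm Q u + (\<Sum>b\<in>Basis. l2_norm Q (g b)))\<^sup>2" by simp
  have "0 \<le> (\<Sum>b\<in>Basis. l2_norm Q (g b))" using nn(2) by (rule sum_nonneg)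
  with nn(1) show ?thesis by (intro power2_le_imp_le[OF sq]) simp
qed

text \<open>The functions and their derivatives have separate limits in L2; that the latter limits
  are derivatives of the former is the closedness in \<open>has_weak_partial_limit\<close>.\<close>

lemma W21_complete:
  assumes X: "\<And>n. X n \<in> W21 Q" and cau: "\<And>e. 0 < e \<Longrightarrow> \<exists>N. \<forall>m\<ge>N. \<forall>n\<ge>N. W21_norm Q (X m - X n) < e"
  shows "\<exists>x\<in>W21 Q. (\<lambda>n. W21_norm Q (X n - x)) \<longlonglongrightarrow> 0"
proof -
  have wp_diff: "l2_norm Q (weak_partial Q b (u - v)) = l2_norm Q (weak_partial Q b u - weak_partial Q b v)"
    if "u \<in> W21 Q" "v \<in> W21 Q" "b \<in> Basis" for u v b
  proof -
    have v': "cscale (-1) v \<in> W21 Q" using that by (intro W21_scale)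
    note A = W21_scale_weak_partial[OF that(2,3), of "-1"]
    have "has_weak_partial Q b (u + cscale (-1) v) (weak_partial Q b u + cscale (-1) (weak_partial Q b v))"
      using that W21_weak_partial[OF that(1,3)] A W21_L2 v' by (intro has_weak_partial_add[OF measurable_Q])
    moreover have "u + cscale (-1) v = u - v" "weak_partial Q b u + cscale (-1) (weak_partial Q b v) = weak_partial Q b u - weak_partial Q b v"
      by (auto simp: fun_eq_iff)
    ultimately have h: "has_weak_partial Q b (u - v) (weak_partial Q b u - weak_partial Q b v)" by simp
    have m: "weak_partial Q b u - weak_partial Q b v \<in> L2 Q" using W21_weak_partial that by simp
    show ?thesis by (rule Lsp.nrm_null_cong[OF weak_partial(1)[OF m h] m weak_partial_null[OF that(3) m h]])
  qed
  have cau0: "Lsp.cau Q X"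
    unfolding Lsp.cau_def
  proof (intro allI impI)
    fix e :: real assume "0 < e"
    then obtain N where "\<forall>m\<ge>N. \<forall>n\<ge>N. W21_norm Q (X m - X n) < e" using cau by blast
    then show "\<exists>N. \<forall>m\<ge>N. \<forall>n\<ge>N. l2_norm Q (X m - X n) < e"
      using l2_norm_le_W21_norm(1)[OF W.mem(3)[OF X X]] by (meson order_le_less_trans)
  qed
  have cau1: "Lsp.cau Q (\<lambda>n. weak_partial Q b (X n))" if b: "b \<in> Basis" for b
    unfolding Lsp.cau_def
  proof (intro allI impI)
    fix e :: real assume "0 < e"
    then obtain N where "\<forall>m\<ge>N. \<forall>n\<ge>N. W21_norm Q (X m - X n) < e" using cau by blast
    then show "\<exists>N. \<forall>m\<ge>N. \<forall>n\<ge>N. l2_norm Q (weak_partial Q b (X m) - weak_partial Q b (X n)) < e"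
      using l2_norm_le_W21_norm(2)[OF W.mem(3)[OF X X] b] by (metis order_le_less_trans wp_diff[OF X X b])
  qed
  obtain u where u: "u \<in> L2 Q" "(\<lambda>n. l2_norm Q (X n - u)) \<longlonglongrightarrow> 0"
    using L2_complete[OF W21_L2[OF X] cau0] by blast
  have "\<forall>b\<in>Basis. \<exists>g\<in>L2 Q. (\<lambda>n. l2_norm Q (weak_partial Q b (X n) - g)) \<longlonglongrightarrow> 0"
    using L2_complete[OF W21_weak_partial(1)[OF X] cau1] by blast
  then obtain g where g: "\<And>b. b \<in> Basis \<Longrightarrow> g b \<in> L2 Q"
      "\<And>b. b \<in> Basis \<Longrightarrow> (\<lambda>n. l2_norm Q (weak_partial Q b (X n) - g b)) \<longlonglongrightarrow> 0"
    by metis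
  have hw: "has_weak_partial Q b u (g b)" if b: "b \<in> Basis" for b
    by (rule has_weak_partial_limit[OF measurable_Q b W21_weak_partial(2)[OF X b] W21_L2[OF X]
          W21_weak_partial(1)[OF X b] u(1) g(1)[OF b] u(2) g(2)[OF b]])
  have uW: "u \<in> W21 Q" by (rule W21_I[OF u(1), of g]) (use g hw in auto)
  have eq: "l2_norm Q (weak_partial Q b (X n - u)) = l2_norm Q (weak_partial Q b (X n) - g b)" if b: "b \<in> Basis" for b n
  proof -
    have "l2_norm Q (weak_partial Q b (X n - u)) = l2_norm Q (weak_partial Q b (X n) - weak_partial Q b u)"
      by (rule wp_diff[OF X uW b])
    also have "\<dots> = l2_norm Q (weak_partial Q b (X n) - g b)"
    proof (rule Lsp.nrm_null_cong)
      have "weak_partial Q b (X n) - weak_partial Q b u - (weak_partial Q b (X n) - g b) = g b - weak_partial Q b u"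
        by simp
      then show "l2_norm Q (weak_partial Q b (X n) - weak_partial Q b u - (weak_partial Q b (X n) - g b)) = 0"
        using weak_partial_null[OF b g(1)[OF b] hw[OF b]] W21_weak_partial(1)[OF uW b] g(1)[OF b]
        by (simp add: Lsp.nrm_minus_commute)
    qed (use W21_weak_partial(1)[OF X b] W21_weak_partial(1)[OF uW b] g(1)[OF b] in auto)
    finally show ?thesis .
  qed
  have "(\<lambda>n. sqrt ((l2_norm Q (X n - u))\<^sup>2 + (\<Sum>b\<in>Basis. (l2_norm Q (weak_partial Q b (X n) - g b))\<^sup>2)))
      \<longlonglongrightarrow> sqrt (0\<^sup>2 + (\<Sum>b\<in>(Basis::'a set). 0\<^sup>2))"
    by (intro tendsto_real_sqrt tendsto_add tendsto_power tendsto_sum u(2) g(2))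
  then have "(\<lambda>n. W21_norm Q (X n - u)) \<longlonglongrightarrow> 0"
    by (simp add: W21_norm_def eq)
  with uW show ?thesis by blast
qed

section \<open>The subspace of functions with zero trace\<close>

lemma W21_zero_W21: "u \<in> W21_zero Q \<Longrightarrow> u \<in> W21 Q"
  by (simp add: W21_zero_def)

lemma W21_zero_D:
  assumes "u \<in> W21_zero Q"
  obtains \<phi> where "\<And>n. \<phi> n \<in> test_functions Q" "(\<lambda>n. W21_norm Q (u - \<phi> n)) \<longlonglongrightarrow> 0"
  using assms by (auto simp: W21_zero_def fun_diff_def)

lemma W21_zero_I:
  assumes "u \<in> W21 Q" "\<And>n. \<phi> n \<in> test_functions Q" "(\<lambda>n. W21_norm Q (u - \<phi> n)) \<longlonglongrightarrow> 0"
  shows "u \<in> W21_zero Q"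
  using assms by (auto simp: W21_zero_def fun_diff_def)

lemma W21_zero_subspace: "csp.subspace (W21_zero Q)"
  unfolding csp.subspace_def
proof (intro conjI ballI allI)
  show "0 \<in> W21_zero Q"
  proof (rule W21_zero_I[where \<phi>="\<lambda>n. 0"])
    show "0 \<in> test_functions Q" using test_function_zero by (simp add: zero_fun_def)
    show "(\<lambda>n. W21_norm Q (0 - 0)) \<longlonglongrightarrow> 0" by (simp only: diff_self W.nrm_zero tendsto_const)
  qed (rule W.mem(1))
  fix u v assume u: "u \<in> W21_zero Q" and v: "v \<in> W21_zero Q"
  obtain \<phi> where \<phi>: "\<And>n. \<phi> n \<in> test_functions Q" "(\<lambda>n. W21_norm Q (u - \<phi> n)) \<longlonglongrightarrow> 0" by (rule W21_zero_D[OF u]) blast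
  obtain \<psi> where \<psi>: "\<And>n. \<psi> n \<in> test_functions Q" "(\<lambda>n. W21_norm Q (v - \<psi> n)) \<longlonglongrightarrow> 0" by (rule W21_zero_D[OF v]) blast
  note W = W21_zero_W21[OF u] W21_zero_W21[OF v] test_function_W21[OF \<phi>(1)] test_function_W21[OF \<psi>(1)]
  show "u + v \<in> W21_zero Q"
  proof (rule W21_zero_I[where \<phi>="\<lambda>n. \<phi> n + \<psi> n"])
    show "u + v \<in> W21 Q" using W by simp
    show "\<phi> n + \<psi> n \<in> test_functions Q" for n using test_function_add[OF \<phi>(1) \<psi>(1)] by (simp add: plus_fun_def)
    have lim0: "(\<lambda>n. W21_norm Q (u - \<phi> n) + W21_norm Q (v - \<psi> n)) \<longlonglongrightarrow> 0"
      using tendsto_add[OF \<phi>(2) \<psi>(2)] by simp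
    show "(\<lambda>n. W21_norm Q (u + v - (\<phi> n + \<psi> n))) \<longlonglongrightarrow> 0"
    proof (rule Lim_null_comparison[OF _ lim0], intro always_eventually allI)
      fix n
      have eq: "u + v - (\<phi> n + \<psi> n) = (u - \<phi> n) + (v - \<psi> n)" by simp
      have "W21_norm Q (u + v - (\<phi> n + \<psi> n)) \<le> W21_norm Q (u - \<phi> n) + W21_norm Q (v - \<psi> n)"
        unfolding eq by (rule W.nrm_triangle) (use W in auto)
      moreover have "0 \<le> W21_norm Q (u + v - (\<phi> n + \<psi> n))" using W by (intro W.nrm_nonneg) simp
      ultimately show "norm (W21_norm Q (u + v - (\<phi> n + \<psi> n))) \<le> W21_norm Q (u - \<phi> n) + W21_norm Q (v - \<psi> n)"
        by simp
    qed
  qed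
  show "cscale c u \<in> W21_zero Q" for c
  proof (rule W21_zero_I[where \<phi>="\<lambda>n. cscale c (\<phi> n)"])
    show "cscale c u \<in> W21 Q" using W by simp
    show "cscale c (\<phi> n) \<in> test_functions Q" for n by (rule test_function_scale[OF \<phi>(1)])
    have "W21_norm Q (cscale c u - cscale c (\<phi> n)) = cmod c * W21_norm Q (u - \<phi> n)" for n
    proof -
      have "cscale c u - cscale c (\<phi> n) = cscale c (u - \<phi> n)" by (simp add: fun_eq_iff right_diff_distrib)
      then show ?thesis using W.nrm_scale[of "u - \<phi> n" c] W by simp
    qed
    then show "(\<lambda>n. W21_norm Q (cscale c u - cscale c (\<phi> n))) \<longlonglongrightarrow> 0"
      using tendsto_mult_right_zero[OF \<phi>(2), of "cmod c"] by simp
  qed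
qed

text \<open>A diagonal choice: for each \<open>n\<close> take a test function within 1/(n+1) of
  \<open>X n\<close>. Completeness of the form domain rests on this.\<close>

lemma W21_zero_closed:
  assumes X: "\<And>n. X n \<in> W21_zero Q" and x: "x \<in> W21 Q" and lim: "(\<lambda>n. W21_norm Q (X n - x)) \<longlonglongrightarrow> 0"
  shows "x \<in> W21_zero Q"
proof -
  note XW = W21_zero_W21[OF X]
  have "\<exists>\<phi>. \<phi> \<in> test_functions Q \<and> W21_norm Q (X n - \<phi>) < 1 / Suc n" for n :: nat
  proof -
    obtain \<phi> where \<phi>: "\<And>k. \<phi> k \<in> test_functions Q" "(\<lambda>k. W21_norm Q (X n - \<phi> k)) \<longlonglongrightarrow> 0"
      by (rule W21_zero_D[OF X]) blast
    have "\<forall>\<^sub>F k in sequentially. W21_norm Q (X n - \<phi> k) < 1 / Suc n"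
      by (rule order_tendstoD(2)[OF \<phi>(2)]) simp
    then obtain k where "W21_norm Q (X n - \<phi> k) < 1 / Suc n"
      using eventually_happens'[OF sequentially_bot] by auto
    then show ?thesis using \<phi>(1) by (intro exI[of _ "\<phi> k"] conjI)
  qed
  then obtain \<phi> where \<phi>: "\<And>n. \<phi> n \<in> test_functions Q" "\<And>n. W21_norm Q (X n - \<phi> n) < 1 / Suc n" by metis
  note \<phi>W = test_function_W21[OF \<phi>(1)]
  show ?thesis
  proof (rule W21_zero_I[OF x \<phi>(1)])
    have lim0: "(\<lambda>n. W21_norm Q (X n - x) + 1 / Suc n) \<longlonglongrightarrow> 0"
      using tendsto_add[OF lim LIMSEQ_Suc[OF lim_inverse_n']] by simp
    show "(\<lambda>n. W21_norm Q (x - \<phi> n)) \<longlonglongrightarrow> 0"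
    proof (rule Lim_null_comparison[OF _ lim0], intro always_eventually allI)
      fix n
      have "W21_norm Q (x - \<phi> n) \<le> W21_norm Q (x - X n) + W21_norm Q (X n - \<phi> n)"
        using x XW \<phi>W by (intro W.nrm_triangle3)
      moreover have "W21_norm Q (x - X n) = W21_norm Q (X n - x)" using x XW by (intro W.nrm_minus_commute)
      moreover have "0 \<le> W21_norm Q (x - \<phi> n)" using x \<phi>W by (intro W.nrm_nonneg) simp
      ultimately show "norm (W21_norm Q (x - \<phi> n)) \<le> W21_norm Q (X n - x) + 1 / Suc n"
        using \<phi>(2)[of n] by simp
    qed
  qed
qed

end

section \<open>The Schroedinger form\<close>

locale schroedinger = ae_open Q for Q :: "'a::euclidean_space set" +
  fixes V :: "'a \<Rightarrow> real" and B :: real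
  assumes V_measurable: "V \<in> borel_measurable (lebesgue_on Q)"
    and V_bound: "x \<in> Q \<Longrightarrow> \<bar>V x\<bar> \<le> B" and B_nonneg: "0 \<le> B"
begin

definition vmul :: "('a \<Rightarrow> complex) \<Rightarrow> 'a \<Rightarrow> complex" where
  "vmul u = (\<lambda>x. complex_of_real (V x) * u x)"

text \<open>Since \<open>V + B + 1 \<ge> 1\<close> on \<open>Q\<close>, the shift makes the form
  dominate the square of the W21 norm. Spectral parameters are shifted by \<open>B + 1\<close>
  accordingly.\<close>

definition bform :: "('a \<Rightarrow> complex) \<Rightarrow> ('a \<Rightarrow> complex) \<Rightarrow> complex" where
  "bform u v = schroedinger_form Q V u v + of_real (B + 1) * l2_inner Q u v"

lemma vmul_L2: assumes "u \<in> L2 Q" shows "vmul u \<in> L2 Q"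
  unfolding vmul_def
proof (rule L2_mult[OF assms _ _ measurable_Q, of _ B])
  show "(\<lambda>x. complex_of_real (V x)) \<in> borel_measurable (lebesgue_on Q)"
    by (rule measurable_compose[OF V_measurable borel_measurable_of_real])
qed (use V_bound in auto)

lemma vmul_nrm: assumes "u \<in> L2 Q" shows "l2_norm Q (vmul u) \<le> B * l2_norm Q u"
proof (rule l2_norm_mono_AE[OF assms vmul_L2[OF assms] _ B_nonneg])
  show "AE x in lebesgue_on Q. cmod (vmul u x) \<le> B * cmod (u x)"
    by (rule AE_I2) (use V_bound in \<open>auto simp: vmul_def norm_mult space_restrict_space intro!: mult_right_mono\<close>)
qed

lemma vmul_linear: "vmul (u + v) = vmul u + vmul v" "vmul (cscale c u) = cscale c (vmul u)"
  by (auto simp: vmul_def fun_eq_iff distrib_left)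

lemma vmul_sym: "l2_inner Q (vmul u) v = l2_inner Q u (vmul v)"
  by (simp add: l2_inner_def vmul_def mult_ac)

lemma bform_eq: "bform u v = w_inner Q u v + l2_inner Q (vmul u) v + of_real B * l2_inner Q u v"
  by (simp add: bform_def schroedinger_form_def w_inner_def vmul_def algebra_simps)

lemma bform_bounds:
  assumes u: "u \<in> W21 Q"
  shows "(W21_norm Q u)\<^sup>2 \<le> Re (bform u u)" "Re (bform u u) \<le> (1 + 2 * B) * (W21_norm Q u)\<^sup>2"
proof -
  note uL = W21_L2[OF u]
  have "\<bar>Re (l2_inner Q (vmul u) u)\<bar> \<le> l2_norm Q (vmul u) * l2_norm Q u"
    by (rule Lsp.Re_ip_le[OF vmul_L2[OF uL] uL])
  also have "\<dots> \<le> B * l2_norm Q u * l2_norm Q u"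
    by (intro mult_right_mono vmul_nrm uL Lsp.nrm_nonneg)
  finally have p: "\<bar>Re (l2_inner Q (vmul u) u)\<bar> \<le> B * (l2_norm Q u)\<^sup>2" by (simp add: power2_eq_square mult.assoc)
  have q: "Re (l2_inner Q u u) = (l2_norm Q u)\<^sup>2" using Lsp.nrm_sq[OF uL] by simp
  have r: "Re (w_inner Q u u) = (W21_norm Q u)\<^sup>2" using W.nrm_sq[OF u] by simp
  show "(W21_norm Q u)\<^sup>2 \<le> Re (bform u u)" using p q r by (simp add: bform_eq)
  have "B * (l2_norm Q u)\<^sup>2 \<le> B * (W21_norm Q u)\<^sup>2"
    using l2_norm_le_W21_norm(1)[OF u] B_nonneg uL by (intro mult_left_mono power_mono Lsp.nrm_nonneg)
  then show "Re (bform u u) \<le> (1 + 2 * B) * (W21_norm Q u)\<^sup>2"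
    using p q r by (simp add: bform_eq algebra_simps)
qed

lemma bform_semi_inner: "semi_inner cscale (W21_zero Q) bform"
proof
  note WL = W21_zero_W21 W21_L2[OF W21_zero_W21] vmul_L2[OF W21_L2[OF W21_zero_W21]]
  show "csp.subspace (W21_zero Q)" by (rule W21_zero_subspace)
  show "bform (x + y) z = bform x z + bform y z" if "x \<in> W21_zero Q" "y \<in> W21_zero Q" "z \<in> W21_zero Q" for x y z
    using WL[OF that(1)] WL[OF that(2)] WL[OF that(3)]
    by (simp add: bform_eq vmul_linear W.ip_add_left Lsp.ip_add_left distrib_left)
  show "bform (cscale c x) y = c * bform x y" if "x \<in> W21_zero Q" "y \<in> W21_zero Q" for c x y
    using WL[OF that(1)] WL[OF that(2)]
    by (simp add: bform_eq vmul_linear W.ip_scale_left Lsp.ip_scale_left distrib_left mult.left_commute)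
  show "bform y x = cnj (bform x y)" if "x \<in> W21_zero Q" "y \<in> W21_zero Q" for x y
    using W.ip_sym[of x y] Lsp.ip_sym[of x Q y] Lsp.ip_sym[of "vmul x" Q y] vmul_sym[of y x]
      WL[OF that(1)] WL[OF that(2)] by (simp add: bform_eq)
  show "0 \<le> Re (bform x x)" if "x \<in> W21_zero Q" for x
    using bform_bounds(1)[OF WL(1)[OF that]] by (rule order_trans[OF zero_le_power2])
qed

lemma nrm_bform_bounds:
  assumes "u \<in> W21 Q"
  shows "W21_norm Q u \<le> semi_inner.nrm bform u" "semi_inner.nrm bform u \<le> sqrt (1 + 2 * B) * W21_norm Q u"
proof -
  note n = W.nrm_nonneg[OF assms]
  show "W21_norm Q u \<le> semi_inner.nrm bform u"
    unfolding semi_inner.nrm_def[OF bform_semi_inner] by (rule real_le_rsqrt) (rule bform_bounds(1)[OF assms])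
  have "sqrt (Re (bform u u)) \<le> sqrt ((1 + 2 * B) * (W21_norm Q u)\<^sup>2)"
    using bform_bounds(2)[OF assms] by (rule real_sqrt_le_mono)
  then show "semi_inner.nrm bform u \<le> sqrt (1 + 2 * B) * W21_norm Q u"
    using n by (simp add: semi_inner.nrm_def[OF bform_semi_inner] real_sqrt_mult)
qed

lemma bform_semi_hilbert: "semi_hilbert cscale (W21_zero Q) bform"
proof -
  interpret F: semi_inner cscale "W21_zero Q" bform by (rule bform_semi_inner)
  show ?thesis
  proof
    fix X :: "nat \<Rightarrow> 'a \<Rightarrow> complex" assume X: "\<And>n. X n \<in> W21_zero Q" and cau: "F.cau X"
    note XW = W21_zero_W21[OF X]
    have "\<exists>N. \<forall>m\<ge>N. \<forall>n\<ge>N. W21_norm Q (X m - X n) < e" if e: "0 < e" for e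
    proof -
      obtain N where N: "\<And>m n. N \<le> m \<Longrightarrow> N \<le> n \<Longrightarrow> F.nrm (X m - X n) < e"
        using cau e unfolding F.cau_def by metis
      have "W21_norm Q (X m - X n) < e" if "N \<le> m" "N \<le> n" for m n
        using nrm_bform_bounds(1)[OF W.mem(3)[OF XW XW], of m n] N[OF that] by (rule order_le_less_trans)
      then show ?thesis by blast
    qed
    from W21_complete[OF XW this] obtain x where x: "x \<in> W21 Q" "(\<lambda>n. W21_norm Q (X n - x)) \<longlonglongrightarrow> 0"
      by blast
    have x0: "x \<in> W21_zero Q" by (rule W21_zero_closed[OF X x])
    have "(\<lambda>n. F.nrm (X n - x)) \<longlonglongrightarrow> 0"
    proof (rule Lim_null_comparison)
      show "(\<lambda>n. sqrt (1 + 2 * B) * W21_norm Q (X n - x)) \<longlonglongrightarrow> 0" using tendsto_mult_right_zero[OF x(2)] .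
      show "\<forall>\<^sub>F n in sequentially. norm (F.nrm (X n - x)) \<le> sqrt (1 + 2 * B) * W21_norm Q (X n - x)"
        using nrm_bform_bounds(2)[OF W.mem(3)[OF XW x(1)]] F.nrm_nonneg[OF F.mem(3)[OF X x0]] by simp
    qed
    with x0 show "\<exists>x\<in>W21_zero Q. (\<lambda>n. F.nrm (X n - x)) \<longlonglongrightarrow> 0" by blast
  qed
qed

lemma form_operator_bform: "form_operator cscale (L2 Q) (l2_inner Q) (W21_zero Q) bform"
proof -
  interpret F: semi_hilbert cscale "W21_zero Q" bform by (rule bform_semi_hilbert)
  interpret L: semi_hilbert cscale "L2 Q" "l2_inner Q" by (rule Lh.semi_hilbert_axioms)
  show ?thesis
  proof
    show "W21_zero Q \<subseteq> L2 Q" using W21_zero_W21 W21_L2 by blast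
    show "Re (l2_inner Q u u) \<le> Re (bform u u)" if "u \<in> W21_zero Q" for u
    proof -
      note u = W21_zero_W21[OF that]
      have "Re (l2_inner Q u u) = (l2_norm Q u)\<^sup>2" using Lsp.nrm_sq[OF W21_L2[OF u]] by simp
      also have "\<dots> \<le> (W21_norm Q u)\<^sup>2"
        by (intro power_mono l2_norm_le_W21_norm u Lsp.nrm_nonneg W21_L2)
      finally show ?thesis using bform_bounds(1)[OF u] by linarith
    qed
  qed
qed

sublocale Op: form_operator cscale "L2 Q" "l2_inner Q" "W21_zero Q" bform
  rewrites "semi_inner.nrm (l2_inner Q) = l2_norm Q"
  by (rule form_operator_bform) (rule nrm_l2_inner)

text \<open>\<open>bform\<close> belongs to the Schroedinger operator plus \<open>B + 1\<close>, so
  the two values at \<open>u\<close> differ by \<open>(B + 1) u\<close>.\<close>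

lemma schroedinger_operator_iff:
  assumes "g \<in> L2 Q"
  shows "(u, g - cscale (of_real (B + 1)) u) \<in> schroedinger_operator Q V \<longleftrightarrow> Op.gr u g"
proof -
  let ?c = "complex_of_real (B + 1)"
  have "schroedinger_form Q V u v = l2_inner Q (g - cscale ?c u) v \<longleftrightarrow> bform u v = l2_inner Q g v"
    if "u \<in> W21_zero Q" "v \<in> W21_zero Q" for v
  proof -
    have L: "u \<in> L2 Q" "v \<in> L2 Q" using that W21_zero_W21 W21_L2 by auto
    have eq: "l2_inner Q (g - cscale ?c u) v = l2_inner Q g v - ?c * l2_inner Q u v"
      using L assms L2_scale[OF L(1), of ?c] by (simp only: Lsp.ip_diff_left Lsp.ip_scale_left)
    show ?thesis unfolding eq bform_def by (rule eq_diff_eq)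
  qed
  moreover have "g - cscale ?c u \<in> L2 Q" if "u \<in> W21_zero Q"
    using that assms W21_zero_W21 W21_L2 L2_scale by (intro Lsp.mem(3)) auto
  ultimately show ?thesis
    using assms unfolding schroedinger_operator_def Op.gr_def by blast
qed

lemma schroedinger_operator_cases:
  assumes "(u, f) \<in> schroedinger_operator Q V"
  shows "Op.gr u (f + cscale (of_real (B + 1)) u)"
proof -
  let ?c = "complex_of_real (B + 1)"
  have m: "u \<in> W21_zero Q" "f \<in> L2 Q" using assms by (auto simp: schroedinger_operator_def)
  then have "f + cscale ?c u \<in> L2 Q" using W21_zero_W21 W21_L2 L2_scale by (intro Lsp.mem(2)) auto
  from schroedinger_operator_iff[OF this, of u] assms show ?thesis by (simp only: add_diff_cancel_right')
qed

text \<open>Once equality almost everywhere is read as vanishing of a norm and the shift is taken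
  into account, this is \<open>resolvent_iff_not_apx\<close>.\<close>

lemma spectrum_iff: "z \<in> spectrum Q (schroedinger_operator Q V) \<longleftrightarrow> Op.apx (z + of_real (B + 1))"
proof -
  let ?c = "complex_of_real (B + 1)" and ?H = "schroedinger_operator Q V"
  have shift: "(\<lambda>x. (g - cscale ?c u) x - z * u x) = g - cscale (z + ?c) u"
    "(\<lambda>x. f x - z * u x) = (f + cscale ?c u) - cscale (z + ?c) u" for f g u :: "'a \<Rightarrow> complex"
    by (auto simp: fun_eq_iff algebra_simps)
  have L: "g - cscale (z + ?c) u \<in> L2 Q" if "Op.gr u g" for u g
    using Op.gr_mem[OF that] L2_scale by (intro Lsp.mem(3)) auto
  have onto: "(\<exists>(u, g)\<in>?H. AE x in lebesgue_on Q. g x - z * u x = f x) \<longleftrightarrow>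
      (\<exists>u g. Op.gr u g \<and> l2_norm Q (g - cscale (z + ?c) u - f) = 0)" if f: "f \<in> L2 Q" for f
  proof
    assume "\<exists>(u, g)\<in>?H. AE x in lebesgue_on Q. g x - z * u x = f x"
    then obtain u g where ug: "(u, g) \<in> ?H" "AE x in lebesgue_on Q. g x - z * u x = f x" by blast
    note gr = schroedinger_operator_cases[OF ug(1)]
    have "l2_norm Q ((g + cscale ?c u) - cscale (z + ?c) u - f) = 0"
      using l2_norm_diff_eq_0_iff[OF L[OF gr] f] ug(2) by (simp add: algebra_simps)
    with gr show "\<exists>u g. Op.gr u g \<and> l2_norm Q (g - cscale (z + ?c) u - f) = 0" by blast
  next
    assume "\<exists>u g. Op.gr u g \<and> l2_norm Q (g - cscale (z + ?c) u - f) = 0"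
    then obtain u g where ug: "Op.gr u g" "l2_norm Q (g - cscale (z + ?c) u - f) = 0" by blast
    have "(u, g - cscale ?c u) \<in> ?H"
      using ug(1) Op.gr_mem(2)[OF ug(1)] by (simp only: schroedinger_operator_iff)
    moreover have "AE x in lebesgue_on Q. (g - cscale ?c u) x - z * u x = f x"
      using l2_norm_diff_eq_0_iff[OF L[OF ug(1)] f] ug(2) by (simp add: algebra_simps)
    ultimately show "\<exists>(u, g)\<in>?H. AE x in lebesgue_on Q. g x - z * u x = f x" by blast
  qed
  have below: "(\<exists>C. \<forall>(u, g)\<in>?H. l2_norm Q u \<le> C * l2_norm Q (\<lambda>x. g x - z * u x)) \<longleftrightarrow>
      (\<exists>C. \<forall>u g. Op.gr u g \<longrightarrow> l2_norm Q u \<le> C * l2_norm Q (g - cscale (z + ?c) u))"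
  proof (intro ex_cong1 iffI)
    fix C assume C: "\<forall>(u, g)\<in>?H. l2_norm Q u \<le> C * l2_norm Q (\<lambda>x. g x - z * u x)"
    show "\<forall>u g. Op.gr u g \<longrightarrow> l2_norm Q u \<le> C * l2_norm Q (g - cscale (z + ?c) u)"
    proof (intro allI impI)
      fix u g assume gr: "Op.gr u g"
      have "(u, g - cscale ?c u) \<in> ?H"
        using gr Op.gr_mem(2)[OF gr] by (simp only: schroedinger_operator_iff)
      with C have "l2_norm Q u \<le> C * l2_norm Q (\<lambda>x. (g - cscale ?c u) x - z * u x)" by blast
      then show "l2_norm Q u \<le> C * l2_norm Q (g - cscale (z + ?c) u)" unfolding shift .
    qed
  next
    fix C assume C: "\<forall>u g. Op.gr u g \<longrightarrow> l2_norm Q u \<le> C * l2_norm Q (g - cscale (z + ?c) u)"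
    have "l2_norm Q u \<le> C * l2_norm Q (\<lambda>x. g x - z * u x)" if "(u, g) \<in> ?H" for u g
      using C schroedinger_operator_cases[OF that] unfolding shift(2) by blast
    then show "\<forall>(u, g)\<in>?H. l2_norm Q u \<le> C * l2_norm Q (\<lambda>x. g x - z * u x)" by blast
  qed
  have "z \<in> resolvent_set Q ?H \<longleftrightarrow> \<not> Op.apx (z + ?c)"
    unfolding resolvent_set_def mem_Collect_eq below Op.resolvent_iff_not_apx
    by (rule arg_cong2[of _ _ _ _ "(\<and>)", OF ball_cong[OF refl onto] refl])
  then show ?thesis unfolding spectrum_def by blast
qed

end

section \<open>Domains that differ by a null set\<close>

text \<open>Every subset of a null set is Lebesgue measurable, so the values of \<open>f\<close> on
  \<open>Q1 - Q0\<close> are irrelevant.\<close>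

lemma lebesgue_on_measurable_null_extend:
  assumes sub: "Q0 \<subseteq> Q1" and neg: "negligible (Q1 - Q0)" and Q0: "Q0 \<in> sets lebesgue"
  shows "f \<in> borel_measurable (lebesgue_on Q1) \<longleftrightarrow> f \<in> borel_measurable (lebesgue_on Q0)"
proof
  have Q1: "Q1 \<in> sets lebesgue"
    using sets.Un[OF Q0 negligible_imp_sets[OF neg]] sub by (simp add: Un_absorb1)
  assume "f \<in> borel_measurable (lebesgue_on Q1)"
  then show "f \<in> borel_measurable (lebesgue_on Q0)"
    by (rule measurable_restrict_mono[OF _ sub])
next
  have Q1: "Q1 \<in> sets lebesgue"
    using sets.Un[OF Q0 negligible_imp_sets[OF neg]] sub by (simp add: Un_absorb1)
  assume f: "f \<in> borel_measurable (lebesgue_on Q0)"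
  show "f \<in> borel_measurable (lebesgue_on Q1)"
  proof (rule measurableI)
    fix A :: "'b set" assume A: "A \<in> sets borel"
    have "f -` A \<inter> Q0 \<in> sets lebesgue"
      using measurable_sets[OF f A] Q0 by (auto simp: space_restrict_space sets_restrict_space_iff)
    moreover have "f -` A \<inter> (Q1 - Q0) \<in> sets lebesgue"
      by (rule negligible_imp_sets[OF negligible_subset[OF neg]]) auto
    moreover have "f -` A \<inter> Q1 = (f -` A \<inter> Q0) \<union> (f -` A \<inter> (Q1 - Q0))" using sub by blast
    ultimately have "f -` A \<inter> Q1 \<in> sets lebesgue" by simp
    then show "f -` A \<inter> space (lebesgue_on Q1) \<in> sets (lebesgue_on Q1)"
      using Q1 by (auto simp: space_restrict_space sets_restrict_space_iff)
  qed simp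
qed

text \<open>Because the domains differ by a null set, both operators act in the same L2 with the
  same inner product and can be compared without identification maps.\<close>

locale domain_pair = A: schroedinger Q1 V B + B: schroedinger Q0 V B
  for Q1 Q0 :: "'a::euclidean_space set" and V B +
  assumes dom_sub: "Q0 \<subseteq> Q1" and dom_null: "negligible (Q1 - Q0)"
begin

lemma meas_iff: "f \<in> borel_measurable (lebesgue_on Q1) \<longleftrightarrow> f \<in> borel_measurable (lebesgue_on Q0)"
  by (rule lebesgue_on_measurable_null_extend[OF dom_sub dom_null B.measurable_Q])

lemma integral_iff:
  fixes f :: "'a \<Rightarrow> 'b::euclidean_space"
  shows "integrable (lebesgue_on Q1) f \<longleftrightarrow> integrable (lebesgue_on Q0) f"
    "integral\<^sup>L (lebesgue_on Q1) f = integral\<^sup>L (lebesgue_on Q0) f"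
proof -
  have "(integrable (lebesgue_on Q1) f \<longleftrightarrow> integrable (lebesgue_on Q0) f) \<and>
      integral\<^sup>L (lebesgue_on Q1) f = integral\<^sup>L (lebesgue_on Q0) f"
  proof (cases "f \<in> borel_measurable (lebesgue_on Q0)")
    case False
    then have "\<not> integrable (lebesgue_on Q0) f" "\<not> integrable (lebesgue_on Q1) f"
      using borel_measurable_integrable meas_iff by blast+
    then show ?thesis by (simp add: not_integrable_integral_eq)
  next
    case True
  have ae: "AE x in lebesgue. indicat_real Q1 x *\<^sub>R f x = indicat_real Q0 x *\<^sub>R f x"
  proof -
    have "AE x in lebesgue. x \<notin> Q1 - Q0"
      by (rule AE_not_in) (use dom_null negligible_iff_null_sets in blast)
    then show ?thesis by eventually_elim (use dom_sub in \<open>auto simp: indicator_def\<close>)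
  qed
  have m: "(\<lambda>x. indicat_real Q1 x *\<^sub>R f x) \<in> borel_measurable lebesgue"
    "(\<lambda>x. indicat_real Q0 x *\<^sub>R f x) \<in> borel_measurable lebesgue"
    using True meas_iff[of f] by (auto simp: borel_measurable_restrict_space_iff)
    show ?thesis
      using integrable_cong_AE[OF m ae] integral_cong_AE[OF m ae]
      by (simp add: integrable_restrict_space integral_restrict_space)
  qed
  then show "integrable (lebesgue_on Q1) f \<longleftrightarrow> integrable (lebesgue_on Q0) f"
    "integral\<^sup>L (lebesgue_on Q1) f = integral\<^sup>L (lebesgue_on Q0) f" by auto
qed

lemma L2_eq: "L2 Q1 = L2 Q0"
  unfolding L2_def by (auto simp: meas_iff integral_iff)

lemma l2_inner_eq: "l2_inner Q1 = l2_inner Q0"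
  by (intro ext) (simp add: l2_inner_def integral_iff)

lemma l2_norm_eq: "l2_norm Q1 = l2_norm Q0"
  by (intro ext) (simp add: l2_norm_def integral_iff)

lemma has_weak_partial_restrict:
  assumes "has_weak_partial Q1 b u g"
  shows "has_weak_partial Q0 b u g"
  unfolding has_weak_partial_def
proof
  fix \<phi> assume \<phi>: "\<phi> \<in> test_functions Q0"
  then have \<phi>1: "\<phi> \<in> test_functions Q1" using test_functions_mono[OF dom_sub] by blast

  show "(LINT x|lebesgue_on Q0. u x * frechet_derivative \<phi> (at x) b) = - (LINT x|lebesgue_on Q0. g x * \<phi> x)"
    using assms \<phi>1 unfolding has_weak_partial_def by (simp add: integral_iff)
qed

lemma W21_restrict:
  assumes "u \<in> W21 Q1"
  shows "u \<in> W21 Q0" "b \<in> Basis \<Longrightarrow> l2_norm Q0 (weak_partial Q1 b u - weak_partial Q0 b u) = 0"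
    "b \<in> Basis \<Longrightarrow> weak_partial Q1 b u \<in> L2 Q0" "b \<in> Basis \<Longrightarrow> weak_partial Q0 b u \<in> L2 Q0"
proof -
  have h: "has_weak_partial Q0 b u (weak_partial Q1 b u)" and L: "weak_partial Q1 b u \<in> L2 Q0" if "b \<in> Basis" for b
    using has_weak_partial_restrict[OF A.W21_weak_partial(2)[OF assms that]]
      A.W21_weak_partial(1)[OF assms that] L2_eq by auto
  show uW: "u \<in> W21 Q0"
    by (rule B.W21_I[where g="\<lambda>b. weak_partial Q1 b u"]) (use A.W21_L2[OF assms] L2_eq h L in auto)
  assume b: "b \<in> Basis"
  show "weak_partial Q1 b u \<in> L2 Q0" by (rule L[OF b])
  show "weak_partial Q0 b u \<in> L2 Q0" by (rule B.W21_weak_partial[OF uW b])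
  show "l2_norm Q0 (weak_partial Q1 b u - weak_partial Q0 b u) = 0"
    using B.weak_partial_null[OF b L[OF b] h[OF b]] L[OF b] B.W21_weak_partial(1)[OF uW b]
    by (simp add: Lsp.nrm_minus_commute)
qed

lemma w_inner_eq: assumes "u \<in> W21 Q1" "v \<in> W21 Q1" shows "w_inner Q1 u v = w_inner Q0 u v"
proof -
  have "l2_inner Q1 (weak_partial Q1 b u) (weak_partial Q1 b v) = l2_inner Q0 (weak_partial Q0 b u) (weak_partial Q0 b v)"
    if b: "b \<in> Basis" for b
  proof -
    note u = W21_restrict(2-4)[OF assms(1) b] and v = W21_restrict(2-4)[OF assms(2) b]
    have "l2_inner Q1 (weak_partial Q1 b u) (weak_partial Q1 b v) = l2_inner Q0 (weak_partial Q0 b u) (weak_partial Q1 b v)"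
      unfolding l2_inner_eq by (rule Lsp.ip_null_cong(1)[OF u(2,3) v(2) u(1)])
    also have "\<dots> = l2_inner Q0 (weak_partial Q0 b u) (weak_partial Q0 b v)"
      by (rule Lsp.ip_null_cong(2)[OF v(2,3) u(3) v(1)])
    finally show ?thesis .
  qed
  then show ?thesis by (simp add: w_inner_def l2_inner_eq)
qed

lemma W21_norm_eq: "u \<in> W21 Q1 \<Longrightarrow> W21_norm Q1 u = W21_norm Q0 u"
  using w_inner_eq[of u u] A.W.nrm_sq[of u] B.W.nrm_sq[of u] A.W.nrm_nonneg[of u] B.W.nrm_nonneg[of u] W21_restrict(1)[of u]
  by (intro power2_eq_imp_eq[of "W21_norm Q1 u"]) simp_all

text \<open>A weak derivative on \<open>Q0\<close> need not be one on \<open>Q1\<close>, since a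
  function may jump across the added set. For a limit of test functions on \<open>Q0\<close> it is
  one: the approximants have the same classical derivatives on both sets, and
  \<open>has_weak_partial_limit\<close> passes to the limit.\<close>

lemma W21_zero_sub: "W21_zero Q0 \<subseteq> W21_zero Q1"
proof
  fix u assume u: "u \<in> W21_zero Q0"
  note uW = B.W21_zero_W21[OF u]
  obtain \<phi> where \<phi>: "\<And>n. \<phi> n \<in> test_functions Q0" "(\<lambda>n. W21_norm Q0 (u - \<phi> n)) \<longlonglongrightarrow> 0" by (rule B.W21_zero_D[OF u]) blast
  have \<phi>1: "\<phi> n \<in> test_functions Q1" for n using test_functions_mono[OF dom_sub] \<phi>(1) by blast
  note \<phi>W = B.test_function_W21[OF \<phi>(1)]
  have uL: "u \<in> L2 Q1" using B.W21_L2[OF uW] L2_eq by simp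
  have hw: "has_weak_partial Q1 b u (weak_partial Q0 b u)" and wL: "weak_partial Q0 b u \<in> L2 Q1" if b: "b \<in> Basis" for b
  proof -
    show wL: "weak_partial Q0 b u \<in> L2 Q1" using B.W21_weak_partial(1)[OF uW b] L2_eq by simp
    let ?G = "\<lambda>n x. frechet_derivative (\<phi> n) (at x) b"
    note sw = smooth_has_weak_partial[OF test_functionsD(1)[OF \<phi>(1)] B.measurable_Q b]
    have GL: "?G n \<in> L2 Q0" for n by (rule test_function_L2[OF test_function_derivative[OF \<phi>(1) b] B.measurable_Q])
    have lim1: "(\<lambda>n. l2_norm Q0 (\<phi> n - u)) \<longlonglongrightarrow> 0"
    proof (rule Lim_null_comparison[OF _ \<phi>(2)], intro always_eventually allI)
      fix n
      have "l2_norm Q0 (\<phi> n - u) = l2_norm Q0 (u - \<phi> n)"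
        using B.W21_L2[OF uW] B.W21_L2[OF \<phi>W] by (intro Lsp.nrm_minus_commute)
      moreover have "0 \<le> l2_norm Q0 (u - \<phi> n)"
        using B.W21_L2[OF uW] B.W21_L2[OF \<phi>W] by (intro Lsp.nrm_nonneg) simp
      ultimately show "norm (l2_norm Q0 (\<phi> n - u)) \<le> W21_norm Q0 (u - \<phi> n)"
        using B.l2_norm_le_W21_norm(1)[OF B.W.mem(3)[OF uW \<phi>W]] by simp
    qed
    have lim2: "(\<lambda>n. l2_norm Q0 (?G n - weak_partial Q0 b u)) \<longlonglongrightarrow> 0"
    proof (rule Lim_null_comparison[OF _ \<phi>(2)], intro always_eventually allI)
      fix n
      note wu = B.W21_weak_partial[OF uW b]
      have m: "weak_partial Q0 b u + cscale (-1) (?G n) \<in> L2 Q0" by (intro Lsp.mem(2) wu(1) L2_scale GL)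
      have h: "has_weak_partial Q0 b (u + cscale (-1) (\<phi> n)) (weak_partial Q0 b u + cscale (-1) (?G n))"
        by (intro has_weak_partial_add[OF B.measurable_Q b] has_weak_partial_scale wu sw
            B.W21_L2[OF uW] L2_scale B.W21_L2[OF \<phi>W] GL)
      have e: "u + cscale (-1) (\<phi> n) = u - \<phi> n" "weak_partial Q0 b u + cscale (-1) (?G n) = weak_partial Q0 b u - ?G n"
        by (auto simp: fun_eq_iff)
      have "l2_norm Q0 (?G n - weak_partial Q0 b u) = l2_norm Q0 (weak_partial Q0 b u - ?G n)"
        using wu GL by (intro Lsp.nrm_minus_commute)
      also have "\<dots> = l2_norm Q0 (weak_partial Q0 b (u - \<phi> n))"
        using Lsp.nrm_null_cong[OF B.weak_partial(1)[OF m h] m B.weak_partial_null[OF b m h]] unfolding e by simp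
      also have "\<dots> \<le> W21_norm Q0 (u - \<phi> n)"
        by (rule B.l2_norm_le_W21_norm(2)[OF B.W.mem(3)[OF uW \<phi>W] b])
      finally have "l2_norm Q0 (?G n - weak_partial Q0 b u) \<le> W21_norm Q0 (u - \<phi> n)" .
      moreover have "0 \<le> l2_norm Q0 (?G n - weak_partial Q0 b u)"
        using wu GL by (intro Lsp.nrm_nonneg Lsp.mem(3))
      ultimately show "norm (l2_norm Q0 (?G n - weak_partial Q0 b u)) \<le> W21_norm Q0 (u - \<phi> n)" by simp
    qed
    show "has_weak_partial Q1 b u (weak_partial Q0 b u)"
    proof (rule has_weak_partial_limit[OF A.measurable_Q b, where X=\<phi> and G="?G"])
      show "has_weak_partial Q1 b (\<phi> n) (?G n)" for n
        by (rule smooth_has_weak_partial[OF test_functionsD(1)[OF \<phi>(1)] A.measurable_Q b])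
      show "\<phi> n \<in> L2 Q1" "?G n \<in> L2 Q1" for n using B.W21_L2[OF \<phi>W] GL L2_eq by auto
      show "(\<lambda>n. l2_norm Q1 (\<phi> n - u)) \<longlonglongrightarrow> 0" unfolding l2_norm_eq by (rule lim1)
      show "(\<lambda>n. l2_norm Q1 (?G n - weak_partial Q0 b u)) \<longlonglongrightarrow> 0" unfolding l2_norm_eq by (rule lim2)
    qed (use uL wL in auto)
  qed
  have uW1: "u \<in> W21 Q1" by (rule A.W21_I[OF uL, of "\<lambda>b. weak_partial Q0 b u"]) (use hw wL in auto)
  show "u \<in> W21_zero Q1"
  proof (rule A.W21_zero_I[OF uW1 \<phi>1])
    have "W21_norm Q1 (u - \<phi> n) = W21_norm Q0 (u - \<phi> n)" for n
      using uW1 A.test_function_W21[OF \<phi>1] by (intro W21_norm_eq A.W.mem(3))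
    then show "(\<lambda>n. W21_norm Q1 (u - \<phi> n)) \<longlonglongrightarrow> 0" using \<phi>(2) by simp
  qed
qed

lemma bform_ext:
  assumes "u \<in> W21 Q1" "v \<in> W21 Q1"
  shows "B.bform u v = A.bform u v"
proof -
  have "A.vmul u = B.vmul u" by (simp add: A.vmul_def B.vmul_def)
  then show ?thesis
    using w_inner_eq[OF assms] by (simp add: A.bform_eq B.bform_eq l2_inner_eq)
qed

lemma form_operator_small: "form_operator cscale (L2 Q1) (l2_inner Q1) (W21_zero Q0) B.bform"
  unfolding L2_eq l2_inner_eq by (rule B.form_operator_bform)

end

section \<open>Cut-off functions and convergence of resolvents\<close>

text \<open>The crude bound \<open>C\<close> only serves to pass to the limit along test functions;
  the constant \<open>A\<close> survives unchanged.\<close>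

lemma (in ae_open) multiplier_bound_extend:
  assumes m: "m \<in> borel_measurable (lebesgue_on Q)" "\<And>x. x \<in> Q \<Longrightarrow> cmod (m x) \<le> C"
    and test: "\<And>\<phi>. \<phi> \<in> test_functions Q \<Longrightarrow> l2_norm Q (\<lambda>x. m x * \<phi> x) \<le> A * W21_norm Q \<phi>"
    and v: "v \<in> W21_zero Q"
  shows "l2_norm Q (\<lambda>x. m x * v x) \<le> A * W21_norm Q v"
proof -
  note vW = W21_zero_W21[OF v]
  obtain \<phi> where \<phi>: "\<And>n. \<phi> n \<in> test_functions Q" "(\<lambda>n. W21_norm Q (v - \<phi> n)) \<longlonglongrightarrow> 0" by (rule W21_zero_D[OF v]) blast
  note \<phi>W = test_function_W21[OF \<phi>(1)]
  have mL: "(\<lambda>x. m x * u x) \<in> L2 Q" if "u \<in> L2 Q" for u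
    by (rule L2_mult[OF that m measurable_Q])
  have "l2_norm Q (\<lambda>x. m x * v x) \<le> \<bar>C\<bar> * W21_norm Q (v - \<phi> n) + A * W21_norm Q (\<phi> n)" for n
  proof -
    have d: "v - \<phi> n \<in> W21 Q" using vW \<phi>W by simp
    have eq: "(\<lambda>x. m x * v x) = (\<lambda>x. m x * (v - \<phi> n) x) + (\<lambda>x. m x * \<phi> n x)"
      by (simp add: fun_eq_iff algebra_simps)
    have "l2_norm Q (\<lambda>x. m x * v x) \<le> l2_norm Q (\<lambda>x. m x * (v - \<phi> n) x) + l2_norm Q (\<lambda>x. m x * \<phi> n x)"
      unfolding eq by (rule Lsp.nrm_triangle) (intro mL W21_L2 d \<phi>W)+
    moreover have "l2_norm Q (\<lambda>x. m x * (v - \<phi> n) x) \<le> \<bar>C\<bar> * l2_norm Q (v - \<phi> n)"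
    proof (rule l2_norm_mono_AE[OF W21_L2[OF d] mL[OF W21_L2[OF d]]])
      show "AE x in lebesgue_on Q. cmod (m x * (v - \<phi> n) x) \<le> \<bar>C\<bar> * cmod ((v - \<phi> n) x)"
      proof (rule AE_I2)
        fix x assume "x \<in> space (lebesgue_on Q)"
        then have "cmod (m x) \<le> \<bar>C\<bar>" using m(2)[of x] by (simp add: space_restrict_space)
        then show "cmod (m x * (v - \<phi> n) x) \<le> \<bar>C\<bar> * cmod ((v - \<phi> n) x)"
          unfolding norm_mult by (rule mult_right_mono) simp
      qed
    qed simp
    moreover have "\<bar>C\<bar> * l2_norm Q (v - \<phi> n) \<le> \<bar>C\<bar> * W21_norm Q (v - \<phi> n)"
      by (intro mult_left_mono l2_norm_le_W21_norm d) simp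
    ultimately show ?thesis using test[OF \<phi>(1), of n] by linarith
  qed
  moreover have "(\<lambda>n. \<bar>C\<bar> * W21_norm Q (v - \<phi> n) + A * W21_norm Q (\<phi> n)) \<longlonglongrightarrow> \<bar>C\<bar> * 0 + A * W21_norm Q v"
  proof (intro tendsto_intros \<phi>(2) W.LIMSEQ_nrm \<phi>W vW)
    show "(\<lambda>n. W21_norm Q (\<phi> n - v)) \<longlonglongrightarrow> 0"
      using \<phi>(2) W.nrm_minus_commute[OF vW \<phi>W] by simp
  qed
  ultimately show ?thesis by (intro LIMSEQ_le_const[of _ "A * W21_norm Q v"]) auto
qed

text \<open>\<open>K\<close> may be huge: it enters only through the continuity of multiplication by
  \<open>\<theta>\<close> in W21. The closeness of the resolvents depends on \<open>\<alpha>\<close>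
  alone, whose estimates are required for test functions only.\<close>

locale cutoff = domain_pair Q1 Q0 V B
  for Q1 Q0 :: "'a::euclidean_space set" and V B +
  fixes \<theta> :: "'a \<Rightarrow> real" and K \<alpha> :: real
  assumes \<theta>_smooth: "smooth_on \<theta> UNIV" and \<theta>_range: "0 \<le> \<theta> x" "\<theta> x \<le> 1"
    and \<theta>_deriv: "b \<in> Basis \<Longrightarrow> \<bar>frechet_derivative \<theta> (at x) b\<bar> \<le> K"
    and \<theta>_maps: "\<phi> \<in> test_functions Q1 \<Longrightarrow> (\<lambda>x. of_real (\<theta> x) * \<phi> x) \<in> test_functions Q0"
    and \<alpha>_nonneg: "0 \<le> \<alpha>"
    and \<theta>_small: "\<phi> \<in> test_functions Q1 \<Longrightarrow> l2_norm Q1 (\<lambda>x. of_real (1 - \<theta> x) * \<phi> x) \<le> \<alpha> * W21_norm Q1 \<phi>"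
    and d\<theta>_small: "\<phi> \<in> test_functions Q1 \<Longrightarrow> b \<in> Basis \<Longrightarrow>
      l2_norm Q1 (\<lambda>x. of_real (frechet_derivative \<theta> (at x) b) * \<phi> x) \<le> \<alpha> * W21_norm Q1 \<phi>"
begin

definition M :: "('a \<Rightarrow> complex) \<Rightarrow> 'a \<Rightarrow> complex" where "M v = (\<lambda>x. of_real (\<theta> x) * v x)"

definition d\<theta> :: "'a \<Rightarrow> 'a \<Rightarrow> complex" where "d\<theta> b x = of_real (frechet_derivative \<theta> (at x) b)"

lemma complex_\<theta>:
  shows "smooth_on (\<lambda>x. complex_of_real (\<theta> x)) UNIV"
    and "frechet_derivative (\<lambda>x. complex_of_real (\<theta> x)) (at x) b = d\<theta> b x"
proof -
  show "smooth_on (\<lambda>x. complex_of_real (\<theta> x)) UNIV"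
    using \<theta>_smooth by (simp add: smooth_on_def Ck_on_linear[OF bounded_linear_of_real])
  show "frechet_derivative (\<lambda>x. complex_of_real (\<theta> x)) (at x) b = d\<theta> b x"
  proof -
    have "((\<lambda>x. complex_of_real (\<theta> x)) has_derivative (\<lambda>h. complex_of_real (frechet_derivative \<theta> (at x) h))) (at x)"
      by (rule has_derivative_of_real[OF smooth_has_derivative[OF \<theta>_smooth]])
    from frechet_derivative_at[OF this, symmetric] show ?thesis by (simp add: d\<theta>_def)
  qed
qed

lemma \<theta>_meas: "(\<lambda>x. complex_of_real (\<theta> x)) \<in> borel_measurable (lebesgue_on Q)"
  by (rule continuous_borel_measurable_lebesgue_on[OF smooth_continuous[OF complex_\<theta>(1)]])

lemma d\<theta>_meas: "b \<in> Basis \<Longrightarrow> d\<theta> b \<in> borel_measurable (lebesgue_on Q)"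
  using continuous_borel_measurable_lebesgue_on[OF smooth_continuous[OF smooth_frechet[OF complex_\<theta>(1)]]]
  by (simp add: complex_\<theta>(2)[abs_def])

lemma M_L2: "u \<in> L2 Q1 \<Longrightarrow> M u \<in> L2 Q1"
  unfolding M_def by (rule L2_mult[OF _ \<theta>_meas _ A.measurable_Q, of _ 1]) (use \<theta>_range in auto)

lemma d\<theta>_L2: "b \<in> Basis \<Longrightarrow> u \<in> L2 Q1 \<Longrightarrow> (\<lambda>x. d\<theta> b x * u x) \<in> L2 Q1"
  by (rule L2_mult[OF _ d\<theta>_meas _ A.measurable_Q, of _ _ K]) (use \<theta>_deriv in \<open>auto simp: d\<theta>_def\<close>)

lemma M_weak_partial:
  assumes "u \<in> W21 Q1" "b \<in> Basis"
  shows "has_weak_partial Q1 b (M u) (M (weak_partial Q1 b u) + (\<lambda>x. d\<theta> b x * u x))"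
    "M (weak_partial Q1 b u) + (\<lambda>x. d\<theta> b x * u x) \<in> L2 Q1"
proof -
  note w = A.W21_weak_partial[OF assms] A.W21_L2[OF assms(1)]
  show "has_weak_partial Q1 b (M u) (M (weak_partial Q1 b u) + (\<lambda>x. d\<theta> b x * u x))"
    using has_weak_partial_mult[OF A.measurable_Q assms(2) complex_\<theta>(1) w(2,3,1)]
    by (simp add: M_def complex_\<theta>(2) plus_fun_def)
  show "M (weak_partial Q1 b u) + (\<lambda>x. d\<theta> b x * u x) \<in> L2 Q1"
    using w assms(2) by (intro Lsp.mem(2) M_L2 d\<theta>_L2)
qed

lemma M_W21: "u \<in> W21 Q1 \<Longrightarrow> M u \<in> W21 Q1"
  by (rule A.W21_I[OF M_L2[OF A.W21_L2]], assumption) (blast intro: M_weak_partial)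

lemma M_L2_norm: "u \<in> L2 Q1 \<Longrightarrow> l2_norm Q1 (M u) \<le> l2_norm Q1 u"
  using l2_norm_mono_AE[OF _ M_L2, of u u 1] \<theta>_range
  by (simp add: M_def norm_mult mult_left_le_one_le)

lemma d\<theta>_L2_norm: "b \<in> Basis \<Longrightarrow> u \<in> L2 Q1 \<Longrightarrow> l2_norm Q1 (\<lambda>x. d\<theta> b x * u x) \<le> \<bar>K\<bar> * l2_norm Q1 u"
proof (rule l2_norm_mono_AE[OF _ d\<theta>_L2])
  assume b: "b \<in> Basis"
  show "AE x in lebesgue_on Q1. cmod (d\<theta> b x * u x) \<le> \<bar>K\<bar> * cmod (u x)"
  proof (rule AE_I2)
    fix x
    have "cmod (d\<theta> b x) \<le> \<bar>K\<bar>" using \<theta>_deriv[OF b, of x] by (simp add: d\<theta>_def)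
    then show "cmod (d\<theta> b x * u x) \<le> \<bar>K\<bar> * cmod (u x)"
      unfolding norm_mult by (rule mult_right_mono) simp
  qed
qed auto

lemma M_W21_norm:
  assumes "u \<in> W21 Q1"
  shows "W21_norm Q1 (M u) \<le> (1 + DIM('a) * (1 + \<bar>K\<bar>)) * W21_norm Q1 u"
proof -
  note uL = A.W21_L2[OF assms]
  have "W21_norm Q1 (M u) \<le> l2_norm Q1 (M u) + (\<Sum>b\<in>Basis. l2_norm Q1 (M (weak_partial Q1 b u) + (\<lambda>x. d\<theta> b x * u x)))"
    by (rule A.W21_norm_le[OF M_L2[OF uL]]) (blast intro: M_weak_partial assms)
  also have "\<dots> \<le> W21_norm Q1 u + (\<Sum>b\<in>(Basis::'a set). (1 + \<bar>K\<bar>) * W21_norm Q1 u)"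
  proof (intro add_mono sum_mono)
    show "l2_norm Q1 (M u) \<le> W21_norm Q1 u"
      using M_L2_norm[OF uL] A.l2_norm_le_W21_norm(1)[OF assms] by linarith
    fix b :: 'a assume b: "b \<in> Basis"
    note wL = A.W21_weak_partial(1)[OF assms b]
    have "l2_norm Q1 (M (weak_partial Q1 b u) + (\<lambda>x. d\<theta> b x * u x))
        \<le> l2_norm Q1 (M (weak_partial Q1 b u)) + l2_norm Q1 (\<lambda>x. d\<theta> b x * u x)"
      by (rule Lsp.nrm_triangle[OF M_L2[OF wL] d\<theta>_L2[OF b uL]])
    moreover have "\<bar>K\<bar> * l2_norm Q1 u \<le> \<bar>K\<bar> * W21_norm Q1 u"
      by (intro mult_left_mono A.l2_norm_le_W21_norm assms) simp
    ultimately show "l2_norm Q1 (M (weak_partial Q1 b u) + (\<lambda>x. d\<theta> b x * u x)) \<le> (1 + \<bar>K\<bar>) * W21_norm Q1 u"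
      using M_L2_norm[OF wL] A.l2_norm_le_W21_norm(2)[OF assms b] d\<theta>_L2_norm[OF b uL]
      by (simp add: distrib_right)
  qed
  finally show ?thesis by (simp add: algebra_simps)
qed

lemma M_W21_zero:
  assumes v: "v \<in> W21_zero Q1" shows "M v \<in> W21_zero Q0"
proof -
  note vW = A.W21_zero_W21[OF v]
  obtain \<phi> where \<phi>: "\<And>n. \<phi> n \<in> test_functions Q1" "(\<lambda>n. W21_norm Q1 (v - \<phi> n)) \<longlonglongrightarrow> 0" by (rule A.W21_zero_D[OF v]) blast
  note \<phi>W = A.test_function_W21[OF \<phi>(1)]
  show ?thesis
  proof (rule B.W21_zero_I[where \<phi>="\<lambda>n. M (\<phi> n)"])
    show "M v \<in> W21 Q0" by (rule W21_restrict(1)[OF M_W21[OF vW]])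
    show "M (\<phi> n) \<in> test_functions Q0" for n unfolding M_def by (rule \<theta>_maps[OF \<phi>(1)])
    show "(\<lambda>n. W21_norm Q0 (M v - M (\<phi> n))) \<longlonglongrightarrow> 0"
    proof (rule Lim_null_comparison)
      show "(\<lambda>n. (1 + DIM('a) * (1 + \<bar>K\<bar>)) * W21_norm Q1 (v - \<phi> n)) \<longlonglongrightarrow> 0"
        by (rule tendsto_mult_right_zero[OF \<phi>(2)])
      show "\<forall>\<^sub>F n in sequentially. norm (W21_norm Q0 (M v - M (\<phi> n))) \<le> (1 + DIM('a) * (1 + \<bar>K\<bar>)) * W21_norm Q1 (v - \<phi> n)"
      proof (intro always_eventually allI)
        fix n
        have d: "v - \<phi> n \<in> W21 Q1" using vW \<phi>W by simp
        have e: "M v - M (\<phi> n) = M (v - \<phi> n)" by (simp add: M_def fun_eq_iff right_diff_distrib)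
        show "norm (W21_norm Q0 (M v - M (\<phi> n))) \<le> (1 + DIM('a) * (1 + \<bar>K\<bar>)) * W21_norm Q1 (v - \<phi> n)"
          using M_W21_norm[OF d] A.W.nrm_nonneg[OF M_W21[OF d]] W21_norm_eq[OF M_W21[OF d]] unfolding e by simp
      qed
    qed
  qed
qed

lemma small_extend:
  assumes v: "v \<in> W21_zero Q1"
  shows "l2_norm Q1 (v - M v) \<le> \<alpha> * W21_norm Q1 v"
    and "b \<in> Basis \<Longrightarrow> l2_norm Q1 (\<lambda>x. d\<theta> b x * v x) \<le> \<alpha> * W21_norm Q1 v"
proof -
  have "v - M v = (\<lambda>x. complex_of_real (1 - \<theta> x) * v x)" by (simp add: fun_eq_iff M_def algebra_simps)
  moreover have "l2_norm Q1 (\<lambda>x. complex_of_real (1 - \<theta> x) * v x) \<le> \<alpha> * W21_norm Q1 v"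
  proof (rule A.multiplier_bound_extend[OF _ _ \<theta>_small v])
    show "(\<lambda>x. complex_of_real (1 - \<theta> x)) \<in> borel_measurable (lebesgue_on Q1)"
      using borel_measurable_diff[OF borel_measurable_const \<theta>_meas, of 1] by simp
    show "cmod (complex_of_real (1 - \<theta> x)) \<le> 1" for x
      unfolding norm_of_real using \<theta>_range[of x] by simp
  qed
  ultimately show "l2_norm Q1 (v - M v) \<le> \<alpha> * W21_norm Q1 v" by simp
  show "l2_norm Q1 (\<lambda>x. d\<theta> b x * v x) \<le> \<alpha> * W21_norm Q1 v" if b: "b \<in> Basis"
  proof (rule A.multiplier_bound_extend[OF d\<theta>_meas[OF b] _ _ v])
    show "cmod (d\<theta> b x) \<le> K" for x using \<theta>_deriv[OF b] by (simp add: d\<theta>_def)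
    show "l2_norm Q1 (\<lambda>x. d\<theta> b x * \<phi> x) \<le> \<alpha> * W21_norm Q1 \<phi>" if "\<phi> \<in> test_functions Q1" for \<phi>
      using d\<theta>_small[OF that b] by (simp add: d\<theta>_def)
  qed
qed

text \<open>The terms with \<open>\<theta>\<close> times two derivatives cancel, and so do the
  potential terms. What remains for each basis vector are two products of a derivative with a
  function multiplied by a derivative of \<open>\<theta>\<close>.\<close>

lemma commutator:
  assumes u: "u \<in> W21_zero Q1" and v: "v \<in> W21_zero Q1"
  shows "cmod (A.bform u (M v) - A.bform (M u) v) \<le> 2 * DIM('a) * \<alpha> * (W21_norm Q1 u * W21_norm Q1 v)"
proof -
  note W = A.W21_zero_W21[OF u] A.W21_zero_W21[OF v]
  note L = A.W21_L2[OF W(1)] A.W21_L2[OF W(2)]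
  have sym: "l2_inner Q1 (M x) y = l2_inner Q1 x (M y)" for x y
    by (simp add: l2_inner_def M_def mult_ac)
  have pot: "l2_inner Q1 (A.vmul u) (M v) = l2_inner Q1 (A.vmul (M u)) v"
    by (simp add: l2_inner_def M_def A.vmul_def mult_ac)
  have part: "cmod (l2_inner Q1 (weak_partial Q1 b u) (weak_partial Q1 b (M v)) - l2_inner Q1 (weak_partial Q1 b (M u)) (weak_partial Q1 b v))
      \<le> 2 * \<alpha> * (W21_norm Q1 u * W21_norm Q1 v)" if b: "b \<in> Basis" for b
  proof -
    note wu = A.W21_weak_partial(1)[OF W(1) b] and wv = A.W21_weak_partial(1)[OF W(2) b]
    note du = d\<theta>_L2[OF b L(1)] and dv = d\<theta>_L2[OF b L(2)]
    note Mu = M_weak_partial[OF W(1) b] and Mv = M_weak_partial[OF W(2) b]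
    have 1: "l2_inner Q1 (weak_partial Q1 b u) (weak_partial Q1 b (M v))
        = l2_inner Q1 (weak_partial Q1 b u) (M (weak_partial Q1 b v)) + l2_inner Q1 (weak_partial Q1 b u) (\<lambda>x. d\<theta> b x * v x)"
      using Lsp.ip_null_cong(2)[OF A.weak_partial(1)[OF Mv(2,1)] Mv(2) wu A.weak_partial_null[OF b Mv(2,1)]]
        Lsp.ip_add_right[OF M_L2[OF wv] dv wu] by simp
    have 2: "l2_inner Q1 (weak_partial Q1 b (M u)) (weak_partial Q1 b v)
        = l2_inner Q1 (M (weak_partial Q1 b u)) (weak_partial Q1 b v) + l2_inner Q1 (\<lambda>x. d\<theta> b x * u x) (weak_partial Q1 b v)"
      using Lsp.ip_null_cong(1)[OF A.weak_partial(1)[OF Mu(2,1)] Mu(2) wv A.weak_partial_null[OF b Mu(2,1)]]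
        Lsp.ip_add_left[OF M_L2[OF wu] du wv] by simp
    have "cmod (l2_inner Q1 (weak_partial Q1 b u) (\<lambda>x. d\<theta> b x * v x)) \<le> l2_norm Q1 (weak_partial Q1 b u) * l2_norm Q1 (\<lambda>x. d\<theta> b x * v x)"
      by (rule Lsp.Cauchy_Schwarz[OF wu dv])
    also have "\<dots> \<le> W21_norm Q1 u * (\<alpha> * W21_norm Q1 v)"
      by (intro mult_mono A.l2_norm_le_W21_norm(2)[OF W(1) b] small_extend(2)[OF v b] A.W.nrm_nonneg[OF W(1)] Lsp.nrm_nonneg[OF dv])
    finally have 3: "cmod (l2_inner Q1 (weak_partial Q1 b u) (\<lambda>x. d\<theta> b x * v x)) \<le> \<alpha> * (W21_norm Q1 u * W21_norm Q1 v)"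
      by (simp add: mult_ac)
    have "cmod (l2_inner Q1 (\<lambda>x. d\<theta> b x * u x) (weak_partial Q1 b v)) \<le> l2_norm Q1 (\<lambda>x. d\<theta> b x * u x) * l2_norm Q1 (weak_partial Q1 b v)"
      by (rule Lsp.Cauchy_Schwarz[OF du wv])
    also have "\<dots> \<le> (\<alpha> * W21_norm Q1 u) * W21_norm Q1 v"
      using A.W.nrm_nonneg[OF W(1)] \<alpha>_nonneg
      by (intro mult_mono A.l2_norm_le_W21_norm(2)[OF W(2) b] small_extend(2)[OF u b] Lsp.nrm_nonneg[OF wv]) simp
    finally have 4: "cmod (l2_inner Q1 (\<lambda>x. d\<theta> b x * u x) (weak_partial Q1 b v)) \<le> \<alpha> * (W21_norm Q1 u * W21_norm Q1 v)"
      by (simp add: mult_ac)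
    show ?thesis
      unfolding 1 2 sym
      using norm_triangle_ineq4[of "l2_inner Q1 (weak_partial Q1 b u) (\<lambda>x. d\<theta> b x * v x)" "l2_inner Q1 (\<lambda>x. d\<theta> b x * u x) (weak_partial Q1 b v)"] 3 4
      by simp
  qed
  have "A.bform u (M v) - A.bform (M u) v =
      (\<Sum>b\<in>Basis. l2_inner Q1 (weak_partial Q1 b u) (weak_partial Q1 b (M v)) - l2_inner Q1 (weak_partial Q1 b (M u)) (weak_partial Q1 b v))"
    unfolding A.bform_eq w_inner_def sym pot by (simp add: sum_subtractf)
  also have "cmod \<dots> \<le> (\<Sum>b\<in>(Basis::'a set). 2 * \<alpha> * (W21_norm Q1 u * W21_norm Q1 v))"
    by (rule sum_norm_le) (rule part)
  finally show ?thesis by simp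
qed

text \<open>The constant is three times the \<eta> of \<open>resolvents_close\<close>; the choice
  \<eta> = 2 DIM \<alpha> comes from \<open>commutator\<close> and also covers the bound \<alpha>
  for \<open>v - M v\<close>.\<close>

lemma form_pair: "form_pair cscale (L2 Q1) (l2_inner Q1) (W21_zero Q1) A.bform (W21_zero Q0) B.bform (6 * DIM('a) * \<alpha>)"
proof -
  interpret FB: form_operator cscale "L2 Q1" "l2_inner Q1" "W21_zero Q0" B.bform by (rule form_operator_small)
  define \<eta> where "\<eta> = 2 * DIM('a) * \<alpha>"
  have \<eta>: "0 \<le> \<eta>" "\<alpha> \<le> \<eta>"
  proof -
    have "1 \<le> real DIM('a)" using DIM_positive[where 'a='a] by linarith
    then have "1 * \<alpha> \<le> (2 * DIM('a)) * \<alpha>" using \<open>1 \<le> real DIM('a)\<close> \<alpha>_nonneg by (intro mult_right_mono) linarith+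
    then show "0 \<le> \<eta>" "\<alpha> \<le> \<eta>" using \<alpha>_nonneg by (simp_all add: \<eta>_def)
  qed
  show ?thesis
  proof
    fix u f v
    assume uf: "A.Op.gr u f" and vf: "FB.gr v f"
    have "semi_inner.nrm (l2_inner Q1) (u - v) \<le> 3 * \<eta> * semi_inner.nrm (l2_inner Q1) f"
    proof (rule resolvents_close[OF A.form_operator_bform FB.form_operator_axioms W21_zero_sub _ M_W21_zero _ _ \<eta>(1) uf vf])
      show "B.bform x y = A.bform x y" if "x \<in> W21_zero Q0" "y \<in> W21_zero Q0" for x y
        using that W21_zero_sub by (intro bform_ext A.W21_zero_W21) auto
      show "semi_inner.nrm (l2_inner Q1) (x - M x) \<le> \<eta> * A.Op.F.nrm x" if "x \<in> W21_zero Q1" for x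
      proof -
        note xW = A.W21_zero_W21[OF that]
        have "l2_norm Q1 (x - M x) \<le> \<alpha> * W21_norm Q1 x" by (rule small_extend(1)[OF that])
        also have "\<dots> \<le> \<eta> * A.Op.F.nrm x"
          by (intro mult_mono \<eta> A.nrm_bform_bounds(1)[OF xW] A.W.nrm_nonneg[OF xW])
        finally show ?thesis unfolding nrm_l2_inner .
      qed
      show "cmod (A.bform x (M y) - A.bform (M x) y) \<le> \<eta> * (A.Op.F.nrm x * A.Op.F.nrm y)"
        if "x \<in> W21_zero Q1" "y \<in> W21_zero Q1" for x y
      proof -
        note W = A.W21_zero_W21[OF that(1)] A.W21_zero_W21[OF that(2)]
        have "cmod (A.bform x (M y) - A.bform (M x) y) \<le> \<eta> * (W21_norm Q1 x * W21_norm Q1 y)"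
          using commutator[OF that] by (simp add: \<eta>_def)
        also have "\<dots> \<le> \<eta> * (A.Op.F.nrm x * A.Op.F.nrm y)"
          by (intro mult_left_mono mult_mono \<eta> A.nrm_bform_bounds(1) W A.W.nrm_nonneg A.Op.F.nrm_nonneg that)
        finally show ?thesis .
      qed
    qed
    then show "semi_inner.nrm (l2_inner Q1) (u - v) \<le> 6 * DIM('a) * \<alpha> * semi_inner.nrm (l2_inner Q1) f" by (simp add: \<eta>_def mult_ac)
  qed
qed

end

section \<open>A Hardy inequality near the gates\<close>

text \<open>A periodic substitute for the distance from \<open>t\<close> to the multiples of
  \<open>d\<close>. The factor \<open>d / pi\<close> makes its slope 1 in modulus next to the walls;
  elsewhere the slope is at most 1.\<close>

definition wall_dist :: "real \<Rightarrow> real \<Rightarrow> real" where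
  "wall_dist d t = d / pi * \<bar>sin (pi * t / d)\<bar>"

definition grad_sq :: "(real \<times> real \<Rightarrow> complex) \<Rightarrow> real \<times> real \<Rightarrow> real" where
  "grad_sq \<phi> x = (cmod (frechet_derivative \<phi> (at x) (1, 0)))\<^sup>2 + (cmod (frechet_derivative \<phi> (at x) (0, 1)))\<^sup>2"

lemma wall_dist_nonneg: "0 < d \<Longrightarrow> 0 \<le> wall_dist d t"
  by (simp add: wall_dist_def)

lemma wall_dist_continuous: "0 < d \<Longrightarrow> continuous_on S (wall_dist d)"
  unfolding wall_dist_def by (intro continuous_intros) auto

lemma sin_zero_wall: "sin (pi * t / d) = 0 \<Longrightarrow> 0 < d \<Longrightarrow> \<exists>k::int. t = of_int k * d"
proof -
  assume d: "0 < d" and "sin (pi * t / d) = 0"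
  then obtain k :: int where "pi * t / d = of_int k * pi" using sin_zero_iff_int2 by blast
  then have "t = of_int k * d" using d by (simp add: field_simps)
  then show ?thesis by blast
qed

text \<open>The walls are the exceptional points for the fundamental theorem of calculus in
  \<open>Hardy_path\<close>, as \<open>wall_dist\<close> has kinks there.\<close>

lemma finite_walls: assumes "0 < d" shows "finite {t \<in> {-N..N}. sin (pi * t / d) = 0}"
proof (rule finite_subset)
  show "{t \<in> {-N..N}. sin (pi * t / d) = 0} \<subseteq> (\<lambda>k::int. of_int k * d) ` {\<lfloor>- N / d\<rfloor>..\<lceil>N / d\<rceil>}"
  proof
    fix t assume t: "t \<in> {t \<in> {-N..N}. sin (pi * t / d) = 0}"
    then obtain k :: int where k: "t = of_int k * d" using sin_zero_wall assms by blast
    then have "- N / d \<le> of_int k" "of_int k \<le> N / d" using t assms by (auto simp: field_simps)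
    then have "k \<in> {\<lfloor>- N / d\<rfloor>..\<lceil>N / d\<rceil>}" by (simp add: floor_le_iff le_ceiling_iff)
    then show "t \<in> (\<lambda>k::int. of_int k * d) ` {\<lfloor>- N / d\<rfloor>..\<lceil>N / d\<rceil>}" using k by blast
  qed
qed simp

lemma smooth_grad_sq_continuous: assumes "smooth_on \<phi> UNIV" shows "continuous_on UNIV (grad_sq \<phi>)"
proof -
  have "(1, 0) \<in> (Basis :: (real \<times> real) set)" "(0, 1) \<in> (Basis :: (real \<times> real) set)" by (auto simp: Basis_prod_def)
  then show ?thesis
    unfolding grad_sq_def by (intro continuous_intros smooth_continuous[OF smooth_frechet[OF assms]])
qed

lemma cmod_derivative_direction:
  assumes "smooth_on \<phi> UNIV" "\<bar>h\<bar> \<le> 1" "\<bar>k\<bar> \<le> 1"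
  shows "(cmod (frechet_derivative \<phi> (at x) (h, k)))\<^sup>2 \<le> 2 * grad_sq \<phi> x"
proof -
  let ?D = "frechet_derivative \<phi> (at x)"
  have l: "linear ?D" using has_derivative_linear[OF smooth_has_derivative[OF assms(1)]] .
  have "?D (h, k) = ?D (h *\<^sub>R (1, 0) + k *\<^sub>R (0, 1))" by simp
  also have "\<dots> = h *\<^sub>R ?D (1, 0) + k *\<^sub>R ?D (0, 1)" by (simp only: linear_add[OF l] linear_scale[OF l])
  finally have "cmod (?D (h, k)) \<le> \<bar>h\<bar> * cmod (?D (1, 0)) + \<bar>k\<bar> * cmod (?D (0, 1))"
    using norm_triangle_ineq[of "h *\<^sub>R ?D (1, 0)" "k *\<^sub>R ?D (0, 1)"] by simp
  also have "\<dots> \<le> 1 * cmod (?D (1, 0)) + 1 * cmod (?D (0, 1))"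
    using assms(2,3) by (intro add_mono mult_right_mono) auto
  finally have "(cmod (?D (h, k)))\<^sup>2 \<le> (cmod (?D (1, 0)) + cmod (?D (0, 1)))\<^sup>2"
    by (intro power_mono) auto
  also have "\<dots> \<le> 2 * grad_sq \<phi> x"
    using sum_squares_bound[of "cmod (?D (1, 0))" "cmod (?D (0, 1))"] by (simp add: grad_sq_def power2_sum)
  finally show ?thesis .
qed

text \<open>Along the path \<open>t \<mapsto> (t, s (y - wall_dist d t))\<close>, which meets all walls outside the gates, the
  function \<open>F\<close> vanishes at the walls; so \<open>\<bar>F\<bar>\<^sup>2 cos sgn(sin) / (wall_dist d + \<epsilon>)\<close> is continuous, and
  its derivative integrates to zero.\<close>

lemma Hardy_path:
  fixes \<phi> :: "real \<times> real \<Rightarrow> complex"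
  assumes d: "0 < d" and eps: "0 < \<epsilon>" and \<phi>: "smooth_on \<phi> UNIV" and N: "\<And>x. N \<le> \<bar>fst x\<bar> \<Longrightarrow> \<phi> x = 0" "0 < N"
    and wall: "\<And>(k::int) y. \<epsilon> \<le> \<bar>y\<bar> \<Longrightarrow> \<phi> (of_int k * d, y) = 0"
    and s: "\<bar>s\<bar> = 1" and y: "\<epsilon> \<le> y"
  shows "(\<integral>\<^sup>+t. ennreal ((cmod (\<phi> (t, s * (y - wall_dist d t))))\<^sup>2 / (wall_dist d t + \<epsilon>)\<^sup>2) \<partial>lborel)
    \<le> 8 * (\<integral>\<^sup>+t. ennreal (grad_sq \<phi> (t, s * (y - wall_dist d t))) \<partial>lborel)"
proof -
  define q where "q = wall_dist d"
  have q0: "0 \<le> q t" for t using d by (simp add: q_def wall_dist_nonneg)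
  have cq: "continuous_on S q" for S using d by (simp add: q_def wall_dist_continuous)
  define F where "F t = \<phi> (t, s * (y - q t))" for t
  have cF: "continuous_on S F" for S
    unfolding F_def by (intro continuous_on_compose2[OF smooth_continuous[OF \<phi>]] continuous_intros cq) auto
  define gr where "gr t = grad_sq \<phi> (t, s * (y - q t))" for t
  have cgr: "continuous_on S gr" for S
    unfolding gr_def by (intro continuous_on_compose2[OF smooth_grad_sq_continuous[OF \<phi>]] continuous_intros cq) auto
  have gr0: "0 \<le> gr t" for t by (simp add: gr_def grad_sq_def)
  define S where "S t = sin (pi * t / d)" for t
  define C where "C t = cos (pi * t / d)" for t
  have SC: "(S t)\<^sup>2 + (C t)\<^sup>2 = 1" for t by (simp add: S_def C_def)
  have Fwall: "F t = 0" if S0: "S t = 0" for t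
  proof -
    obtain k :: int where k: "t = of_int k * d" using sin_zero_wall[of t d] S0 d by (auto simp: S_def)
    have "q t = 0" using S0 by (simp add: q_def wall_dist_def S_def)
    then show ?thesis using wall[of "s * y" k] y s eps by (simp add: F_def k abs_mult)
  qed
  define w where "w t = 1 / (q t + \<epsilon>)" for t
  have w0: "0 < w t" and wq: "w t * (q t + \<epsilon>) = 1" for t
    using q0[of t] eps by (auto simp: w_def add_nonneg_pos)
  have cw: "continuous_on S w" for S
    unfolding w_def using q0 eps by (intro continuous_intros cq) (smt (verit))
  define G where "G t = (cmod (F t))\<^sup>2 * (sgn (S t) * C t * w t)" for t
  define G' where "G' t = (if S t = 0 then 0 else
      2 * (F t \<bullet> frechet_derivative \<phi> (at (t, s * (y - q t))) (1, - (s * (sgn (S t) * C t)))) * (sgn (S t) * C t * w t)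
      - (cmod (F t))\<^sup>2 * (w t * (pi / d * \<bar>S t\<bar> + (C t)\<^sup>2 * w t)))" for t
  have Gder: "(G has_vector_derivative G' t) (at t)" if S0: "S t \<noteq> 0" for t
  proof -
    \<comment> \<open>Near \<open>t\<close> the sine keeps its sign, so \<open>wall_dist\<close> can
      be differentiated there with a fixed sign \<sigma>.\<close>
    define \<sigma> where "\<sigma> = sgn (S t)"
    have \<sigma>: "\<sigma> * \<sigma> = 1" using S0 by (simp add: \<sigma>_def sgn_if)
    have ev: "open {u. 0 < \<sigma> * S u}" unfolding S_def by (intro open_Collect_less continuous_intros) (use d in auto)
    have tin: "0 < \<sigma> * S t" using S0 by (simp add: \<sigma>_def sgn_if mult_less_0_iff)
    have loc: "sgn (S u) = \<sigma>" "\<bar>S u\<bar> = \<sigma> * S u" if "0 < \<sigma> * S u" for u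
      using that S0 by (auto simp: \<sigma>_def sgn_if split: if_splits)
    define qq where "qq u = d / pi * (\<sigma> * S u)" for u
    have qqe: "q u = qq u" if "0 < \<sigma> * S u" for u using loc(2)[OF that] by (simp add: q_def wall_dist_def qq_def S_def)
    have dS: "(S has_real_derivative C t * (pi / d)) (at t)" and dC: "(C has_real_derivative - S t * (pi / d)) (at t)"
      unfolding S_def C_def using d by (auto intro!: derivative_eq_intros)
    have dqq: "(qq has_real_derivative \<sigma> * C t) (at t)"
      unfolding qq_def using d by (auto intro!: derivative_eq_intros dS)
    have q_pos: "0 < qq t + \<epsilon>" using qqe[OF tin] q0[of t] eps by simp
    define FF where "FF u = \<phi> (u, s * (y - qq u))" for u
    define F' where "F' = frechet_derivative \<phi> (at (t, s * (y - qq t))) (1, - (s * (\<sigma> * C t)))"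
    have dFF: "(FF has_vector_derivative F') (at t)"
    proof -
      have p: "((\<lambda>u. (u, s * (y - qq u))) has_derivative (\<lambda>h. (h, - (s * (\<sigma> * C t * h))))) (at t)"
        using dqq unfolding has_field_derivative_def by (auto intro!: derivative_eq_intros)
      note D = smooth_has_derivative[OF \<phi>, of "(t, s * (y - qq t))"]
      have "(FF has_derivative (\<lambda>h. frechet_derivative \<phi> (at (t, s * (y - qq t))) (h, - (s * (\<sigma> * C t * h))))) (at t)"
        unfolding FF_def by (rule has_derivative_compose[OF p D])
      moreover have "frechet_derivative \<phi> (at (t, s * (y - qq t))) (h, - (s * (\<sigma> * C t * h))) = h *\<^sub>R F'" for h
        unfolding F'_def using linear_scale[OF has_derivative_linear[OF D], of h "(1, - (s * (\<sigma> * C t)))"]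
        by (simp add: mult_ac)
      ultimately show ?thesis by (simp add: has_vector_derivative_def)
    qed
    have dN: "((\<lambda>u. (cmod (FF u))\<^sup>2) has_real_derivative 2 * (FF t \<bullet> F')) (at t)"
    proof -
      have "((\<lambda>u. FF u \<bullet> FF u) has_derivative (\<lambda>h. FF t \<bullet> (h *\<^sub>R F') + (h *\<^sub>R F') \<bullet> FF t)) (at t)"
        using dFF unfolding has_vector_derivative_def by (intro has_derivative_inner)
      moreover have "(\<lambda>h. FF t \<bullet> (h *\<^sub>R F') + (h *\<^sub>R F') \<bullet> FF t) = (*) (2 * (FF t \<bullet> F'))"
        by (auto simp: fun_eq_iff inner_commute algebra_simps)
      ultimately show ?thesis by (simp add: has_field_derivative_def power2_norm_eq_inner)
    qed
    have dc: "((\<lambda>u. \<sigma> * C u * (1 / (qq u + \<epsilon>))) has_real_derivative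
        - (1 / (qq t + \<epsilon>) * (pi / d * (\<sigma> * S t) + (C t)\<^sup>2 * (1 / (qq t + \<epsilon>))))) (at t)"
    proof -
      have 1: "((\<lambda>u. 1 / (qq u + \<epsilon>)) has_real_derivative - (\<sigma> * C t) * (1 / (qq t + \<epsilon>))\<^sup>2) (at t)"
        using q_pos by (auto intro!: derivative_eq_intros dqq simp: power2_eq_square field_simps)
      have 2: "((\<lambda>u. \<sigma> * C u) has_real_derivative \<sigma> * (- S t * (pi / d))) (at t)"
        by (rule DERIV_cmult[OF dC])
      have 3: "\<sigma> * (- S t * (pi / d)) * W + - (\<sigma> * C t) * W\<^sup>2 * (\<sigma> * C t)
          = - (W * (pi / d * (\<sigma> * S t) + (C t)\<^sup>2 * W))" for W
      proof -
        have "- (\<sigma> * C t) * W\<^sup>2 * (\<sigma> * C t) = - ((\<sigma> * \<sigma>) * (C t)\<^sup>2 * W\<^sup>2)" by (simp add: power2_eq_square)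
        then show ?thesis unfolding \<sigma> by (simp add: power2_eq_square algebra_simps)
      qed
      show ?thesis using DERIV_mult[OF 2 1] unfolding 3 .
    qed
    have "((\<lambda>u. (cmod (FF u))\<^sup>2 * (\<sigma> * C u * (1 / (qq u + \<epsilon>)))) has_real_derivative
        2 * (FF t \<bullet> F') * (\<sigma> * C t * (1 / (qq t + \<epsilon>))) +
        - (1 / (qq t + \<epsilon>) * (pi / d * (\<sigma> * S t) + (C t)\<^sup>2 * (1 / (qq t + \<epsilon>)))) * (cmod (FF t))\<^sup>2) (at t)"
      by (rule DERIV_mult[OF dN dc])
    moreover have "2 * (FF t \<bullet> F') * (\<sigma> * C t * (1 / (qq t + \<epsilon>))) +
        - (1 / (qq t + \<epsilon>) * (pi / d * (\<sigma> * S t) + (C t)\<^sup>2 * (1 / (qq t + \<epsilon>)))) * (cmod (FF t))\<^sup>2 = G' t"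
      using S0 unfolding G'_def w_def F_def qqe[OF tin] FF_def F'_def \<sigma>_def[symmetric] loc(2)[OF tin]
      by (simp add: algebra_simps)
    ultimately have "((\<lambda>u. (cmod (FF u))\<^sup>2 * (\<sigma> * C u * (1 / (qq u + \<epsilon>)))) has_real_derivative G' t) (at t)"
      by simp
    then have "(G has_real_derivative G' t) (at t)"
    proof (rule has_field_derivative_transform_within_open[OF _ ev])
      show "(cmod (FF u))\<^sup>2 * (\<sigma> * C u * (1 / (qq u + \<epsilon>))) = G u" if "u \<in> {u. 0 < \<sigma> * S u}" for u
      proof -
        have u: "0 < \<sigma> * S u" using that by simp
        show ?thesis unfolding G_def F_def FF_def w_def qqe[OF u] loc(1)[OF u] ..
      qed
    qed (use tin in simp)
    then show ?thesis by (simp add: has_real_derivative_iff_has_vector_derivative)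
  qed
  have Gcont: "continuous_on {-N..N} G"
  proof (rule continuous_at_imp_continuous_on, rule ballI)
    fix t
    show "isCont G t"
    proof (cases "S t = 0")
      case False
      then show ?thesis using has_vector_derivative_continuous[OF Gder] by blast
    next
      case True
      have "G \<midarrow>t\<rightarrow> 0"
      \<comment> \<open>The sign function jumps at a wall, but \<open>F\<close> vanishes there and
        the remaining factor is at most \<open>1 / \<epsilon>\<close>.\<close>
      proof (rule Lim_null_comparison[of _ "\<lambda>u. (cmod (F u))\<^sup>2 * (1 / \<epsilon>)"])
        have "norm (G u) \<le> (cmod (F u))\<^sup>2 * (1 / \<epsilon>)" for u
        proof -
          have "\<bar>sgn (S u) * C u * w u\<bar> \<le> 1 * 1 * (1 / \<epsilon>)"
            unfolding abs_mult using q0[of u] eps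
            by (intro mult_mono) (auto simp: sgn_if C_def w_def abs_if field_simps)
          then have "(cmod (F u))\<^sup>2 * \<bar>sgn (S u) * C u * w u\<bar> \<le> (cmod (F u))\<^sup>2 * (1 / \<epsilon>)"
            by (intro mult_left_mono) simp_all
          moreover have "norm (G u) = (cmod (F u))\<^sup>2 * \<bar>sgn (S u) * C u * w u\<bar>"
            unfolding G_def real_norm_def abs_mult[of "(cmod (F u))\<^sup>2"] by simp
          ultimately show ?thesis by simp
        qed
        then show "\<forall>\<^sub>F u in at t. norm (G u) \<le> (cmod (F u))\<^sup>2 * (1 / \<epsilon>)" by simp
        have "isCont F t" using cF[of UNIV] by (simp add: continuous_on_eq_continuous_at)
        then have "F \<midarrow>t\<rightarrow> 0" using Fwall[OF True] by (simp add: isCont_def)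
        then have "(\<lambda>u. (cmod (F u))\<^sup>2 * (1 / \<epsilon>)) \<midarrow>t\<rightarrow> (cmod 0)\<^sup>2 * (1 / \<epsilon>)" by (intro tendsto_intros)
        then show "(\<lambda>u. (cmod (F u))\<^sup>2 * (1 / \<epsilon>)) \<midarrow>t\<rightarrow> 0" by simp
      qed
      then show ?thesis using Fwall[OF True] by (simp add: isCont_def G_def)
    qed
  qed
  have Fout: "F t = 0" if "N \<le> \<bar>t\<bar>" for t using N(1)[of "(t, s * (y - q t))"] that by (simp add: F_def)
  have "(G' has_integral (G N - G (- N))) {-N..N}"
    by (rule fundamental_theorem_of_calculus_interior_strong[OF finite_walls[OF d, of N] _ _ Gcont])
       (use N Gder in \<open>auto simp: S_def\<close>)
  moreover have "G N = 0" "G (- N) = 0" using Fout N(2) by (auto simp: G_def)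
  ultimately have int0: "(G' has_integral 0) {-N..N}" by simp
  define H where "H t = (cmod (F t))\<^sup>2 / (q t + \<epsilon>)\<^sup>2" for t
  have Hw: "H t = (cmod (F t))\<^sup>2 * (w t)\<^sup>2" for t by (simp add: H_def w_def power_divide)
  have H0: "0 \<le> H t" for t by (simp add: H_def)
  \<comment> \<open>The derivative of the weight contributes at most \<open>- H\<close>, and Young's
    inequality bounds the cross term by \<open>H / 2 + 4 gr\<close>. As the integral of
    \<open>G'\<close> is zero, this gives the constant 8.\<close>
  have G'le: "G' t \<le> 4 * gr t - H t / 2" for t
  proof (cases "S t = 0")
    case True
    then show ?thesis using Fwall gr0[of t] by (simp add: G'_def H_def)
  next
    case False
    define F' where "F' = frechet_derivative \<phi> (at (t, s * (y - q t))) (1, - (s * (sgn (S t) * C t)))"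
    have cC: "\<bar>C t\<bar> \<le> 1" by (simp add: C_def)
    have F'2: "(cmod F')\<^sup>2 \<le> 2 * gr t"
      unfolding F'_def gr_def using s cC by (intro cmod_derivative_direction[OF \<phi>]) (auto simp: abs_mult sgn_if)
    have "2 * (F t \<bullet> F') * (sgn (S t) * C t * w t) \<le> 2 * (cmod (F t) * cmod F') * (1 * 1 * w t)"
    proof -
      have "\<bar>F t \<bullet> F'\<bar> \<le> cmod (F t) * cmod F'" by (rule Cauchy_Schwarz_ineq2)
      moreover have "\<bar>sgn (S t) * C t * w t\<bar> \<le> 1 * 1 * w t"
        unfolding abs_mult using cC w0[of t] by (intro mult_mono) (auto simp: sgn_if)
      ultimately have "\<bar>F t \<bullet> F'\<bar> * \<bar>sgn (S t) * C t * w t\<bar> \<le> (cmod (F t) * cmod F') * (1 * 1 * w t)"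
        by (intro mult_mono) auto
      then show ?thesis unfolding abs_mult[symmetric] by linarith
    qed
    also have "\<dots> = 2 * ((cmod (F t) * w t / 2) * (2 * cmod F'))" by simp
    also have "\<dots> \<le> 2 * (cmod (F t) * w t / 2)\<^sup>2 + (2 * cmod F')\<^sup>2 / 2"
    proof -
      have "0 \<le> (2 * (cmod (F t) * w t / 2) - 2 * cmod F')\<^sup>2" by simp
      then show ?thesis by (simp add: power2_eq_square algebra_simps)
    qed
    also have "\<dots> = H t / 2 + 2 * (cmod F')\<^sup>2" by (simp add: Hw power2_eq_square)
    finally have 1: "2 * (F t \<bullet> F') * (sgn (S t) * C t * w t) \<le> H t / 2 + 4 * gr t" using F'2 by linarith
    \<comment> \<open>With \<open>S^2 + C^2 = 1\<close> this shows that the derivative of the weight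
      is at most \<open>- w^2\<close>: the sine term makes up for the decay of the cosine between
      the walls.\<close>
    have "pi / d * \<bar>S t\<bar> * q t = \<bar>S t\<bar>\<^sup>2" using d by (simp add: q_def wall_dist_def S_def power2_eq_square)
    then have "1 = pi / d * \<bar>S t\<bar> * q t + (C t)\<^sup>2" using SC[of t] by simp
    also have "\<dots> \<le> pi / d * \<bar>S t\<bar> * (q t + \<epsilon>) + (C t)\<^sup>2" using d eps by (simp add: distrib_left)
    finally have "(w t)\<^sup>2 * 1 \<le> (w t)\<^sup>2 * (pi / d * \<bar>S t\<bar> * (q t + \<epsilon>) + (C t)\<^sup>2)" by (intro mult_left_mono) auto
    also have "\<dots> = w t * (pi / d * \<bar>S t\<bar> * (w t * (q t + \<epsilon>)) + (C t)\<^sup>2 * w t)"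
    proof -
      have "(w t)\<^sup>2 * (A * (q t + \<epsilon>) + (C t)\<^sup>2) = w t * (A * (w t * (q t + \<epsilon>)) + (C t)\<^sup>2 * w t)" for A
        by (simp add: power2_eq_square algebra_simps)
      then show ?thesis .
    qed
    finally have "(w t)\<^sup>2 \<le> w t * (pi / d * \<bar>S t\<bar> + (C t)\<^sup>2 * w t)" by (simp add: wq)
    then have "H t \<le> (cmod (F t))\<^sup>2 * (w t * (pi / d * \<bar>S t\<bar> + (C t)\<^sup>2 * w t))"
      unfolding Hw by (rule mult_left_mono) simp
    then show ?thesis using 1 False by (simp add: G'_def F'_def)
  qed
  have cH: "continuous_on A H" for A
    unfolding Hw by (intro continuous_intros cF cw)
  have iH: "(H has_integral integral {-N..N} H) {-N..N}" and iG: "(gr has_integral integral {-N..N} gr) {-N..N}"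
    using integrable_continuous_real[OF cH] integrable_continuous_real[OF cgr] by (auto intro: integrable_integral)
  have "((\<lambda>t. 4 * gr t - H t / 2) has_integral (4 * integral {-N..N} gr - integral {-N..N} H / 2)) {-N..N}"
    using has_integral_diff[OF has_integral_mult_right[OF iG, of 4] has_integral_mult_right[OF iH, of "1/2"]] by simp
  from has_integral_le[OF int0 this] G'le have le: "integral {-N..N} H \<le> 8 * integral {-N..N} gr" by simp
  have "(\<integral>\<^sup>+t. ennreal (H t) \<partial>lborel) = (\<integral>\<^sup>+t. ennreal (H t) * indicator {-N..N} t \<partial>lborel)"
    using Fout by (intro nn_integral_cong) (auto simp: indicator_def H_def)
  also have "\<dots> = ennreal (integral {-N..N} H)" by (rule nn_integral_has_integral_lebesgue'[OF H0 iH])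
  also have "\<dots> \<le> ennreal (8 * integral {-N..N} gr)" using le by (rule ennreal_leI)
  also have "\<dots> = 8 * ennreal (integral {-N..N} gr)"
    using integral_nonneg[OF integrable_continuous_real[OF cgr], of "-N" N] gr0 by (simp add: ennreal_mult)
  also have "ennreal (integral {-N..N} gr) = (\<integral>\<^sup>+t. ennreal (gr t) * indicator {-N..N} t \<partial>lborel)"
    by (rule nn_integral_has_integral_lebesgue'[OF gr0 iG, symmetric])
  also have "8 * \<dots> \<le> 8 * (\<integral>\<^sup>+t. ennreal (gr t) \<partial>lborel)"
    by (intro mult_left_mono nn_integral_mono) (auto simp: indicator_def)
  finally show ?thesis by (simp add: H_def F_def gr_def q_def)
qed

text \<open>For fixed \<open>t\<close> the second coordinate is only translated and possibly
  reflected, which preserves the measure. Fubini's theorem then makes the integral along the path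
  the inner one.\<close>

lemma nn_integral_shear:
  fixes f :: "real \<times> real \<Rightarrow> ennreal" and q :: "real \<Rightarrow> real"
  assumes f: "f \<in> borel_measurable borel" and q: "continuous_on UNIV q" and s: "\<bar>s\<bar> = 1"
  shows "(\<integral>\<^sup>+x. f x \<partial>lborel) = (\<integral>\<^sup>+y. (\<integral>\<^sup>+t. f (t, s * (y - q t)) \<partial>lborel) \<partial>lborel)"
proof -
  have [measurable]: "f \<in> borel_measurable (lborel \<Otimes>\<^sub>M lborel)" using f by (simp add: lborel_prod)
  have fs: "(\<lambda>x2. f (t, x2)) \<in> borel_measurable borel" for t
    by (rule measurable_compose[OF borel_measurable_continuous_onI f]) (intro continuous_intros)
  have "(\<lambda>(t, y). f (t, s * (y - q t))) \<in> borel_measurable borel"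
    unfolding case_prod_beta
    by (rule measurable_compose[OF borel_measurable_continuous_onI f])
       (intro continuous_intros continuous_on_compose2[OF q] subset_UNIV)
  then have m: "(\<lambda>(t, y). f (t, s * (y - q t))) \<in> borel_measurable (lborel \<Otimes>\<^sub>M lborel)" by (simp add: lborel_prod)
  have "(\<integral>\<^sup>+x. f x \<partial>lborel) = (\<integral>\<^sup>+t. \<integral>\<^sup>+x2. f (t, x2) \<partial>lborel \<partial>lborel)"
    by (subst lborel_prod[symmetric], subst lborel.nn_integral_fst) simp_all
  also have "\<dots> = (\<integral>\<^sup>+t. \<integral>\<^sup>+y. f (t, s * (y - q t)) \<partial>lborel \<partial>lborel)"
  proof (rule nn_integral_cong)
    fix t
    have "(\<integral>\<^sup>+x2. f (t, x2) \<partial>lborel) = \<bar>s\<bar> * (\<integral>\<^sup>+y. f (t, - s * q t + s * y) \<partial>lborel)"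
      by (rule nn_integral_real_affine[OF fs]) (use s in auto)
    then show "(\<integral>\<^sup>+x2. f (t, x2) \<partial>lborel) = (\<integral>\<^sup>+y. f (t, s * (y - q t)) \<partial>lborel)"
      using s by (simp add: algebra_simps)
  qed
  also have "\<dots> = (\<integral>\<^sup>+y. (\<integral>\<^sup>+t. f (t, s * (y - q t)) \<partial>lborel) \<partial>lborel)"
    by (rule lborel_pair.Fubini'[OF m, symmetric])
  finally show ?thesis .
qed

text \<open>The paths with parameter \<open>y \<ge> \<epsilon>\<close> sweep out the points where
  \<open>wall_dist\<close> plus \<open>s\<close> times the second coordinate is at least \<epsilon>.
  The signs 1 and -1 together cover the region, which doubles the constant 8.\<close>

lemma Hardy_gates:
  fixes \<phi> :: "real \<times> real \<Rightarrow> complex"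
  assumes d: "0 < d" and eps: "0 < \<epsilon>" and \<phi>: "smooth_on \<phi> UNIV" and N: "\<And>x. N \<le> \<bar>fst x\<bar> \<Longrightarrow> \<phi> x = 0" "0 < N"
    and wall: "\<And>(k::int) y. \<epsilon> \<le> \<bar>y\<bar> \<Longrightarrow> \<phi> (of_int k * d, y) = 0"
  shows "(\<integral>\<^sup>+x. ennreal ((cmod (\<phi> x))\<^sup>2 / (wall_dist d (fst x) + \<epsilon>)\<^sup>2) * indicator {x. \<epsilon> \<le> wall_dist d (fst x) + \<bar>snd x\<bar>} x \<partial>lborel)
    \<le> 16 * (\<integral>\<^sup>+x. ennreal (grad_sq \<phi> x) \<partial>lborel)"
proof -
  let ?q = "wall_dist d"
  define f where "f s x = ennreal ((cmod (\<phi> x))\<^sup>2 / (?q (fst x) + \<epsilon>)\<^sup>2) * indicator {x. \<epsilon> \<le> ?q (fst x) + s * snd x} x" for s x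
  have cq: "continuous_on UNIV ?q" by (rule wall_dist_continuous[OF d])
  have cqf: "continuous_on UNIV (\<lambda>x::real\<times>real. ?q (fst x))"
    by (rule continuous_on_compose2[OF cq]) (auto intro!: continuous_intros)
  have c\<phi>: "continuous_on UNIV (\<lambda>x. (cmod (\<phi> x))\<^sup>2 / (?q (fst x) + \<epsilon>)\<^sup>2)"
    by (intro continuous_intros smooth_continuous[OF \<phi>] cqf)
       (use wall_dist_nonneg[OF d] eps in \<open>auto simp: add_nonneg_eq_0_iff\<close>)
  have fm: "f s \<in> borel_measurable borel" for s
  proof -
    have "closed {x::real\<times>real. \<epsilon> \<le> ?q (fst x) + s * snd x}"
      by (intro closed_Collect_le continuous_intros cqf)
    then have "{x::real\<times>real. \<epsilon> \<le> ?q (fst x) + s * snd x} \<in> sets borel" by (rule borel_closed)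
    then show ?thesis
      unfolding f_def using borel_measurable_continuous_onI[OF c\<phi>] by measurable
  qed
  have gm: "(\<lambda>x. ennreal (grad_sq \<phi> x)) \<in> borel_measurable borel"
    using borel_measurable_continuous_onI[OF smooth_grad_sq_continuous[OF \<phi>]] by measurable
  have one: "(\<integral>\<^sup>+x. f s x \<partial>lborel) \<le> 8 * (\<integral>\<^sup>+x. ennreal (grad_sq \<phi> x) \<partial>lborel)" if s: "\<bar>s\<bar> = 1" for s
  proof -
    have ss: "s * s = 1" using s by (auto simp: abs_if split: if_splits)
    have "(\<integral>\<^sup>+x. f s x \<partial>lborel) = (\<integral>\<^sup>+y. (\<integral>\<^sup>+t. f s (t, s * (y - ?q t)) \<partial>lborel) \<partial>lborel)"
      by (rule nn_integral_shear[OF fm cq s])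
    also have "\<dots> \<le> (\<integral>\<^sup>+y. 8 * (\<integral>\<^sup>+t. ennreal (grad_sq \<phi> (t, s * (y - ?q t))) \<partial>lborel) \<partial>lborel)"
    proof (rule nn_integral_mono)
      fix y
      have in_iff: "\<epsilon> \<le> ?q t + s * (s * (y - ?q t)) \<longleftrightarrow> \<epsilon> \<le> y" for t
        using ss by (simp add: mult.assoc[symmetric])
      show "(\<integral>\<^sup>+t. f s (t, s * (y - ?q t)) \<partial>lborel) \<le> 8 * (\<integral>\<^sup>+t. ennreal (grad_sq \<phi> (t, s * (y - ?q t))) \<partial>lborel)"
      proof (cases "\<epsilon> \<le> y")
        case True
        have "f s (t, s * (y - ?q t)) = ennreal ((cmod (\<phi> (t, s * (y - ?q t))))\<^sup>2 / (?q t + \<epsilon>)\<^sup>2)" for t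
          using True in_iff[of t] by (simp add: f_def)
        then show ?thesis using Hardy_path[OF d eps \<phi> N wall s True] by simp
      next
        case False
        have "f s (t, s * (y - ?q t)) = 0" for t
          using False in_iff[of t] by (simp add: f_def)
        then show ?thesis by simp
      qed
    qed
    also have "\<dots> = 8 * (\<integral>\<^sup>+y. (\<integral>\<^sup>+t. ennreal (grad_sq \<phi> (t, s * (y - ?q t))) \<partial>lborel) \<partial>lborel)"
    proof (rule nn_integral_cmult)
      have "(\<lambda>(y, t). ennreal (grad_sq \<phi> (t, s * (y - ?q t)))) \<in> borel_measurable borel"
        unfolding case_prod_beta
        by (rule measurable_compose[OF borel_measurable_continuous_onI gm])
           (intro continuous_intros continuous_on_compose2[OF cq] subset_UNIV)
      then have "(\<lambda>(y, t). ennreal (grad_sq \<phi> (t, s * (y - ?q t)))) \<in> borel_measurable (lborel \<Otimes>\<^sub>M lborel)" by (simp add: lborel_prod)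
      then show "(\<lambda>y. \<integral>\<^sup>+t. ennreal (grad_sq \<phi> (t, s * (y - ?q t))) \<partial>lborel) \<in> borel_measurable lborel"
        by (rule lborel.borel_measurable_nn_integral)
    qed
    also have "\<dots> = 8 * (\<integral>\<^sup>+x. ennreal (grad_sq \<phi> x) \<partial>lborel)"
      by (subst nn_integral_shear[OF gm cq s]) simp
    finally show ?thesis .
  qed
  have "(\<integral>\<^sup>+x. ennreal ((cmod (\<phi> x))\<^sup>2 / (?q (fst x) + \<epsilon>)\<^sup>2) * indicator {x. \<epsilon> \<le> ?q (fst x) + \<bar>snd x\<bar>} x \<partial>lborel)
      \<le> (\<integral>\<^sup>+x. f 1 x + f (-1) x \<partial>lborel)"
  proof (rule nn_integral_mono)
    fix x :: "real \<times> real"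
    have "indicator {x. \<epsilon> \<le> ?q (fst x) + \<bar>snd x\<bar>} x \<le>
      (indicator {x. \<epsilon> \<le> ?q (fst x) + 1 * snd x} x + indicator {x. \<epsilon> \<le> ?q (fst x) + (-1) * snd x} x :: ennreal)"
      by (auto simp: indicator_def abs_if)
    then show "ennreal ((cmod (\<phi> x))\<^sup>2 / (?q (fst x) + \<epsilon>)\<^sup>2) * indicator {x. \<epsilon> \<le> ?q (fst x) + \<bar>snd x\<bar>} x \<le> f 1 x + f (-1) x"
      unfolding f_def distrib_left[symmetric] by (rule mult_left_mono) simp
  qed
  also have "\<dots> = (\<integral>\<^sup>+x. f 1 x \<partial>lborel) + (\<integral>\<^sup>+x. f (-1) x \<partial>lborel)"
    using fm by (intro nn_integral_add) simp_all
  also have "\<dots> \<le> 8 * (\<integral>\<^sup>+x. ennreal (grad_sq \<phi> x) \<partial>lborel) + 8 * (\<integral>\<^sup>+x. ennreal (grad_sq \<phi> x) \<partial>lborel)"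
    by (intro add_mono one) auto
  also have "\<dots> = 16 * (\<integral>\<^sup>+x. ennreal (grad_sq \<phi> x) \<partial>lborel)"
    by (simp add: distrib_right[symmetric])
  finally show ?thesis .
qed

text \<open>A one-dimensional Sobolev inequality: \<open>(cmod (\<phi> x))^2\<close> is at most the
  integral of \<open>(cmod \<phi>)^2 + grad_sq \<phi>\<close> over the vertical line through
  \<open>x\<close>, and the strip has width \<open>2 * \<tau>\<close>. It handles the region where
  the cut-off may be far from 1.\<close>

lemma nn_integral_thin_strip:
  fixes \<phi> :: "real \<times> real \<Rightarrow> complex"
  assumes \<phi>: "smooth_on \<phi> UNIV" and N: "\<And>x. N \<le> \<bar>snd x\<bar> \<Longrightarrow> \<phi> x = 0" "0 < N" and \<tau>: "0 < \<tau>"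
  shows "(\<integral>\<^sup>+x. ennreal ((cmod (\<phi> x))\<^sup>2) * indicator {x. \<bar>snd x\<bar> < \<tau>} x \<partial>lborel)
    \<le> ennreal (2 * \<tau>) * (\<integral>\<^sup>+x. ennreal ((cmod (\<phi> x))\<^sup>2 + grad_sq \<phi> x) \<partial>lborel)"
proof -
  let ?g = "\<lambda>x. (cmod (\<phi> x))\<^sup>2 + grad_sq \<phi> x"
  have cg: "continuous_on UNIV ?g" by (intro continuous_intros smooth_continuous[OF \<phi>] smooth_grad_sq_continuous[OF \<phi>])
  have gm: "(\<lambda>x. ennreal (?g x)) \<in> borel_measurable borel" using borel_measurable_continuous_onI[OF cg] by measurable
  have g0: "0 \<le> ?g x" for x by (simp add: grad_sq_def)
  have pw: "ennreal ((cmod (\<phi> (t, u)))\<^sup>2) \<le> (\<integral>\<^sup>+y. ennreal (?g (t, y)) \<partial>lborel)" for t u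
  proof (cases "\<bar>u\<bar> < N")
    case False
    then show ?thesis using N(1)[of "(t, u)"] by simp
  next
    case True
    define D where "D y = frechet_derivative \<phi> (at (t, y)) (0, 1)" for y
    have der: "((\<lambda>y. (cmod (\<phi> (t, y)))\<^sup>2) has_vector_derivative 2 * (\<phi> (t, y) \<bullet> D y)) (at y within A)" for y A
    proof -
      note F = smooth_has_derivative[OF \<phi>, of "(t, y)"]
      have "((\<lambda>y. \<phi> (t, y)) has_derivative (\<lambda>h. frechet_derivative \<phi> (at (t, y)) (0, h))) (at y)"
        by (rule has_derivative_compose[of "\<lambda>y. (t, y)" "\<lambda>h. (0, h)", OF _ F]) (auto intro!: derivative_eq_intros)
      moreover have "frechet_derivative \<phi> (at (t, y)) (0, h) = h *\<^sub>R D y" for h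
        unfolding D_def using linear_scale[OF has_derivative_linear[OF F], of h "(0, 1)"] by simp
      ultimately have f: "((\<lambda>y. \<phi> (t, y)) has_derivative (\<lambda>h. h *\<^sub>R D y)) (at y)" by simp
      have "((\<lambda>y. \<phi> (t, y) \<bullet> \<phi> (t, y)) has_derivative (\<lambda>h. \<phi> (t, y) \<bullet> (h *\<^sub>R D y) + (h *\<^sub>R D y) \<bullet> \<phi> (t, y))) (at y)"
        by (rule has_derivative_inner[OF f f])
      moreover have "(\<lambda>h. \<phi> (t, y) \<bullet> (h *\<^sub>R D y) + (h *\<^sub>R D y) \<bullet> \<phi> (t, y)) = (\<lambda>h. h *\<^sub>R (2 * (\<phi> (t, y) \<bullet> D y)))"
        by (auto simp: fun_eq_iff inner_commute algebra_simps)
      ultimately have "((\<lambda>y. (cmod (\<phi> (t, y)))\<^sup>2) has_vector_derivative 2 * (\<phi> (t, y) \<bullet> D y)) (at y)"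
        by (simp add: has_vector_derivative_def power2_norm_eq_inner)
      then show ?thesis by (rule has_vector_derivative_at_within)
    qed
    have "((\<lambda>y. 2 * (\<phi> (t, y) \<bullet> D y)) has_integral ((cmod (\<phi> (t, u)))\<^sup>2 - (cmod (\<phi> (t, - N)))\<^sup>2)) {-N..u}"
      by (rule fundamental_theorem_of_calculus[OF _ der]) (use True in auto)
    moreover have "\<phi> (t, - N) = 0" using N(1)[of "(t, - N)"] by simp
    ultimately have i1: "((\<lambda>y. 2 * (\<phi> (t, y) \<bullet> D y)) has_integral (cmod (\<phi> (t, u)))\<^sup>2) {-N..u}" by simp
    have cgt: "continuous_on {-N..u} (\<lambda>y. ?g (t, y))"
      by (rule continuous_on_compose2[OF cg]) (auto intro!: continuous_intros)
    have i2: "((\<lambda>y. ?g (t, y)) has_integral integral {-N..u} (\<lambda>y. ?g (t, y))) {-N..u}"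
      by (rule integrable_integral[OF integrable_continuous_real[OF cgt]])
    have "2 * (\<phi> (t, y) \<bullet> D y) \<le> ?g (t, y)" for y
    proof -
      have "2 * (\<phi> (t, y) \<bullet> D y) \<le> 2 * cmod (\<phi> (t, y)) * cmod (D y)"
        using Cauchy_Schwarz_ineq2[of "\<phi> (t, y)" "D y"] by linarith
      also have "\<dots> \<le> (cmod (\<phi> (t, y)))\<^sup>2 + (cmod (D y))\<^sup>2" by (rule sum_squares_bound)
      finally show ?thesis unfolding D_def grad_sq_def by (smt (verit) zero_le_power2)
    qed
    then have "(cmod (\<phi> (t, u)))\<^sup>2 \<le> integral {-N..u} (\<lambda>y. ?g (t, y))"
      by (intro has_integral_le[OF i1 i2]) auto
    then have "ennreal ((cmod (\<phi> (t, u)))\<^sup>2) \<le> ennreal (integral {-N..u} (\<lambda>y. ?g (t, y)))" by (rule ennreal_leI)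
    also have "\<dots> = (\<integral>\<^sup>+y. ennreal (?g (t, y)) * indicator {-N..u} y \<partial>lborel)"
      by (rule nn_integral_has_integral_lebesgue'[OF g0 i2, symmetric])
    also have "\<dots> \<le> (\<integral>\<^sup>+y. ennreal (?g (t, y)) \<partial>lborel)"
      by (intro nn_integral_mono) (auto simp: indicator_def)
    finally show ?thesis .
  qed
  let ?f = "\<lambda>x. ennreal ((cmod (\<phi> x))\<^sup>2) * indicator {x. \<bar>snd x\<bar> < \<tau>} x"
  have "open {x::real\<times>real. \<bar>snd x\<bar> < \<tau>}" by (intro open_Collect_less continuous_intros)
  then have "{x::real\<times>real. \<bar>snd x\<bar> < \<tau>} \<in> sets borel" by (rule borel_open)
  moreover have "(\<lambda>x. (cmod (\<phi> x))\<^sup>2) \<in> borel_measurable borel"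
    by (intro borel_measurable_continuous_onI continuous_intros smooth_continuous[OF \<phi>])
  ultimately have fm: "?f \<in> borel_measurable (lborel \<Otimes>\<^sub>M lborel)"
    unfolding lborel_prod by measurable
  have gmp: "(\<lambda>x. ennreal (?g x)) \<in> borel_measurable (lborel \<Otimes>\<^sub>M lborel)" using gm by (simp add: lborel_prod)
  have "(\<integral>\<^sup>+x. ?f x \<partial>lborel) = (\<integral>\<^sup>+t. \<integral>\<^sup>+u. ?f (t, u) \<partial>lborel \<partial>lborel)"
    by (subst lborel_prod[symmetric], rule lborel.nn_integral_fst[OF fm, symmetric])
  also have "\<dots> \<le> (\<integral>\<^sup>+t. ennreal (2 * \<tau>) * (\<integral>\<^sup>+y. ennreal (?g (t, y)) \<partial>lborel) \<partial>lborel)"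
  proof (rule nn_integral_mono)
    fix t
    let ?I = "\<integral>\<^sup>+y. ennreal (?g (t, y)) \<partial>lborel"
    have "(\<integral>\<^sup>+u. ?f (t, u) \<partial>lborel) \<le> (\<integral>\<^sup>+u. ?I * indicator {-\<tau><..<\<tau>} u \<partial>lborel)"
      using pw[of t] by (intro nn_integral_mono) (auto simp: indicator_def)
    also have "\<dots> = ?I * emeasure lborel {-\<tau><..<\<tau>}" by (rule nn_integral_cmult_indicator) simp
    also have "\<dots> = ennreal (2 * \<tau>) * ?I" using \<tau> by (simp add: mult.commute)
    finally show "(\<integral>\<^sup>+u. ?f (t, u) \<partial>lborel) \<le> ennreal (2 * \<tau>) * ?I" .
  qed
  also have "\<dots> = ennreal (2 * \<tau>) * (\<integral>\<^sup>+t. (\<integral>\<^sup>+y. ennreal (?g (t, y)) \<partial>lborel) \<partial>lborel)"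
    by (rule nn_integral_cmult) (rule lborel.borel_measurable_nn_integral_fst[OF gmp])
  also have "(\<integral>\<^sup>+t. (\<integral>\<^sup>+y. ennreal (?g (t, y)) \<partial>lborel) \<partial>lborel) = (\<integral>\<^sup>+x. ennreal (?g x) \<partial>lborel)"
    by (subst lborel.nn_integral_fst[OF gmp]) (simp add: lborel_prod)
  finally show ?thesis .
qed

section \<open>The cut-off around the gates\<close>

text \<open>Unlike \<open>wall_dist\<close>, the square of the sine is smooth across the walls. The
  term \<open>\<epsilon>^2\<close> keeps the argument of the logarithm positive, and on the gates
  the value is below \<open>2 * \<epsilon>^2\<close>.\<close>

definition gate_dist_sq :: "real \<Rightarrow> real \<Rightarrow> real \<times> real \<Rightarrow> real" where
  "gate_dist_sq d \<epsilon> x = (d / pi)\<^sup>2 * (sin (pi * fst x / d))\<^sup>2 + (snd x)\<^sup>2 + \<epsilon>\<^sup>2"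

text \<open>The logarithm makes \<open>dist \<cdot> \<bar>grad\<bar>\<close> of the cut-off at most of order \<open>\<kappa>\<close>, uniformly in \<open>\<epsilon>\<close>.\<close>

definition gate_cutoff :: "real \<Rightarrow> real \<Rightarrow> real \<Rightarrow> real \<times> real \<Rightarrow> real" where
  "gate_cutoff d \<kappa> \<epsilon> x = step (\<kappa> * (ln (gate_dist_sq d \<epsilon> x) - ln (2 * \<epsilon>\<^sup>2)))"

lemma gate_dist_sq_wall_dist: "gate_dist_sq d \<epsilon> x = (wall_dist d (fst x))\<^sup>2 + (snd x)\<^sup>2 + \<epsilon>\<^sup>2"
  unfolding gate_dist_sq_def wall_dist_def power_mult_distrib power2_abs ..

lemma gate_dist_sq_pos: "0 < \<epsilon> \<Longrightarrow> 0 < gate_dist_sq d \<epsilon> x"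
  by (simp add: gate_dist_sq_def add_nonneg_pos)

lemma Ck_on_gate_dist_sq: "Ck_on k (gate_dist_sq d \<epsilon>) UNIV"
proof -
  have "gate_dist_sq d \<epsilon> = (\<lambda>x. (d / pi)\<^sup>2 * (sin (pi / d * (x \<bullet> (1, 0))) * sin (pi / d * (x \<bullet> (1, 0))))
      + (x \<bullet> (0, 1)) * (x \<bullet> (0, 1)) + \<epsilon>\<^sup>2)"
    by (auto simp: fun_eq_iff gate_dist_sq_def power2_eq_square inner_prod_def)
  moreover have "Ck_on k (\<lambda>x. sin (pi / d * (x \<bullet> (1::real, 0::real)))) UNIV"
  proof -
    have lin: "Ck_on k (\<lambda>x. pi / d * (x \<bullet> (1::real, 0::real))) UNIV"
      by (intro Ck_on_mult Ck_on_const Ck_on_inner open_UNIV)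
    show ?thesis
      by (rule Ck_on_compose[OF open_UNIV open_UNIV _ _ lin, of sin]) (use Ck_on_sin_cos in auto)
  qed
  ultimately show ?thesis
    by (auto intro!: Ck_on_add Ck_on_mult Ck_on_const Ck_on_inner)
qed

lemma gate_cutoff_smooth: assumes "0 < \<epsilon>" shows "smooth_on (gate_cutoff d \<kappa> \<epsilon>) UNIV"
proof (rule smooth_onI)
  fix k
  have "Ck_on k (\<lambda>x. ln (gate_dist_sq d \<epsilon> x)) UNIV"
    by (rule Ck_on_compose[of UNIV "{0<..}" _ k ln])
       (use gate_dist_sq_pos[OF assms] in \<open>auto intro: Ck_on_ln Ck_on_gate_dist_sq\<close>)
  then have "Ck_on k (\<lambda>x. \<kappa> * (ln (gate_dist_sq d \<epsilon> x) - ln (2 * \<epsilon>\<^sup>2))) UNIV"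
    by (intro Ck_on_mult Ck_on_diff Ck_on_const) auto
  then show "Ck_on k (gate_cutoff d \<kappa> \<epsilon>) UNIV"
    unfolding gate_cutoff_def by (rule Ck_on_compose[where g=step and T=UNIV, rotated -1]) (auto intro: Ck_on_step_aux)
qed

lemma gate_cutoff_eq_0:
  assumes "0 < \<epsilon>" "0 < \<kappa>" "gate_dist_sq d \<epsilon> x \<le> 2 * \<epsilon>\<^sup>2" shows "gate_cutoff d \<kappa> \<epsilon> x = 0"
proof -
  have "ln (gate_dist_sq d \<epsilon> x) \<le> ln (2 * \<epsilon>\<^sup>2)"
    using assms gate_dist_sq_pos by (intro ln_mono) auto
  then have "\<kappa> * (ln (gate_dist_sq d \<epsilon> x) - ln (2 * \<epsilon>\<^sup>2)) \<le> 0" using assms(2) by (simp add: mult_le_0_iff)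
  then show ?thesis by (simp add: gate_cutoff_def step_aux_def)
qed

text \<open>The partial derivatives of \<open>gate_dist_sq\<close> are at most twice its square root
  and that of \<open>step\<close> is at most 4, whence 64 = 16 * 4. The second claim confines the
  gradient to the region covered by \<open>Hardy_gates\<close>.\<close>

lemma gate_cutoff_derivative:
  assumes d: "0 < d" and eps: "0 < \<epsilon>" and \<kappa>: "0 < \<kappa>" and b: "b \<in> Basis"
  shows "(frechet_derivative (gate_cutoff d \<kappa> \<epsilon>) (at x) b)\<^sup>2 \<le> 64 * \<kappa>\<^sup>2 / gate_dist_sq d \<epsilon> x"
    and "gate_dist_sq d \<epsilon> x \<le> 2 * \<epsilon>\<^sup>2 \<Longrightarrow> frechet_derivative (gate_cutoff d \<kappa> \<epsilon>) (at x) b = 0"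
proof -
  let ?r = "gate_dist_sq d \<epsilon> x" and ?S = "sin (pi * fst x / d)" and ?C = "cos (pi * fst x / d)"
  let ?a = "\<kappa> * (ln ?r - ln (2 * \<epsilon>\<^sup>2))"
  define D where "D h = 2 * (d / pi) * ?S * ?C * fst h + 2 * snd x * snd h" for h :: "real \<times> real"
  have r: "0 < ?r" by (rule gate_dist_sq_pos[OF eps])
  have 1: "(gate_dist_sq d \<epsilon> has_derivative D) (at x)"
    unfolding gate_dist_sq_def[abs_def] D_def[abs_def] using d
    by (auto intro!: derivative_eq_intros simp: fun_eq_iff power2_eq_square field_simps)
  have "((\<lambda>x. \<kappa> * (ln (gate_dist_sq d \<epsilon> x) - ln (2 * \<epsilon>\<^sup>2))) has_derivative (\<lambda>h. \<kappa> * (D h / ?r))) (at x)"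
    by (rule derivative_eq_intros 1 refl | use r in \<open>simp add: divide_inverse\<close>)+
  from has_derivative_compose[OF this DERIV_step[unfolded has_field_derivative_def]]
  have "(gate_cutoff d \<kappa> \<epsilon> has_derivative (\<lambda>h. step_aux 2 ?a * (\<kappa> * (D h / ?r)))) (at x)"
    unfolding gate_cutoff_def[abs_def] .
  from frechet_derivative_at[OF this, symmetric]
  have fd: "frechet_derivative (gate_cutoff d \<kappa> \<epsilon>) (at x) b = step_aux 2 ?a * (\<kappa> * (D b / ?r))" by simp
  have "(D b)\<^sup>2 \<le> 4 * ?r"
  proof -
    have "b = (1, 0) \<or> b = (0, 1)" using b by (auto simp: Basis_prod_def)
    then show ?thesis
    proof
      assume "b = (1, 0)"
      then have "(D b)\<^sup>2 = 4 * ((d / pi)\<^sup>2 * ?S\<^sup>2 * ?C\<^sup>2)" by (simp add: D_def power_mult_distrib power_divide)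
      also have "(d / pi)\<^sup>2 * ?S\<^sup>2 * ?C\<^sup>2 \<le> (d / pi)\<^sup>2 * ?S\<^sup>2 * 1"
        by (intro mult_left_mono) (auto simp: abs_square_le_1)
      finally show ?thesis by (simp add: gate_dist_sq_def) (smt (verit) zero_le_power2)
    next
      assume "b = (0, 1)"
      then show ?thesis by (simp add: D_def gate_dist_sq_def power_mult_distrib)
    qed
  qed
  moreover have "(step_aux 2 ?a)\<^sup>2 \<le> 4\<^sup>2" using step_bounds by (intro power_mono) auto
  ultimately have "(step_aux 2 ?a)\<^sup>2 * (D b)\<^sup>2 \<le> 4\<^sup>2 * (4 * ?r)" by (intro mult_mono) auto
  then have "\<kappa>\<^sup>2 / ?r\<^sup>2 * ((step_aux 2 ?a)\<^sup>2 * (D b)\<^sup>2) \<le> \<kappa>\<^sup>2 / ?r\<^sup>2 * (4\<^sup>2 * (4 * ?r))" by (intro mult_left_mono) auto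
  then show "(frechet_derivative (gate_cutoff d \<kappa> \<epsilon>) (at x) b)\<^sup>2 \<le> 64 * \<kappa>\<^sup>2 / ?r"
    unfolding fd using r by (simp add: power_mult_distrib power_divide power2_eq_square field_simps)
  show "frechet_derivative (gate_cutoff d \<kappa> \<epsilon>) (at x) b = 0" if "?r \<le> 2 * \<epsilon>\<^sup>2"
  proof -
    have "ln ?r \<le> ln (2 * \<epsilon>\<^sup>2)" using that r eps by (intro ln_mono) auto
    then have "?a \<le> 0" using \<kappa> by (simp add: mult_le_0_iff)
    then show ?thesis unfolding fd by (simp add: step_aux_def)
  qed
qed

text \<open>An application of \<open>one_minus_step\<close>; the hypothesis \<open>large\<close>
  says that the logarithmic range between the scales \<epsilon> and \<tau> is long enough.\<close>

lemma one_minus_gate_cutoff: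
  assumes eps: "0 < \<epsilon>" and \<kappa>: "0 < \<kappa>" and \<tau>: "2 * \<epsilon>\<^sup>2 < \<tau>\<^sup>2" "0 < \<tau>" "\<tau> \<le> \<bar>snd x\<bar>"
    and large: "1 \<le> c * (\<kappa> * (ln (\<tau>\<^sup>2) - ln (2 * \<epsilon>\<^sup>2)))"
  shows "1 - gate_cutoff d \<kappa> \<epsilon> x \<le> c"
proof -
  let ?r = "gate_dist_sq d \<epsilon> x"
  have "\<tau>\<^sup>2 \<le> (snd x)\<^sup>2" using \<tau> by (simp add: abs_le_square_iff[symmetric])
  then have "\<tau>\<^sup>2 \<le> ?r" by (simp add: gate_dist_sq_def) (smt (verit) zero_le_power2 mult_nonneg_nonneg)
  then have le: "ln (\<tau>\<^sup>2) \<le> ln ?r" using \<tau>(2) by (intro ln_mono) auto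
  have "ln (2 * \<epsilon>\<^sup>2) < ln (\<tau>\<^sup>2)" using \<tau> eps by (subst ln_less_cancel_iff) auto
  then have pos: "0 < \<kappa> * (ln (\<tau>\<^sup>2) - ln (2 * \<epsilon>\<^sup>2))" using \<kappa> by simp
  have c: "0 < c" using large pos by (smt (verit) zero_less_mult_pos2 mult_nonpos_nonneg)
  let ?a = "\<kappa> * (ln ?r - ln (2 * \<epsilon>\<^sup>2))"
  have ale: "\<kappa> * (ln (\<tau>\<^sup>2) - ln (2 * \<epsilon>\<^sup>2)) \<le> ?a" using le \<kappa> by simp
  then have a: "0 < ?a" using pos by linarith
  have "1 - gate_cutoff d \<kappa> \<epsilon> x \<le> 1 / ?a" unfolding gate_cutoff_def by (rule one_minus_step[OF a])
  also have "\<dots> \<le> c"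
  proof -
    have "1 \<le> c * ?a" using large mult_left_mono[OF ale less_imp_le[OF c]] by linarith
    then show ?thesis using a by (simp add: divide_le_eq)
  qed
  finally show ?thesis .
qed

lemma nn_integral_L2_lborel:
  fixes u :: "'a::euclidean_space \<Rightarrow> complex"
  assumes "u \<in> L2 Q" "Q \<in> sets lebesgue" "continuous_on UNIV u" "\<And>x. x \<notin> Q \<Longrightarrow> u x = 0"
  shows "(\<integral>\<^sup>+x. ennreal ((cmod (u x))\<^sup>2) \<partial>lborel) = ennreal ((l2_norm Q u)\<^sup>2)"
proof -
  have "ennreal ((l2_norm Q u)\<^sup>2) = (\<integral>\<^sup>+x. ennreal ((cmod (u x))\<^sup>2) \<partial>lebesgue_on Q)"
    by (rule nn_integral_L2[OF assms(1), symmetric])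
  also have "\<dots> = (\<integral>\<^sup>+x. ennreal ((cmod (u x))\<^sup>2) * indicator Q x \<partial>lebesgue)"
    by (rule nn_integral_restrict_space) (use assms(2) in simp)
  also have "\<dots> = (\<integral>\<^sup>+x. ennreal ((cmod (u x))\<^sup>2) \<partial>lebesgue)"
    using assms(4) by (intro nn_integral_cong) (auto simp: indicator_def)
  also have "\<dots> = (\<integral>\<^sup>+x. ennreal ((cmod (u x))\<^sup>2) \<partial>lborel)" by (rule nn_integral_completion)
  finally show ?thesis by simp
qed

lemma (in ae_open) l2_norm_weak_partial_test:
  assumes "\<phi> \<in> test_functions Q" "b \<in> Basis"
  shows "l2_norm Q (weak_partial Q b \<phi>) = l2_norm Q (\<lambda>x. frechet_derivative \<phi> (at x) b)"
proof -
  note L = test_function_L2[OF test_function_derivative[OF assms] measurable_Q]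
    and h = smooth_has_weak_partial[OF test_functionsD(1)[OF assms(1)] measurable_Q assms(2)]
  show ?thesis by (rule Lsp.nrm_null_cong[OF weak_partial(1)[OF L h] L weak_partial_null[OF assms(2) L h]])
qed

lemma nn_integral_W21_norm:
  fixes \<phi> :: "real \<times> real \<Rightarrow> complex"
  assumes "ae_open Q" and \<phi>: "\<phi> \<in> test_functions Q"
  shows "(\<integral>\<^sup>+x. ennreal ((cmod (\<phi> x))\<^sup>2 + grad_sq \<phi> x) \<partial>lborel) = ennreal ((W21_norm Q \<phi>)\<^sup>2)"
proof -
  interpret ae_open Q by (rule assms(1))
  have B: "(Basis :: (real \<times> real) set) = {(1, 0), (0, 1)}" by (auto simp: Basis_prod_def)
  have nn: "(\<integral>\<^sup>+x. ennreal ((cmod (\<psi> x))\<^sup>2) \<partial>lborel) = ennreal ((l2_norm Q \<psi>)\<^sup>2)"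
    and m: "(\<lambda>x. ennreal ((cmod (\<psi> x))\<^sup>2)) \<in> borel_measurable lborel"
    if "\<psi> \<in> test_functions Q" for \<psi>
  proof -
    show "(\<integral>\<^sup>+x. ennreal ((cmod (\<psi> x))\<^sup>2) \<partial>lborel) = ennreal ((l2_norm Q \<psi>)\<^sup>2)"
      by (rule nn_integral_L2_lborel[OF test_function_L2[OF that measurable_Q] measurable_Q
            test_function_continuous[OF that] test_function_outside[OF that]])
    have "(\<lambda>x. (cmod (\<psi> x))\<^sup>2) \<in> borel_measurable borel"
      by (intro borel_measurable_continuous_onI continuous_intros test_function_continuous[OF that])
    then show "(\<lambda>x. ennreal ((cmod (\<psi> x))\<^sup>2)) \<in> borel_measurable lborel" by measurable
  qed
  have T: "(\<lambda>x. frechet_derivative \<phi> (at x) (1, 0)) \<in> test_functions Q" "(\<lambda>x. frechet_derivative \<phi> (at x) (0, 1)) \<in> test_functions Q"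
    using B by (auto intro: test_function_derivative[OF \<phi>])
  have "(W21_norm Q \<phi>)\<^sup>2 = (l2_norm Q \<phi>)\<^sup>2 + ((l2_norm Q (\<lambda>x. frechet_derivative \<phi> (at x) (1, 0)))\<^sup>2
      + (l2_norm Q (\<lambda>x. frechet_derivative \<phi> (at x) (0, 1)))\<^sup>2)"
    using l2_norm_weak_partial_test[OF \<phi>] by (simp add: W21_norm_sq B)
  then show ?thesis
    unfolding grad_sq_def
    using m[OF \<phi>] m[OF T(1)] m[OF T(2)]
    by (simp add: nn_integral_add nn[OF \<phi>] nn[OF T(1)] nn[OF T(2)])
qed

text \<open>The derivative is at most a multiple of
  \<open>\<kappa> / (wall_dist + \<epsilon>)\<close> and vanishes where \<open>Hardy_gates\<close>
  says nothing. For the constant, 128 * 16 = 2048 is below 64^2.\<close>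

lemma gate_cutoff_derivative_small:
  fixes \<phi> :: "real \<times> real \<Rightarrow> complex"
  assumes Q: "ae_open Q" and d: "0 < d" and eps: "0 < \<epsilon>" and \<kappa>: "0 < \<kappa>"
    and wall: "\<And>(k::int) y. \<epsilon> \<le> \<bar>y\<bar> \<Longrightarrow> (of_int k * d, y) \<notin> Q"
    and \<phi>: "\<phi> \<in> test_functions Q" and b: "b \<in> Basis"
  shows "l2_norm Q (\<lambda>x. of_real (frechet_derivative (gate_cutoff d \<kappa> \<epsilon>) (at x) b) * \<phi> x) \<le> 64 * \<kappa> * W21_norm Q \<phi>"
proof -
  interpret ae_open Q by (rule Q)
  let ?f = "\<lambda>x. complex_of_real (frechet_derivative (gate_cutoff d \<kappa> \<epsilon>) (at x) b)"
  let ?A = "{x::real\<times>real. \<epsilon> \<le> wall_dist d (fst x) + \<bar>snd x\<bar>}"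
  have sf: "smooth_on ?f UNIV"
    using smooth_frechet[OF gate_cutoff_smooth[OF eps] b]
    by (simp add: smooth_on_def Ck_on_linear[OF bounded_linear_of_real])
  have T: "(\<lambda>x. ?f x * \<phi> x) \<in> test_functions Q" by (rule test_function_smooth_mult[OF sf \<phi>])
  obtain N where N: "0 < N" "\<And>x. x \<in> closure {x. \<phi> x \<noteq> 0} \<Longrightarrow> norm x < N"
  proof -
    obtain r where "0 < r" "\<forall>x\<in>closure {x. \<phi> x \<noteq> 0}. norm x \<le> r"
      using compact_imp_bounded[OF test_functionsD(2)[OF \<phi>]] unfolding bounded_pos by blast
    then show ?thesis by (intro that[of "r + 1"]) force+
  qed
  have out: "\<phi> x = 0" if "N \<le> \<bar>fst x\<bar>" for x
  proof (rule ccontr)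
    assume "\<phi> x \<noteq> 0"
    then have "norm x < N" using N(2)[of x] closure_subset[of "{x. \<phi> x \<noteq> 0}"] by auto
    then show False using that norm_fst_le[of "fst x" "snd x"] by simp
  qed
  have \<phi>wall: "\<phi> (of_int k * d, y) = 0" if "\<epsilon> \<le> \<bar>y\<bar>" for k :: int and y
    by (rule test_function_outside[OF \<phi> wall[OF that]])
  have pw: "(cmod (?f x * \<phi> x))\<^sup>2 \<le> 128 * \<kappa>\<^sup>2 * ((cmod (\<phi> x))\<^sup>2 / (wall_dist d (fst x) + \<epsilon>)\<^sup>2 * indicator ?A x)" for x
  proof (cases "x \<in> ?A")
    case True
    let ?q = "wall_dist d (fst x)" and ?r = "gate_dist_sq d \<epsilon> x"
    have q: "0 < ?q + \<epsilon>" using wall_dist_nonneg[OF d, of "fst x"] eps by simp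
    have "(?q + \<epsilon>)\<^sup>2 \<le> 2 * (?q\<^sup>2 + \<epsilon>\<^sup>2)" using sum_squares_bound[of ?q \<epsilon>] by (simp add: power2_sum)
    also have "\<dots> \<le> 2 * ?r" by (simp add: gate_dist_sq_wall_dist)
    finally have "64 * \<kappa>\<^sup>2 / ?r \<le> 64 * \<kappa>\<^sup>2 / ((?q + \<epsilon>)\<^sup>2 / 2)"
      using q by (intro divide_left_mono mult_pos_pos gate_dist_sq_pos eps) auto
    then have "(frechet_derivative (gate_cutoff d \<kappa> \<epsilon>) (at x) b)\<^sup>2 \<le> 128 * \<kappa>\<^sup>2 / (?q + \<epsilon>)\<^sup>2"
      using gate_cutoff_derivative(1)[OF d eps \<kappa> b, of x] by simp
    then have "(frechet_derivative (gate_cutoff d \<kappa> \<epsilon>) (at x) b)\<^sup>2 * (cmod (\<phi> x))\<^sup>2 \<le> 128 * \<kappa>\<^sup>2 / (?q + \<epsilon>)\<^sup>2 * (cmod (\<phi> x))\<^sup>2"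
      by (rule mult_right_mono) simp
    then show ?thesis using True by (simp add: norm_mult power_mult_distrib)
  next
    case False
    let ?q = "wall_dist d (fst x)"
    have q: "0 \<le> ?q" by (rule wall_dist_nonneg[OF d])
    have "?q\<^sup>2 + (snd x)\<^sup>2 \<le> (?q + \<bar>snd x\<bar>)\<^sup>2" using q by (simp add: power2_sum)
    also have "\<dots> \<le> \<epsilon>\<^sup>2" using False q by (intro power_mono) auto
    finally have "gate_dist_sq d \<epsilon> x \<le> 2 * \<epsilon>\<^sup>2" by (simp add: gate_dist_sq_wall_dist)
    then show ?thesis using gate_cutoff_derivative(2)[OF d eps \<kappa> b] False by simp
  qed
  have "ennreal ((l2_norm Q (\<lambda>x. ?f x * \<phi> x))\<^sup>2) = (\<integral>\<^sup>+x. ennreal ((cmod (?f x * \<phi> x))\<^sup>2) \<partial>lborel)"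
    by (rule nn_integral_L2_lborel[OF test_function_L2[OF T measurable_Q] measurable_Q
          test_function_continuous[OF T] test_function_outside[OF T], symmetric])
  also have "\<dots> \<le> (\<integral>\<^sup>+x. ennreal (128 * \<kappa>\<^sup>2) * (ennreal ((cmod (\<phi> x))\<^sup>2 / (wall_dist d (fst x) + \<epsilon>)\<^sup>2) * indicator ?A x) \<partial>lborel)"
  proof (rule nn_integral_mono)
    fix x
    have "ennreal ((cmod (?f x * \<phi> x))\<^sup>2) \<le> ennreal (128 * \<kappa>\<^sup>2 * ((cmod (\<phi> x))\<^sup>2 / (wall_dist d (fst x) + \<epsilon>)\<^sup>2 * indicator ?A x))"
      by (rule ennreal_leI[OF pw])
    also have "\<dots> = ennreal (128 * \<kappa>\<^sup>2) * (ennreal ((cmod (\<phi> x))\<^sup>2 / (wall_dist d (fst x) + \<epsilon>)\<^sup>2) * indicator ?A x)"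
      by (subst ennreal_mult) (auto simp: indicator_def)
    finally show "ennreal ((cmod (?f x * \<phi> x))\<^sup>2) \<le> ennreal (128 * \<kappa>\<^sup>2) * (ennreal ((cmod (\<phi> x))\<^sup>2 / (wall_dist d (fst x) + \<epsilon>)\<^sup>2) * indicator ?A x)" .
  qed
  also have "\<dots> = ennreal (128 * \<kappa>\<^sup>2) * (\<integral>\<^sup>+x. ennreal ((cmod (\<phi> x))\<^sup>2 / (wall_dist d (fst x) + \<epsilon>)\<^sup>2) * indicator ?A x \<partial>lborel)"
  proof (rule nn_integral_cmult)
    have cqf: "continuous_on UNIV (\<lambda>x::real\<times>real. wall_dist d (fst x))"
      by (rule continuous_on_compose2[OF wall_dist_continuous[OF d, of UNIV]]) (auto intro!: continuous_intros)
    have "closed ?A" by (intro closed_Collect_le continuous_intros cqf)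
    then have A: "?A \<in> sets borel" by (rule borel_closed)
    have "continuous_on UNIV (\<lambda>x. (cmod (\<phi> x))\<^sup>2 / (wall_dist d (fst x) + \<epsilon>)\<^sup>2)"
      by (intro continuous_intros test_function_continuous[OF \<phi>] cqf)
         (use wall_dist_nonneg[OF d] eps in \<open>auto simp: add_nonneg_eq_0_iff\<close>)
    from borel_measurable_continuous_onI[OF this] A
    show "(\<lambda>x. ennreal ((cmod (\<phi> x))\<^sup>2 / (wall_dist d (fst x) + \<epsilon>)\<^sup>2) * indicator ?A x) \<in> borel_measurable lborel"
      unfolding measurable_lborel1 by measurable
  qed
  also have "\<dots> \<le> ennreal (128 * \<kappa>\<^sup>2) * (16 * (\<integral>\<^sup>+x. ennreal (grad_sq \<phi> x) \<partial>lborel))"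
    by (intro mult_left_mono Hardy_gates[OF d eps test_functionsD(1)[OF \<phi>] out N(1) \<phi>wall]) auto
  also have "\<dots> \<le> ennreal (128 * \<kappa>\<^sup>2) * (16 * ennreal ((W21_norm Q \<phi>)\<^sup>2))"
    unfolding nn_integral_W21_norm[OF Q \<phi>, symmetric]
    by (intro mult_left_mono nn_integral_mono ennreal_leI) auto
  also have "16 * ennreal ((W21_norm Q \<phi>)\<^sup>2) = ennreal (16 * (W21_norm Q \<phi>)\<^sup>2)"
    by (simp add: ennreal_mult)
  also have "ennreal (128 * \<kappa>\<^sup>2) * ennreal (16 * (W21_norm Q \<phi>)\<^sup>2) = ennreal (128 * \<kappa>\<^sup>2 * (16 * (W21_norm Q \<phi>)\<^sup>2))"
    by (rule ennreal_mult[symmetric]) auto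
  also have "128 * \<kappa>\<^sup>2 * (16 * (W21_norm Q \<phi>)\<^sup>2) = 2048 * \<kappa>\<^sup>2 * (W21_norm Q \<phi>)\<^sup>2" by simp
  finally have "(l2_norm Q (\<lambda>x. ?f x * \<phi> x))\<^sup>2 \<le> 2048 * \<kappa>\<^sup>2 * (W21_norm Q \<phi>)\<^sup>2" by simp
  also have "\<dots> \<le> 4096 * \<kappa>\<^sup>2 * (W21_norm Q \<phi>)\<^sup>2" by (intro mult_right_mono) auto
  also have "\<dots> = (64 * \<kappa> * W21_norm Q \<phi>)\<^sup>2" by (simp add: power_mult_distrib)
  finally show ?thesis
    by (rule power2_le_imp_le) (use \<kappa> W.nrm_nonneg[OF test_function_W21[OF \<phi>]] in simp)
qed

text \<open>In the strip of half-width \<tau> only \<open>1 - \<theta> \<le> 1\<close> is used, and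
  the smallness comes from \<open>nn_integral_thin_strip\<close>; outside,
  \<open>1 - \<theta> \<le> \<alpha> / 2\<close>. The squared contributions
  \<open>2 * \<tau>\<close> and \<open>\<alpha>^2 / 4\<close> add up to at most
  \<open>\<alpha>^2\<close>.\<close>

lemma one_minus_gate_cutoff_small:
  fixes \<phi> :: "real \<times> real \<Rightarrow> complex"
  assumes Q: "ae_open Q" and eps: "0 < \<epsilon>" and \<kappa>: "0 < \<kappa>" and \<alpha>: "0 < \<alpha>"
    and \<tau>: "0 < \<tau>" "2 * \<tau> \<le> \<alpha>\<^sup>2 / 2" "2 * \<epsilon>\<^sup>2 < \<tau>\<^sup>2"
    and large: "1 \<le> \<alpha> / 2 * (\<kappa> * (ln (\<tau>\<^sup>2) - ln (2 * \<epsilon>\<^sup>2)))"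
    and \<phi>: "\<phi> \<in> test_functions Q"
  shows "l2_norm Q (\<lambda>x. of_real (1 - gate_cutoff d \<kappa> \<epsilon> x) * \<phi> x) \<le> \<alpha> * W21_norm Q \<phi>"
proof -
  interpret ae_open Q by (rule Q)
  let ?f = "\<lambda>x. complex_of_real (1 - gate_cutoff d \<kappa> \<epsilon> x)"
  have "Ck_on k (\<lambda>x. 1 - gate_cutoff d \<kappa> \<epsilon> x) UNIV" for k
    by (intro Ck_on_diff Ck_on_const open_UNIV) (rule smooth_onD[OF gate_cutoff_smooth[OF eps]])
  then have sf: "smooth_on ?f UNIV"
    by (intro smooth_onI Ck_on_linear[OF bounded_linear_of_real]) auto
  have T: "(\<lambda>x. ?f x * \<phi> x) \<in> test_functions Q" by (rule test_function_smooth_mult[OF sf \<phi>])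
  obtain N where N: "0 < N" "\<And>x. x \<in> closure {x. \<phi> x \<noteq> 0} \<Longrightarrow> norm x < N"
  proof -
    obtain r where "0 < r" "\<forall>x\<in>closure {x. \<phi> x \<noteq> 0}. norm x \<le> r"
      using compact_imp_bounded[OF test_functionsD(2)[OF \<phi>]] unfolding bounded_pos by blast
    then show ?thesis by (intro that[of "r + 1"]) force+
  qed
  have out: "\<phi> x = 0" if "N \<le> \<bar>snd x\<bar>" for x
  proof (rule ccontr)
    assume "\<phi> x \<noteq> 0"
    then have "norm x < N" using N(2)[of x] closure_subset[of "{x. \<phi> x \<noteq> 0}"] by auto
    then show False using that norm_snd_le[of "snd x" "fst x"] by simp
  qed
  let ?A = "{x::real\<times>real. \<bar>snd x\<bar> < \<tau>}"
  have pw: "(cmod (?f x * \<phi> x))\<^sup>2 \<le> (cmod (\<phi> x))\<^sup>2 * indicator ?A x + \<alpha>\<^sup>2 / 4 * ((cmod (\<phi> x))\<^sup>2 + grad_sq \<phi> x)" for x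
  proof -
    have 01: "0 \<le> 1 - gate_cutoff d \<kappa> \<epsilon> x" "1 - gate_cutoff d \<kappa> \<epsilon> x \<le> 1"
      by (simp_all add: gate_cutoff_def step_bounds)
    have eq: "(cmod (?f x * \<phi> x))\<^sup>2 = (1 - gate_cutoff d \<kappa> \<epsilon> x)\<^sup>2 * (cmod (\<phi> x))\<^sup>2"
      unfolding norm_mult norm_of_real by (simp add: power_mult_distrib)
    have g: "0 \<le> \<alpha>\<^sup>2 / 4 * grad_sq \<phi> x" "0 \<le> \<alpha>\<^sup>2 / 4 * (cmod (\<phi> x))\<^sup>2" by (auto simp: grad_sq_def)
    show ?thesis
    proof (cases "x \<in> ?A")
      case True
      have "(1 - gate_cutoff d \<kappa> \<epsilon> x)\<^sup>2 * (cmod (\<phi> x))\<^sup>2 \<le> 1 * (cmod (\<phi> x))\<^sup>2"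
        using 01 by (intro mult_right_mono) (auto simp: power_le_one)
      moreover have "(cmod (\<phi> x))\<^sup>2 * indicator ?A x = (cmod (\<phi> x))\<^sup>2" using True by simp
      ultimately show ?thesis unfolding eq distrib_left using g by linarith
    next
      case False
      then have "1 - gate_cutoff d \<kappa> \<epsilon> x \<le> \<alpha> / 2"
        by (intro one_minus_gate_cutoff[OF eps \<kappa> \<tau>(3,1) _ large]) simp
      then have "(1 - gate_cutoff d \<kappa> \<epsilon> x)\<^sup>2 * (cmod (\<phi> x))\<^sup>2 \<le> (\<alpha> / 2)\<^sup>2 * (cmod (\<phi> x))\<^sup>2"
        using 01 by (intro mult_right_mono power_mono) auto
      then have "(1 - gate_cutoff d \<kappa> \<epsilon> x)\<^sup>2 * (cmod (\<phi> x))\<^sup>2 \<le> \<alpha>\<^sup>2 / 4 * (cmod (\<phi> x))\<^sup>2"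
        by (simp add: power_divide)
      moreover have "(cmod (\<phi> x))\<^sup>2 * indicator ?A x = 0" using False by simp
      ultimately show ?thesis unfolding eq distrib_left using g by linarith
    qed
  qed
  have m: "(\<lambda>x. ennreal ((cmod (\<phi> x))\<^sup>2) * indicator ?A x) \<in> borel_measurable lborel"
    "(\<lambda>x. ennreal ((cmod (\<phi> x))\<^sup>2 + grad_sq \<phi> x)) \<in> borel_measurable lborel"
  proof -
    have "open ?A" by (intro open_Collect_less continuous_intros)
    then have A: "?A \<in> sets borel" by (rule borel_open)
    have "(\<lambda>x. (cmod (\<phi> x))\<^sup>2) \<in> borel_measurable borel"
      by (intro borel_measurable_continuous_onI continuous_intros test_function_continuous[OF \<phi>])
    with A show "(\<lambda>x. ennreal ((cmod (\<phi> x))\<^sup>2) * indicator ?A x) \<in> borel_measurable lborel"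
      unfolding measurable_lborel1 by measurable
    have "(\<lambda>x. (cmod (\<phi> x))\<^sup>2 + grad_sq \<phi> x) \<in> borel_measurable borel"
      by (intro borel_measurable_continuous_onI continuous_intros test_function_continuous[OF \<phi>]
          smooth_grad_sq_continuous test_functionsD(1)[OF \<phi>])
    then show "(\<lambda>x. ennreal ((cmod (\<phi> x))\<^sup>2 + grad_sq \<phi> x)) \<in> borel_measurable lborel"
      unfolding measurable_lborel1 by measurable
  qed
  have "ennreal ((l2_norm Q (\<lambda>x. ?f x * \<phi> x))\<^sup>2) = (\<integral>\<^sup>+x. ennreal ((cmod (?f x * \<phi> x))\<^sup>2) \<partial>lborel)"
    by (rule nn_integral_L2_lborel[OF test_function_L2[OF T measurable_Q] measurable_Q
          test_function_continuous[OF T] test_function_outside[OF T], symmetric])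
  also have "\<dots> \<le> (\<integral>\<^sup>+x. ennreal ((cmod (\<phi> x))\<^sup>2) * indicator ?A x + ennreal (\<alpha>\<^sup>2 / 4) * ennreal ((cmod (\<phi> x))\<^sup>2 + grad_sq \<phi> x) \<partial>lborel)"
  proof (rule nn_integral_mono)
    fix x
    have "ennreal ((cmod (?f x * \<phi> x))\<^sup>2) \<le> ennreal ((cmod (\<phi> x))\<^sup>2 * indicator ?A x + \<alpha>\<^sup>2 / 4 * ((cmod (\<phi> x))\<^sup>2 + grad_sq \<phi> x))"
      by (rule ennreal_leI[OF pw])
    also have "\<dots> = ennreal ((cmod (\<phi> x))\<^sup>2) * indicator ?A x + ennreal (\<alpha>\<^sup>2 / 4) * ennreal ((cmod (\<phi> x))\<^sup>2 + grad_sq \<phi> x)"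
    proof -
      have Y: "0 \<le> (cmod (\<phi> x))\<^sup>2 + grad_sq \<phi> x" by (simp add: grad_sq_def)
      have "ennreal (\<alpha>\<^sup>2 / 4 * ((cmod (\<phi> x))\<^sup>2 + grad_sq \<phi> x)) = ennreal (\<alpha>\<^sup>2 / 4) * ennreal ((cmod (\<phi> x))\<^sup>2 + grad_sq \<phi> x)"
        by (rule ennreal_mult[OF _ Y]) simp
      moreover have "ennreal ((cmod (\<phi> x))\<^sup>2 * indicator ?A x) = ennreal ((cmod (\<phi> x))\<^sup>2) * indicator ?A x"
        by (simp add: indicator_def)
      moreover have "ennreal ((cmod (\<phi> x))\<^sup>2 * indicator ?A x + \<alpha>\<^sup>2 / 4 * ((cmod (\<phi> x))\<^sup>2 + grad_sq \<phi> x))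
          = ennreal ((cmod (\<phi> x))\<^sup>2 * indicator ?A x) + ennreal (\<alpha>\<^sup>2 / 4 * ((cmod (\<phi> x))\<^sup>2 + grad_sq \<phi> x))"
        by (rule ennreal_plus) (use Y in \<open>auto intro!: mult_nonneg_nonneg\<close>)
      ultimately show ?thesis by (simp only:)
    qed
    finally show "ennreal ((cmod (?f x * \<phi> x))\<^sup>2)
        \<le> ennreal ((cmod (\<phi> x))\<^sup>2) * indicator ?A x + ennreal (\<alpha>\<^sup>2 / 4) * ennreal ((cmod (\<phi> x))\<^sup>2 + grad_sq \<phi> x)" .
  qed
  also have "\<dots> = (\<integral>\<^sup>+x. ennreal ((cmod (\<phi> x))\<^sup>2) * indicator ?A x \<partial>lborel)
      + ennreal (\<alpha>\<^sup>2 / 4) * (\<integral>\<^sup>+x. ennreal ((cmod (\<phi> x))\<^sup>2 + grad_sq \<phi> x) \<partial>lborel)"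
    using m by (simp only: nn_integral_add nn_integral_cmult borel_measurable_times_ennreal borel_measurable_const)
  also have "\<dots> \<le> ennreal (2 * \<tau>) * ennreal ((W21_norm Q \<phi>)\<^sup>2) + ennreal (\<alpha>\<^sup>2 / 4) * ennreal ((W21_norm Q \<phi>)\<^sup>2)"
    unfolding nn_integral_W21_norm[OF Q \<phi>, symmetric]
    by (intro add_right_mono nn_integral_thin_strip[OF test_functionsD(1)[OF \<phi>] out N(1) \<tau>(1)])
  also have "\<dots> = ennreal ((2 * \<tau> + \<alpha>\<^sup>2 / 4) * (W21_norm Q \<phi>)\<^sup>2)"
    using \<tau>(1) by (simp add: distrib_right flip: ennreal_mult ennreal_plus)
  finally have "(l2_norm Q (\<lambda>x. ?f x * \<phi> x))\<^sup>2 \<le> (2 * \<tau> + \<alpha>\<^sup>2 / 4) * (W21_norm Q \<phi>)\<^sup>2"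
    using \<tau>(1) by (subst (asm) ennreal_le_iff) (auto intro!: mult_nonneg_nonneg add_nonneg_nonneg)
  also have "\<dots> \<le> \<alpha>\<^sup>2 * (W21_norm Q \<phi>)\<^sup>2"
    using \<tau>(2) zero_le_power2[of \<alpha>] by (intro mult_right_mono zero_le_power2) linarith
  also have "\<dots> = (\<alpha> * W21_norm Q \<phi>)\<^sup>2" by (simp add: power_mult_distrib)
  finally show ?thesis
    by (rule power2_le_imp_le) (use \<alpha> W.nrm_nonneg[OF test_function_W21[OF \<phi>]] in simp)
qed

text \<open>The threshold is fixed before the domains and the potential, which is possible because
  the Hardy and strip estimates have absolute constants.\<close>

lemma gate_cutoff_cutoff:
  assumes d: "0 < d" and \<alpha>: "0 < \<alpha>"
  obtains \<epsilon>0 where "0 < \<epsilon>0"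
    "\<And>\<epsilon> Q1 Q0 V B. \<lbrakk>0 < \<epsilon>; \<epsilon> < \<epsilon>0; domain_pair Q1 Q0 V B;
       \<And>(k::int) y. \<epsilon> \<le> \<bar>y\<bar> \<Longrightarrow> (of_int k * d, y) \<notin> Q1;
       \<And>x. x \<in> Q1 \<Longrightarrow> 2 * \<epsilon>\<^sup>2 \<le> gate_dist_sq d \<epsilon> x \<Longrightarrow> x \<in> Q0\<rbrakk>
     \<Longrightarrow> \<exists>\<theta> K. cutoff Q1 Q0 V B \<theta> K \<alpha>"
proof -
  \<comment> \<open>\<open>\<kappa>\<close> compensates the constant 64 of
    \<open>gate_cutoff_derivative_small\<close>, \<open>\<tau>\<close> is the largest value with
    \<open>2 * \<tau> \<le> \<alpha>^2 / 2\<close>, and \<open>\<epsilon>0\<close> makes the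
    logarithm at least \<open>128 / \<alpha>^2\<close>, so that
    \<open>\<alpha> / 2 * \<kappa> * 128 / \<alpha>^2 = 1\<close> gives
    \<open>large\<close>.\<close>
  define \<kappa> where "\<kappa> = \<alpha> / 64"
  define \<tau> where "\<tau> = \<alpha>\<^sup>2 / 4"
  define \<epsilon>0 where "\<epsilon>0 = \<tau> / 2 * exp (- 64 / \<alpha>\<^sup>2)"
  have pos: "0 < \<kappa>" "0 < \<tau>" "0 < \<epsilon>0" using \<alpha> by (auto simp: \<kappa>_def \<tau>_def \<epsilon>0_def)
  show ?thesis
  proof (rule that[OF pos(3)])
    fix \<epsilon> Q1 Q0 V B
    assume eps: "0 < \<epsilon>" "\<epsilon> < \<epsilon>0" and dp: "domain_pair Q1 Q0 V B"
      and wall: "\<And>(k::int) y. \<epsilon> \<le> \<bar>y\<bar> \<Longrightarrow> (of_int k * d, y) \<notin> Q1"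
      and gate: "\<And>x. x \<in> Q1 \<Longrightarrow> 2 * \<epsilon>\<^sup>2 \<le> gate_dist_sq d \<epsilon> x \<Longrightarrow> x \<in> Q0"
    interpret domain_pair Q1 Q0 V B by (rule dp)
    have ae: "ae_open Q1" by (rule A.ae_open_axioms)
    have "\<epsilon>\<^sup>2 < \<epsilon>0\<^sup>2" using eps by (intro power_strict_mono) auto
    also have "\<epsilon>0\<^sup>2 = \<tau>\<^sup>2 / 4 * exp (- 128 / \<alpha>\<^sup>2)"
      by (simp add: \<epsilon>0_def power_mult_distrib power_divide exp_double[symmetric])
    finally have e2: "2 * \<epsilon>\<^sup>2 < \<tau>\<^sup>2 * exp (- 128 / \<alpha>\<^sup>2)" using pos by (simp add: field_simps) (smt (verit) exp_gt_zero mult_pos_pos zero_less_power)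
    then have "ln (2 * \<epsilon>\<^sup>2) \<le> ln (\<tau>\<^sup>2 * exp (- 128 / \<alpha>\<^sup>2))" using eps by (intro ln_mono) auto
    also have "\<dots> = ln (\<tau>\<^sup>2) - 128 / \<alpha>\<^sup>2" using pos by (simp add: ln_mult)
    finally have l: "128 / \<alpha>\<^sup>2 \<le> ln (\<tau>\<^sup>2) - ln (2 * \<epsilon>\<^sup>2)" by simp
    have large: "1 \<le> \<alpha> / 2 * (\<kappa> * (ln (\<tau>\<^sup>2) - ln (2 * \<epsilon>\<^sup>2)))"
    proof -
      have "\<alpha> / 2 * (\<kappa> * (128 / \<alpha>\<^sup>2)) \<le> \<alpha> / 2 * (\<kappa> * (ln (\<tau>\<^sup>2) - ln (2 * \<epsilon>\<^sup>2)))"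
        using \<alpha> pos l by (intro mult_left_mono) auto
      moreover have "\<alpha> / 2 * (\<kappa> * (128 / \<alpha>\<^sup>2)) = 1" using \<alpha> by (simp add: \<kappa>_def power2_eq_square)
      ultimately show ?thesis by linarith
    qed
    have "exp (- 128 / \<alpha>\<^sup>2) \<le> 1" by simp
    then have "\<tau>\<^sup>2 * exp (- 128 / \<alpha>\<^sup>2) \<le> \<tau>\<^sup>2 * 1" by (intro mult_left_mono) auto
    with e2 have e3: "2 * \<epsilon>\<^sup>2 < \<tau>\<^sup>2" by linarith
    let ?\<theta> = "gate_cutoff d \<kappa> \<epsilon>"
    have "cutoff Q1 Q0 V B ?\<theta> (8 * \<kappa> / \<epsilon>) \<alpha>"
    proof
      show "smooth_on ?\<theta> UNIV" by (rule gate_cutoff_smooth[OF eps(1)])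
      show "0 \<le> ?\<theta> x" "?\<theta> x \<le> 1" for x using step_bounds by (auto simp: gate_cutoff_def)
      show "\<bar>frechet_derivative ?\<theta> (at x) b\<bar> \<le> 8 * \<kappa> / \<epsilon>" if b: "b \<in> Basis" for b x
      proof (rule power2_le_imp_le)
        have "\<bar>frechet_derivative ?\<theta> (at x) b\<bar>\<^sup>2 \<le> 64 * \<kappa>\<^sup>2 / gate_dist_sq d \<epsilon> x"
          using gate_cutoff_derivative(1)[OF d eps(1) pos(1) b] by simp
        also have "\<dots> \<le> 64 * \<kappa>\<^sup>2 / \<epsilon>\<^sup>2"
          using eps gate_dist_sq_pos[OF eps(1), of d x]
          by (intro divide_left_mono mult_pos_pos) (auto simp: gate_dist_sq_def)
        finally show "\<bar>frechet_derivative ?\<theta> (at x) b\<bar>\<^sup>2 \<le> (8 * \<kappa> / \<epsilon>)\<^sup>2" by (simp add: power_divide power_mult_distrib)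
        show "0 \<le> 8 * \<kappa> / \<epsilon>" using pos eps by simp
      qed
      show "(\<lambda>x. of_real (?\<theta> x) * \<phi> x) \<in> test_functions Q0" if \<phi>: "\<phi> \<in> test_functions Q1" for \<phi>
      proof (rule test_functionsI)
        \<comment> \<open>The support of the product is a compact subset of the larger domain that
          avoids the gates, hence a subset of \<open>Q0\<close>.\<close>
        let ?K = "closure {x. \<phi> x \<noteq> 0} \<inter> {x. 2 * \<epsilon>\<^sup>2 \<le> gate_dist_sq d \<epsilon> x}"
        have s: "smooth_on (\<lambda>x. complex_of_real (?\<theta> x)) UNIV"
          using gate_cutoff_smooth[OF eps(1), of d \<kappa>] by (simp add: smooth_on_def Ck_on_linear[OF bounded_linear_of_real])
        show "smooth_on (\<lambda>x. complex_of_real (?\<theta> x) * \<phi> x) UNIV"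
          by (rule smooth_on_mult[OF open_UNIV s test_functionsD(1)[OF \<phi>]])
        have "continuous_on UNIV (gate_dist_sq d \<epsilon>)" using Ck_on_gate_dist_sq[of 0] by simp
        then have "closed {x. 2 * \<epsilon>\<^sup>2 \<le> gate_dist_sq d \<epsilon> x}"
          by (intro closed_Collect_le continuous_on_const) simp
        then show "compact ?K" by (rule compact_Int_closed[OF test_functionsD(2)[OF \<phi>]])
        show "?K \<subseteq> Q0" using test_functionsD(3)[OF \<phi>] gate by auto
        show "complex_of_real (?\<theta> x) * \<phi> x = 0" if "x \<notin> ?K" for x
          using that gate_cutoff_eq_0[OF eps(1) pos(1), of d x] closure_subset[of "{x. \<phi> x \<noteq> 0}"]
          by (cases "\<phi> x = 0") auto
      qed
      show "0 \<le> \<alpha>" using \<alpha> by simp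
      show "l2_norm Q1 (\<lambda>x. of_real (1 - ?\<theta> x) * \<phi> x) \<le> \<alpha> * W21_norm Q1 \<phi>" if "\<phi> \<in> test_functions Q1" for \<phi>
        by (rule one_minus_gate_cutoff_small[OF ae eps(1) pos(1) \<alpha> pos(2) _ e3 large that]) (simp add: \<tau>_def)
      show "l2_norm Q1 (\<lambda>x. of_real (frechet_derivative ?\<theta> (at x) b) * \<phi> x) \<le> \<alpha> * W21_norm Q1 \<phi>"
        if "\<phi> \<in> test_functions Q1" "b \<in> Basis" for \<phi> b
        using gate_cutoff_derivative_small[OF ae d eps(1) pos(1) wall that] by (simp add: \<kappa>_def)
    qed
    then show "\<exists>\<theta> K. cutoff Q1 Q0 V B \<theta> K \<alpha>" by blast
  qed
qed

section \<open>Convergence of the spectra\<close>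

text \<open>Allows the transfer of approximate eigenvectors in both directions from one
  estimate.\<close>

lemma form_pair_sym:
  assumes "form_pair sc S ip D1 b1 D2 b2 \<delta>"
  shows "form_pair sc S ip D2 b2 D1 b1 \<delta>"
proof -
  interpret P: form_pair sc S ip D1 b1 D2 b2 \<delta> by (rule assms)
  show ?thesis
  proof (intro form_pair.intro form_pair_axioms.intro)
    show "form_operator sc S ip D2 b2" by (rule P.B.form_operator_axioms)
    show "form_operator sc S ip D1 b1" by (rule P.A.form_operator_axioms)
    fix u f v assume uv: "P.B.gr u f" "P.A.gr v f"
    have "P.A.L.nrm (u - v) = P.A.L.nrm (v - u)"
      by (rule P.A.L.nrm_minus_commute[OF P.B.gr_mem(3)[OF uv(1)] P.A.gr_mem(3)[OF uv(2)]])
    then show "P.A.L.nrm (u - v) \<le> \<delta> * P.A.L.nrm f" using P.close[OF uv(2,1)] by simp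
  qed
qed

context cutoff
begin

lemma approximate_eigenvector_down:
  assumes "A.Op.apx z" "0 < e" "4 * ((1 + cmod z) * (cmod z + e)) * (6 * DIM('a) * \<alpha>) \<le> e"
  shows "\<exists>v f. B.Op.gr v f \<and> 0 < l2_norm Q0 v \<and> l2_norm Q0 (f - cscale z v) < e * l2_norm Q0 v"
proof -
  have "0 \<le> 6 * DIM('a) * \<alpha>" using \<alpha>_nonneg by simp
  from form_pair.apx_transfer[OF form_pair assms(1) this assms(2,3)]
  show ?thesis unfolding nrm_l2_inner L2_eq l2_inner_eq l2_norm_eq .
qed

lemma approximate_eigenvector_up:
  assumes "B.Op.apx z" "0 < e" "4 * ((1 + cmod z) * (cmod z + e)) * (6 * DIM('a) * \<alpha>) \<le> e"
  shows "\<exists>v f. A.Op.gr v f \<and> 0 < l2_norm Q1 v \<and> l2_norm Q1 (f - cscale z v) < e * l2_norm Q1 v"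
proof -
  have "0 \<le> 6 * DIM('a) * \<alpha>" using \<alpha>_nonneg by simp
  moreover have "form_operator.apx cscale (L2 Q1) (l2_inner Q1) (W21_zero Q0) B.bform z"
    using assms(1) unfolding L2_eq l2_inner_eq .
  ultimately show ?thesis
    using form_pair.apx_transfer[OF form_pair_sym[OF form_pair], of z e] assms(2,3) unfolding nrm_l2_inner by blast
qed

end

text \<open>A vector of positive norm in the smaller form domain is one in the larger form domain,
  so \<open>apx_ex\<close> applies.\<close>

lemma (in domain_pair) spectrum_nonempty:
  assumes "B.Op.apx z" shows "\<exists>z. A.Op.apx z"
proof -
  obtain u f where uf: "B.Op.gr u f" "l2_norm Q0 (f - cscale z u) < 1 * l2_norm Q0 u"
    using assms zero_less_one unfolding B.Op.apx_def by blast
  have "f - cscale z u \<in> L2 Q0"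
    using B.Op.gr_mem[OF uf(1)] L2_scale by (intro Lsp.mem(3)) auto
  then have "0 \<le> l2_norm Q0 (f - cscale z u)" by (rule Lsp.nrm_nonneg)
  then have "0 < l2_norm Q1 u" using uf(2) by (simp add: l2_norm_eq)
  moreover have "u \<in> W21_zero Q1" using B.Op.gr_mem(1)[OF uf(1)] W21_zero_sub by blast
  ultimately show ?thesis using A.Op.apx_ex by blast
qed

section \<open>Periodicity and the geometry of the two domains\<close>

lemma periodic_union_shift:
  assumes "x \<in> periodic_union d P" shows "(fst x + of_int m * d, snd x) \<in> periodic_union d P"
proof -
  obtain k :: int where "(fst x - of_int k * d, snd x) \<in> P" using assms by (auto simp: periodic_union_def)
  then have "(fst x + of_int m * d - of_int (k + m) * d, snd x) \<in> P" by (simp add: algebra_simps)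
  then show ?thesis unfolding periodic_union_def by (auto intro!: exI[of _ "k + m"])
qed

lemma closure_periodic_union_shift:
  assumes "x \<in> closure (periodic_union d P)" shows "(fst x + of_int m * d, snd x) \<in> closure (periodic_union d P)"
proof -
  let ?f = "\<lambda>x::real\<times>real. (fst x + of_int m * d, snd x)"
  have "?f ` closure (periodic_union d P) \<subseteq> closure (periodic_union d P)"
  proof (rule image_closure_subset)
    show "continuous_on (closure (periodic_union d P)) ?f" by (intro continuous_intros)
    show "?f ` periodic_union d P \<subseteq> closure (periodic_union d P)"
      using periodic_union_shift closure_subset by blast
  qed simp
  then show ?thesis using assms by blast
qed

lemma open_periodic_union: assumes "open P" shows "open (periodic_union d P)"
  unfolding periodic_union_def
proof (intro open_UN ballI)
  fix k :: int
  have "open ((\<lambda>x::real\<times>real. (fst x - of_int k * d, snd x)) -` P)"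
    by (rule open_vimage[OF assms]) (intro continuous_intros)
  then show "open {x. (fst x - of_int k * d, snd x) \<in> P}" by (simp add: vimage_def)
qed

lemma periodic_potential_shift:
  assumes per: "\<forall>x\<in>closure (periodic_union d P). V (fst x + d, snd x) = V x"
    and x: "x \<in> closure (periodic_union d P)"
  shows "V (fst x + of_int m * d, snd x) = V x"
proof -
  have nat: "V (fst y + real n * d, snd y) = V y" if "y \<in> closure (periodic_union d P)" for y and n :: nat
  proof (induction n)
    case (Suc n)
    have "(fst y + real n * d, snd y) \<in> closure (periodic_union d P)"
      using closure_periodic_union_shift[OF that, of "int n"] by simp
    then have "V (fst y + real n * d + d, snd y) = V (fst y + real n * d, snd y)" using per by auto
    then show ?case using Suc by (simp add: algebra_simps)
  qed simp
  show ?thesis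
  proof (cases "0 \<le> m")
    case True
    then show ?thesis using nat[OF x, of "nat m"] by simp
  next
    case False
    have "V (fst x + of_int m * d + real (nat (- m)) * d, snd x) = V (fst x + of_int m * d, snd x)"
      using nat[OF closure_periodic_union_shift[OF x, of m], of "nat (- m)"] by simp
    then show ?thesis using False by simp
  qed
qed

text \<open>By periodicity and the support condition it is enough to bound \<open>V\<close> on a
  compact piece of one period.\<close>

lemma periodic_potential_bounded:
  fixes V :: "real \<times> real \<Rightarrow> real"
  assumes d: "0 < d" and cont: "continuous_on (closure (periodic_union d P)) V"
    and per: "\<forall>x\<in>closure (periodic_union d P). V (fst x + d, snd x) = V x"
    and supp: "\<forall>x\<in>closure (periodic_union d P). \<bar>snd x\<bar> > h \<longrightarrow> V x = 0"
  shows "\<exists>B\<ge>0. \<forall>x\<in>closure (periodic_union d P). \<bar>V x\<bar> \<le> B"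
proof -
  let ?cl = "closure (periodic_union d P)"
  let ?K = "?cl \<inter> ({0..d} \<times> {-h..h})"
  have "compact ?K" by (intro closed_Int_compact closed_closure compact_Times compact_Icc)
  then have "bounded (V ` ?K)"
    by (intro compact_imp_bounded compact_continuous_image continuous_on_subset[OF cont]) auto
  then obtain B where B: "0 < B" "\<And>x. x \<in> ?K \<Longrightarrow> \<bar>V x\<bar> \<le> B" unfolding bounded_pos by auto
  have "\<bar>V x\<bar> \<le> B" if x: "x \<in> ?cl" for x
  proof (cases "\<bar>snd x\<bar> > h")
    case True
    then show ?thesis using supp x B(1) by auto
  next
    case False
    define m where "m = - \<lfloor>fst x / d\<rfloor>"
    define y where "y = (fst x + of_int m * d, snd x)"
    have "of_int \<lfloor>fst x / d\<rfloor> * d \<le> fst x"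
      using of_int_floor_le[of "fst x / d"] d by (simp only: pos_le_divide_eq)
    moreover have "fst x \<le> (of_int \<lfloor>fst x / d\<rfloor> + 1) * d"
      using real_of_int_floor_add_one_ge[of "fst x / d"] d by (simp only: pos_divide_le_eq)
    ultimately
    have "y \<in> ?K"
      using closure_periodic_union_shift[OF x, of m] False by (auto simp: y_def m_def algebra_simps)
    then have "\<bar>V y\<bar> \<le> B" by (rule B(2))
    then show ?thesis using periodic_potential_shift[OF per x, of m] by (simp add: y_def)
  qed
  with B(1) show ?thesis by (intro exI[of _ B]) auto
qed

lemma negligible_walls: "negligible (\<Union>k::int. {x::real\<times>real. fst x = of_int k * d})"
proof (rule negligible_countable_Union)
  have "negligible {x::real\<times>real. x \<bullet> (1, 0) = of_int k * d}" for k :: int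
    by (rule negligible_standard_hyperplane) (auto simp: Basis_prod_def)
  moreover have "{x::real\<times>real. x \<bullet> (1, 0) = c} = {x. fst x = c}" for c by (auto simp: inner_prod_def)
  ultimately show "negligible S" if "S \<in> range (\<lambda>k::int. {x::real\<times>real. fst x = of_int k * d})" for S
    using that by auto
qed simp

text \<open>A wall point inside a translate of \<open>P\<close> would give an integer strictly
  between 0 and 1, so wall points enter the domain only through the gates.\<close>

lemma perturbed_domain_wall:
  assumes d: "0 < d" and strip: "P \<subseteq> {x. 0 < fst x \<and> fst x < d}" and y: "\<epsilon> \<le> \<bar>y\<bar>"
  shows "(of_int k * d, y) \<notin> perturbed_domain d P \<epsilon>"
proof
  assume "(of_int k * d, y) \<in> perturbed_domain d P \<epsilon>"
  then obtain j :: int where "(of_int k * d - of_int j * d, y) \<in> P"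
    using y by (auto simp: perturbed_domain_def periodic_union_def)
  then have "0 < of_int k * d - of_int j * d" "of_int k * d - of_int j * d < 1 * d" using strip by auto
  then have "0 < of_int (k - j) * d" "of_int (k - j) * d < 1 * d" by (simp_all add: left_diff_distrib)
  then have "0 < real_of_int (k - j)" "real_of_int (k - j) < 1"
    using d by (simp_all only: zero_less_mult_iff mult_less_cancel_right) auto
  then have "0 < k - j" "k - j < 1" by (simp_all only: of_int_0_less_iff of_int_less_1_iff)
  then show False by linarith
qed

lemma perturbed_domain_away_from_gates:
  assumes "0 < d" "x \<in> perturbed_domain d P \<epsilon>" "2 * \<epsilon>\<^sup>2 \<le> gate_dist_sq d \<epsilon> x" "0 < \<epsilon>"
  shows "x \<in> periodic_union d P"
proof (rule ccontr)
  assume "x \<notin> periodic_union d P"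
  then obtain k :: int where k: "fst x = of_int k * d" "\<bar>snd x\<bar> < \<epsilon>"
    using assms(2) by (auto simp: perturbed_domain_def)
  have "sin (pi * fst x / d) = 0" using assms(1) by (simp add: k sin_zero_iff_int2 mult.commute) 
  moreover have "\<bar>snd x\<bar>\<^sup>2 < \<epsilon>\<^sup>2" by (rule power_strict_mono[OF k(2)]) auto
  ultimately show False using assms(3) by (simp add: gate_dist_sq_def)
qed

text \<open>The gates lie in the closure of \<open>periodic_union\<close>, where \<open>V\<close> is
  bounded, so that one constant \<open>B\<close> serves both domains.\<close>

lemma waveguide_domain_pair:
  fixes P :: "(real \<times> real) set" and V :: "real \<times> real \<Rightarrow> real"
  assumes P: "open P" and cont: "continuous_on (closure (periodic_union d P)) V"
    and B: "0 \<le> B" "\<forall>x\<in>closure (periodic_union d P). \<bar>V x\<bar> \<le> B"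
    and wall: "{x. fst x = 0 \<and> \<bar>snd x\<bar> < \<epsilon>} \<subseteq> closure P"
  shows "domain_pair (perturbed_domain d P \<epsilon>) (periodic_union d P) V B"
proof -
  let ?Q0 = "periodic_union d P" and ?Q1 = "perturbed_domain d P \<epsilon>"
  have sub: "?Q0 \<subseteq> ?Q1" by (auto simp: perturbed_domain_def)
  have op: "open ?Q0" by (rule open_periodic_union[OF P])
  have null: "negligible (?Q1 - ?Q0)"
    by (rule negligible_subset[OF negligible_walls[of d]]) (auto simp: perturbed_domain_def)
  have Q0: "?Q0 \<in> sets lebesgue" using op by (auto intro: sets_completionI_sets)
  have cl: "?Q1 \<subseteq> closure ?Q0"
  proof
    fix x assume "x \<in> ?Q1"
    then consider "x \<in> ?Q0" | k :: int where "fst x = of_int k * d" "\<bar>snd x\<bar> < \<epsilon>"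
      by (auto simp: perturbed_domain_def)
    then show "x \<in> closure ?Q0"
    proof cases
      case 1
      then show ?thesis using closure_subset by blast
    next
      case (2 k)
      have "P \<subseteq> ?Q0" unfolding periodic_union_def by (auto intro!: exI[of _ 0])
      then have "closure P \<subseteq> closure ?Q0" by (rule closure_mono)
      moreover have "(0, snd x) \<in> closure P" using wall 2 by auto
      ultimately have "(0, snd x) \<in> closure ?Q0" by blast
      from closure_periodic_union_shift[OF this, of k] 2 show ?thesis by (metis add_0 fst_conv prod.collapse snd_conv)
    qed
  qed
  have m0: "V \<in> borel_measurable (lebesgue_on ?Q0)"
    by (rule continuous_imp_measurable_on_sets_lebesgue[OF continuous_on_subset[OF cont closure_subset] Q0])
  show ?thesis
  proof (intro domain_pair.intro domain_pair_axioms.intro schroedinger.intro schroedinger_axioms.intro ae_open.intro)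
    show "negligible (?Q1 - interior ?Q1)"
      by (rule negligible_subset[OF null]) (use interior_maximal[OF sub op] in blast)
    show "negligible (?Q0 - interior ?Q0)" using op by (simp add: interior_open)
    show "V \<in> borel_measurable (lebesgue_on ?Q1)"
      using lebesgue_on_measurable_null_extend[OF sub null Q0, of V] m0 by blast
    show "\<bar>V x\<bar> \<le> B" if "x \<in> ?Q1" for x using that cl B(2) by blast
    show "\<bar>V x\<bar> \<le> B" if "x \<in> ?Q0" for x using that sub cl B(2) by blast
  qed (use m0 sub null B(1) in auto)
qed

theorem theorem2:
  fixes P :: "(real \<times> real) set" and V :: "real \<times> real \<Rightarrow> real"
    and d x2inf x20 a_plus a_minus :: real
  assumes "open P" and "connected P" and "P \<noteq> {}" and "\<not> bounded P"
    and "has_Ck_boundary 3 P"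
    and "d > 0" and "P \<subseteq> {x. 0 < fst x \<and> fst x < d}"
    and "x2inf > 0"
    and "0 \<le> a_plus" and "a_plus + 1 \<le> d"
    and "0 \<le> a_minus" and "a_minus + 1 \<le> d"
    and "P \<inter> {x. snd x > x2inf} = {x. a_plus < fst x \<and> fst x < a_plus + 1 \<and> snd x > x2inf}"
    and "P \<inter> {x. - snd x > x2inf} = {x. a_minus < fst x \<and> fst x < a_minus + 1 \<and> - snd x > x2inf}"
    and "x20 > 0"
    and "frontier P \<inter> {x. \<bar>snd x\<bar> < x20} =
           {x. fst x = 0 \<and> \<bar>snd x\<bar> < x20} \<union> {x. fst x = d \<and> \<bar>snd x\<bar> < x20}"
    and "smooth_on_closure V (periodic_union d P)"
    and "\<forall>x\<in>closure (periodic_union d P). V (fst x + d, snd x) = V x"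
    and "\<forall>x\<in>closure (periodic_union d P). \<bar>snd x\<bar> > x2inf \<longrightarrow> V x = 0"
  shows "(\<forall>z. z \<notin> spectrum (periodic_union d P) (schroedinger_operator (periodic_union d P) V) \<longrightarrow>
            (\<forall>\<^sub>F \<epsilon> in at_right 0.
               z \<notin> spectrum (perturbed_domain d P \<epsilon>) (schroedinger_operator (perturbed_domain d P \<epsilon>) V))) \<and>
         (\<forall>z. z \<in> spectrum (periodic_union d P) (schroedinger_operator (periodic_union d P) V) \<longrightarrow>
            (\<exists>\<mu> :: real \<Rightarrow> complex.
               (\<forall>\<epsilon>. 0 < \<epsilon> \<and> \<epsilon> < x20 \<longrightarrow>
                    \<mu> \<epsilon> \<in> spectrum (perturbed_domain d P \<epsilon>)
                             (schroedinger_operator (perturbed_domain d P \<epsilon>) V)) \<and>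
               (\<mu> \<longlongrightarrow> z) (at_right 0)))"
proof -
  let ?Q0 = "periodic_union d P" and ?Q1 = "perturbed_domain d P"
  let ?s0 = "spectrum ?Q0 (schroedinger_operator ?Q0 V)"
  let ?s1 = "\<lambda>\<epsilon>. spectrum (?Q1 \<epsilon>) (schroedinger_operator (?Q1 \<epsilon>) V)"
  note d = \<open>d > 0\<close>
  have cont: "continuous_on (closure ?Q0) V" using assms by (simp add: smooth_on_closure_def)
  obtain B where B: "0 \<le> B" "\<forall>x\<in>closure ?Q0. \<bar>V x\<bar> \<le> B"
    using periodic_potential_bounded[OF d cont assms(18,19)] by blast
  have pair: "domain_pair (?Q1 \<epsilon>) ?Q0 V B" if "\<epsilon> < x20" for \<epsilon>
  proof (rule waveguide_domain_pair[OF assms(1) cont B])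
    have "{x. fst x = 0 \<and> \<bar>snd x\<bar> < \<epsilon>} \<subseteq> frontier P \<inter> {x. \<bar>snd x\<bar> < x20}"
      unfolding assms(16) using that by auto
    then show "{x. fst x = 0 \<and> \<bar>snd x\<bar> < \<epsilon>} \<subseteq> closure P" by (auto simp: frontier_def)
  qed
  have ev: "\<forall>\<^sub>F \<epsilon> in at_right 0. 0 < \<epsilon> \<and> \<epsilon> < x20 \<and> (\<exists>\<theta> K. cutoff (?Q1 \<epsilon>) ?Q0 V B \<theta> K \<alpha>)" if \<alpha>: "0 < \<alpha>" for \<alpha>
  proof (rule gate_cutoff_cutoff[OF d \<alpha>])
    fix \<epsilon>0 :: real
    assume \<epsilon>0: "0 < \<epsilon>0"
      "\<And>\<epsilon> Q1 Q0 V B. \<lbrakk>0 < \<epsilon>; \<epsilon> < \<epsilon>0; domain_pair Q1 Q0 V B;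
         \<And>(k::int) y. \<epsilon> \<le> \<bar>y\<bar> \<Longrightarrow> (of_int k * d, y) \<notin> Q1;
         \<And>x. x \<in> Q1 \<Longrightarrow> 2 * \<epsilon>\<^sup>2 \<le> gate_dist_sq d \<epsilon> x \<Longrightarrow> x \<in> Q0\<rbrakk>
       \<Longrightarrow> \<exists>\<theta> K. cutoff Q1 Q0 V B \<theta> K \<alpha>"
    have "\<forall>\<^sub>F \<epsilon> in at_right 0. \<epsilon> \<in> {0<..<min \<epsilon>0 x20}"
      using \<epsilon>0(1) assms(15) by (intro eventually_at_right_real) simp
    then show ?thesis
    proof eventually_elim
      case (elim \<epsilon>)
      then have e: "0 < \<epsilon>" "\<epsilon> < \<epsilon>0" "\<epsilon> < x20" by auto
      have "\<exists>\<theta> K. cutoff (?Q1 \<epsilon>) ?Q0 V B \<theta> K \<alpha>"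
        by (rule \<epsilon>0(2)[OF e(1,2) pair[OF e(3)] perturbed_domain_wall[OF d assms(7)]
              perturbed_domain_away_from_gates[OF d _ _ e(1)]])
      then show ?case using e by blast
    qed
  qed
  interpret B0: schroedinger ?Q0 V B
    using pair[of 0] assms(15) by (simp add: domain_pair_def)
  \<comment> \<open>Chooses \<alpha> for the transfer of approximate eigenvectors with error
    \<open>e\<close>; \<open>6 * DIM * \<alpha>\<close> is the \<delta> of
    \<open>form_pair\<close>.\<close>
  have small_ex: "\<exists>\<alpha>::real. 0 < \<alpha> \<and> 4 * ((1 + cmod \<zeta>) * (cmod \<zeta> + e)) * (6 * DIM(real \<times> real) * \<alpha>) \<le> e"
    if "0 < e" for \<zeta> :: complex and e :: real
  proof -
    define c where "c = 4 * ((1 + cmod \<zeta>) * (cmod \<zeta> + e)) * (6 * DIM(real \<times> real))"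
    have "0 < c" unfolding c_def using that by (intro mult_pos_pos add_pos_nonneg add_nonneg_pos) auto
    then have "0 < e / c" "c * (e / c) \<le> e" using that by auto
    then show ?thesis unfolding c_def mult.assoc by blast
  qed
  let ?c = "complex_of_real (B + 1)"
  show ?thesis
  proof (intro conjI allI impI)
    fix z assume "z \<notin> ?s0"
    then have "\<not> B0.Op.apx (z + ?c)" using B0.spectrum_iff by blast
    then obtain e where e: "0 < e" "\<And>u f. B0.Op.gr u f \<Longrightarrow> e * l2_norm ?Q0 u \<le> l2_norm ?Q0 (f - cscale (z + ?c) u)"
      by (rule B0.Op.not_apx) blast
    obtain \<alpha> :: real where \<alpha>: "0 < \<alpha>" "4 * ((1 + cmod (z + ?c)) * (cmod (z + ?c) + e)) * (6 * DIM(real \<times> real) * \<alpha>) \<le> e"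
      using small_ex[OF e(1)] by blast
    \<comment> \<open>If \<open>z\<close> were in the perturbed spectrum, an approximate eigenvector
      there would transfer to the unperturbed operator and violate the lower bound
      \<open>e\<close>.\<close>
    from ev[OF \<alpha>(1)] show "\<forall>\<^sub>F \<epsilon> in at_right 0. z \<notin> ?s1 \<epsilon>"
    proof eventually_elim
      case (elim \<epsilon>)
      then obtain \<theta> K where "cutoff (?Q1 \<epsilon>) ?Q0 V B \<theta> K \<alpha>" by blast
      then interpret C: cutoff "?Q1 \<epsilon>" ?Q0 V B \<theta> K \<alpha> .
      show ?case
      proof
        assume "z \<in> ?s1 \<epsilon>"
        then have "C.A.Op.apx (z + ?c)" using C.A.spectrum_iff by blast
        from C.approximate_eigenvector_down[OF this e(1) \<alpha>(2)] e(2) show False by (meson not_less)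
      qed
    qed
  next
    fix z assume "z \<in> ?s0"
    then have apx: "B0.Op.apx (z + ?c)" using B0.spectrum_iff by blast
    \<comment> \<open>\<open>apx_near\<close> is formulated at a real point, and approximate
      eigenvalues are real.\<close>
    define r where "r = Re (z + ?c)"
    have r: "z + ?c = of_real r" using B0.Op.apx_real[OF apx] by (simp add: r_def complex_eq_iff)
    \<comment> \<open>\<open>\<mu>\<close> has to take spectral values for all
      \<open>\<epsilon> < x20\<close>, also where the resolvents are not known to be close.\<close>
    have ne: "?s1 \<epsilon> \<noteq> {}" if "\<epsilon> < x20" for \<epsilon>
    proof -
      interpret D: domain_pair "?Q1 \<epsilon>" ?Q0 V B by (rule pair[OF that])
      obtain w where "D.A.Op.apx w" using D.spectrum_nonempty apx by blast
      then have "w - ?c \<in> ?s1 \<epsilon>" using D.A.spectrum_iff[of "w - ?c"] by simp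
      then show ?thesis by blast
    qed
    have near: "\<forall>\<^sub>F \<epsilon> in at_right 0. infdist z (?s1 \<epsilon>) \<le> e" if e: "0 < e" for e
    proof -
      obtain \<alpha> :: real where \<alpha>: "0 < \<alpha>" "4 * ((1 + cmod (z + ?c)) * (cmod (z + ?c) + e)) * (6 * DIM(real \<times> real) * \<alpha>) \<le> e"
        using small_ex[OF e] by blast
      from ev[OF \<alpha>(1)] show ?thesis
      proof eventually_elim
        case (elim \<epsilon>)
        then obtain \<theta> K where "cutoff (?Q1 \<epsilon>) ?Q0 V B \<theta> K \<alpha>" by blast
        then interpret C: cutoff "?Q1 \<epsilon>" ?Q0 V B \<theta> K \<alpha> .
        obtain v f where vf: "C.A.Op.gr v f" "0 < l2_norm (?Q1 \<epsilon>) v"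
            "l2_norm (?Q1 \<epsilon>) (f - cscale (z + ?c) v) < e * l2_norm (?Q1 \<epsilon>) v"
          using C.approximate_eigenvector_up[OF apx e \<alpha>(2)] by blast
        obtain w where w: "C.A.Op.apx (of_real w)" "\<bar>w - r\<bar> \<le> e"
          using C.A.Op.apx_near[OF vf(1) _ vf(2), of r e] vf(3) unfolding r by auto
        have "of_real w - ?c \<in> ?s1 \<epsilon>" using w(1) C.A.spectrum_iff[of "of_real w - ?c"] by simp
        then have "infdist z (?s1 \<epsilon>) \<le> dist z (of_real w - ?c)" by (rule infdist_le)
        also have "dist z (of_real w - ?c) = cmod ((z + ?c) - of_real w)" by (simp add: dist_norm algebra_simps)
        also have "\<dots> = \<bar>r - w\<bar>" unfolding r by (simp only: of_real_diff[symmetric] norm_of_real)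
        finally show ?case using w(2) by simp
      qed
    qed
    \<comment> \<open>A nearest point up to the error \<open>\<epsilon>\<close>, which vanishes in
      the limit; no appeal to closedness of the spectrum is made.\<close>
    have "\<exists>m. m \<in> ?s1 \<epsilon> \<and> dist z m < infdist z (?s1 \<epsilon>) + \<epsilon>" if "0 < \<epsilon>" "\<epsilon> < x20" for \<epsilon>
    proof -
      have "Inf (dist z ` ?s1 \<epsilon>) < infdist z (?s1 \<epsilon>) + \<epsilon>" using ne[OF that(2)] that(1) by (simp add: infdist_notempty)
      then show ?thesis using cInf_lessD[of "dist z ` ?s1 \<epsilon>"] ne[OF that(2)] by blast
    qed
    then obtain \<mu> where \<mu>: "\<And>\<epsilon>. 0 < \<epsilon> \<Longrightarrow> \<epsilon> < x20 \<Longrightarrow> \<mu> \<epsilon> \<in> ?s1 \<epsilon> \<and> dist z (\<mu> \<epsilon>) < infdist z (?s1 \<epsilon>) + \<epsilon>"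
      by metis
    have "(\<mu> \<longlongrightarrow> z) (at_right 0)"
    proof (rule tendstoI)
      fix e :: real assume "0 < e"
      then have "0 < e / 2" by simp
      from near[OF this] have "\<forall>\<^sub>F \<epsilon> in at_right 0. infdist z (?s1 \<epsilon>) \<le> e / 2" .
      moreover have "\<forall>\<^sub>F \<epsilon> in at_right 0. \<epsilon> \<in> {0<..<min (e / 2) x20}"
        using \<open>0 < e / 2\<close> assms(15) by (intro eventually_at_right_real) simp
      ultimately show "\<forall>\<^sub>F \<epsilon> in at_right 0. dist (\<mu> \<epsilon>) z < e"
      proof eventually_elim
        case (elim \<epsilon>)
        then show ?case using \<mu>[of \<epsilon>] by (simp add: dist_commute)
      qed
    qed
    then show "\<exists>\<mu>. (\<forall>\<epsilon>. 0 < \<epsilon> \<and> \<epsilon> < x20 \<longrightarrow> \<mu> \<epsilon> \<in> ?s1 \<epsilon>) \<and> (\<mu> \<longlongrightarrow> z) (at_right 0)"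
      using \<mu> by (intro exI[of _ \<mu>]) blast
  qed
qed

end
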